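(* Let $N\ge1$ and let $\Omega\subsetneq\mathbb R^N$ be a non-empty bounded open convex set. If $N=1$, then $$\mathfrak h_{s,1}(\Omega)=2^{-s}\,\mathfrak h_{s,1}(\mathbb H^1_+)=\frac{2^{2-s}}{s}\quad\text{for all } s\in(0,1),$$ and the constant $\mathfrak h_{s,1}(\Omega)$ is attained in $\mathcal W^{s,1}_0(\Omega)$. If $N\ge2$, then $$\lim_{s\to1^-}\frac{\mathfrak h_{s,1}(\Omega)}{\mathfrak h_{s,1}(\mathbb H^N_+)}=\frac12.$$
   Context: For $N\ge1$, a non-empty open set $\Omega\subsetneq\mathbb R^N$ and $x\in\Omega$, $d_\Omega(x)=\inf_{y\in\partial\Omega}|x-y|$. $C^\infty_0(\Omega)$ is the set of smooth real functions on $\mathbb R^N$ with compact support contained in $\Omega$. For $s\in(0,1)$ and measurable $u$ on $\mathbb R^N$, $$[u]_{W^{s,1}(\mathbb R^N)}=\int_{\mathbb R^N}\int_{\mathbb R^N}\frac{|u(x)-u(y)|}{|x-y|^{N+s}}\,dx\,dy,$$ $$\mathfrak h_{s,1}(\Omega)=\inf_{u\in C^\infty_0(\Omega)}\Big\{[u]_{W^{s,1}(\mathbb R^N)}:\int_\Omega\frac{|u|}{d_\Omega^s}\,dx=1\Big\}\in[0,\infty).$$ $\mathbb H^1_+=(0,\infty)$ and $\mathbb H^N_+=\mathbb R^{N-1}\times(0,\infty)$ for $N\ge2$. $\mathcal W^{s,1}_0(\Omega)$ is the completion of $C_0^\infty(\Omega)$ with respect to $[\cdot]_{W^{s,1}(\mathbb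 R^N)}$, identified with a space of functions, namely the closure of $C^\infty_0(\Omega)$ in $\{u\in L^{N/(N-s)}(\mathbb R^N):[u]_{W^{s,1}(\mathbb R^N)}<\infty\}$ with respect to this seminorm. "$\mathfrak h_{s,1}(\Omega)$ is attained in $\mathcal W^{s,1}_0(\Omega)$" means that there is $u\in\mathcal W^{s,1}_0(\Omega)$ with $\int_\Omega |u|/d_\Omega^s\,dx=1$ and $[u]_{W^{s,1}(\mathbb R^N)}=\mathfrak h_{s,1}(\Omega)$. *)

theory Defs
  imports "HOL-Analysis.Analysis"
begin

primrec k_times_cont_diff :: "nat \<Rightarrow> ('a::euclidean_space \<Rightarrow> real) \<Rightarrow> bool" where
  "k_times_cont_diff 0 f \<longleftrightarrow> continuous_on UNIV f"
| "k_times_cont_diff (Suc k) f \<longleftrightarrow>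
     (\<forall>x. f differentiable (at x)) \<and>
     (\<forall>v. k_times_cont_diff k (\<lambda>x. frechet_derivative f (at x) v))"

definition smooth :: "('a::euclidean_space \<Rightarrow> real) \<Rightarrow> bool" where
  "smooth f \<longleftrightarrow> (\<forall>k. k_times_cont_diff k f)"

definition test_functions :: "'a::euclidean_space set \<Rightarrow> ('a \<Rightarrow> real) set" where
  "test_functions \<Omega> =
     {u. smooth u \<and> compact (closure {x. u x \<noteq> 0}) \<and> closure {x. u x \<noteq> 0} \<subseteq> \<Omega>}"

definition boundary_dist :: "'a::euclidean_space set \<Rightarrow> 'a \<Rightarrow> real" where
  "boundary_dist \<Omega> x = infdist x (frontier \<Omega>)"

(* On the diagonal the quotient is 0 / 0 = 0, which does not affect the integral. *)
definition gagliardo_seminorm :: "real \<Rightarrow> ('a::euclidean_space \<Rightarrow> real) \<Rightarrow> ennreal" where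
  "gagliardo_seminorm s u =
     (\<integral>\<^sup>+ x. (\<integral>\<^sup>+ y.
        ennreal (\<bar>u x - u y\<bar> / norm (x - y) powr (real DIM('a) + s)) \<partial>lebesgue) \<partial>lebesgue)"

definition hardy_integral :: "real \<Rightarrow> 'a::euclidean_space set \<Rightarrow> ('a \<Rightarrow> real) \<Rightarrow> ennreal" where
  "hardy_integral s \<Omega> u =
     (\<integral>\<^sup>+ x \<in> \<Omega>. ennreal (\<bar>u x\<bar> / boundary_dist \<Omega> x powr s) \<partial>lebesgue)"

definition hardy_constant :: "real \<Rightarrow> 'a::euclidean_space set \<Rightarrow> ennreal" where
  "hardy_constant s \<Omega> =
     Inf {gagliardo_seminorm s u | u. u \<in> test_functions \<Omega> \<and> hardy_integral s \<Omega> u = 1}"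

(* The functions in L^(N/(N-s)) with finite seminorm, as representatives of a.e. classes. *)
definition sobolev_ambient :: "real \<Rightarrow> ('a::euclidean_space \<Rightarrow> real) set" where
  "sobolev_ambient s =
     {u. u \<in> borel_measurable lebesgue \<and>
         (\<integral>\<^sup>+ x. ennreal (\<bar>u x\<bar> powr (real DIM('a) / (real DIM('a) - s))) \<partial>lebesgue) < \<infinity> \<and>
         gagliardo_seminorm s u < \<infinity>}"

definition sobolev0 :: "real \<Rightarrow> 'a::euclidean_space set \<Rightarrow> ('a \<Rightarrow> real) set" where
  "sobolev0 s \<Omega> =
     {u \<in> sobolev_ambient s. \<forall>\<epsilon>>0. \<exists>\<phi>\<in>test_functions \<Omega>.
        gagliardo_seminorm s (\<lambda>x. u x - \<phi> x) < ennreal \<epsilon>}"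

definition hardy_constant_attained :: "real \<Rightarrow> 'a::euclidean_space set \<Rightarrow> bool" where
  "hardy_constant_attained s \<Omega> \<longleftrightarrow>
     (\<exists>u\<in>sobolev0 s \<Omega>. hardy_integral s \<Omega> u = 1 \<and> gagliardo_seminorm s u = hardy_constant s \<Omega>)"

(* R^N has no distinguished last coordinate for an unordered index type 'n; the index k
   plays that role. For CARD('n) = 1 this is the half-line. *)
definition half_space :: "'n::finite \<Rightarrow> (real ^ 'n) set" where
  "half_space k = {x. x $ k > 0}"

end

theory Submission
  imports Defs
begin

text \<open>
  Lower bounds. For convex \<open>\<Omega>\<close>, keeping only the interactions between \<open>\<Omega>\<close> and its complement, and
  enclosing \<open>\<Omega>\<close> in a half-space at distance at most \<open>d(x)\<close> from \<open>x\<close>, bounds the Hardy constant below by a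
  directional moment \<open>K\<close> of the kernel. In a half-space the interactions inside it contribute as much
  again, since the integral of \<open>|u(x + z) - u(x)|\<close> over it is at least the mass of \<open>u\<close> in the slab
  \<open>0 < x\<^sub>N < z\<^sub>N\<close>; this gives \<open>2 K\<close>.

  Upper bounds. Mollified cutoffs of \<open>min (d / r) 1\<close> have gradient of size \<open>1 / r\<close> on the layer
  \<open>{d \<le> r}\<close>, so their seminorm is at most \<open>K M / (1 - s) + O(1)\<close>, where \<open>M\<close> is the lower limit of
  \<open>|{d \<le> r}| / r\<close>. The layer cake formula bounds the Hardy integral below by \<open>M / (1 - s)\<close> up to a
  factor close to one, and the quotient tends to \<open>K\<close>. No regularity of the boundary is needed,
  because the same \<open>M\<close> enters both bounds. In a half-space flat boxes are used instead, only one
  face of which lies on the boundary.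

  In dimension one the indicator of an interval is extremal: by the coarea formula it suffices to
  compare sets, where the fractional isoperimetric inequality and the bathtub principle are
  simultaneously sharp.
\<close>

section \<open>Lebesgue measure in polar coordinates\<close>

text \<open>The ratio 1/2 counts boundary. For s near 1 the seminorm of a cutoff of a set E is about
  K / (1 - s) times the perimeter of E, and its Hardy integral about 1 / (1 - s) times the part of
  that perimeter lying on the boundary of \<Omega>. A bounded \<Omega> can be used whole, so the two
  agree. A bounded subset of a half-space has, by projection, at least as much perimeter inside as
  on the boundary hyperplane, which doubles the quotient; wide boxes of fixed height nearly reach
  the bound. The lower bounds hold at every s with K(s) / s and 2 K(s) / s, where K(s) is
  \<open>dir_moment e s\<close>, and K(s) / s is at least K(1); only the upper bounds involve a
  limit. In dimension one K(s) = 2. The half-line constant is exactly 4 / s, but the convex bound 2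
  / s stays below 2 powr (2 - s) / s, as it ignores the complement beyond the farther endpoint;
  hence the separate route through superlevel sets. The radius R separating near from far
  translations is kept free. The limit uses R = 1, while the exact value on an interval needs R
  equal to its length.\<close>

lemma nn_integral_lborel_translate:
  fixes f :: "'a::euclidean_space \<Rightarrow> ennreal"
  assumes [measurable]: "f \<in> borel_measurable borel"
  shows "(\<integral>\<^sup>+ x. f (x + c) \<partial>lborel) = (\<integral>\<^sup>+ x. f x \<partial>lborel)"
proof -
  have "(\<integral>\<^sup>+ x. f x \<partial>lborel) = (\<integral>\<^sup>+ x. f x \<partial>distr lborel borel ((+) c))"
    by (simp add: lborel_distr_plus)
  also have "\<dots> = (\<integral>\<^sup>+ x. f (c + x) \<partial>lborel)"
    by (subst nn_integral_distr) auto
  finally show ?thesis by (simp add: add.commute)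
qed

lemma nn_integral_lborel_scale:
  fixes f :: "'a::euclidean_space \<Rightarrow> ennreal"
  assumes [measurable]: "f \<in> borel_measurable borel" and "c \<noteq> 0"
  shows "(\<integral>\<^sup>+ x. f x \<partial>lborel) = ennreal (\<bar>c\<bar> ^ DIM('a)) * (\<integral>\<^sup>+ x. f (c *\<^sub>R x) \<partial>lborel)"
  by (subst lborel_affine[OF \<open>c \<noteq> 0\<close>, of 0])
     (simp add: nn_integral_density nn_integral_distr nn_integral_cmult)

lemma nn_integral_lborel_minus:
  fixes f :: "'a::euclidean_space \<Rightarrow> ennreal"
  assumes [measurable]: "f \<in> borel_measurable borel"
  shows "(\<integral>\<^sup>+ x. f (- x) \<partial>lborel) = (\<integral>\<^sup>+ x. f x \<partial>lborel)"
  using nn_integral_lborel_scale[OF assms, of "-1"] by simp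

text \<open>Both measures are translation invariant, so Tonelli's theorem gives
  \<open>\<integral>f d\<mu> \<integral>g d\<lambda> = \<integral>g d\<mu> \<integral>f d\<lambda>\<close> for the image \<open>\<mu>\<close> of Lebesgue measure \<open>\<lambda>\<close>; the unit ball
  as \<open>g\<close> shows that the proportionality factor is one.\<close>

lemma nn_integral_lborel_orthogonal:
  fixes f :: "'a::euclidean_space \<Rightarrow> ennreal" and T :: "'a \<Rightarrow> 'a"
  assumes T: "orthogonal_transformation T" and f [measurable]: "f \<in> borel_measurable borel"
  shows "(\<integral>\<^sup>+ x. f (T x) \<partial>lborel) = (\<integral>\<^sup>+ x. f x \<partial>lborel)"
proof -
  have lin: "linear T" using T by (rule orthogonal_transformation_linear)
  have [measurable]: "T \<in> borel_measurable borel"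
    using lin by (simp add: borel_measurable_continuous_onI linear_continuous_on linear_conv_bounded_linear)
  have norm_T: "norm (T x) = norm x" for x
    using T by (simp add: orthogonal_transformation_norm)
  have inj_T: "inj T"
  proof (rule injI)
    fix x y assume "T x = T y"
    then have "T (x - y) = 0" by (simp add: linear_diff[OF lin])
    then show "x = y" using norm_T[of "x - y"] by simp
  qed
  then have "surj T" using lin by (simp add: linear_injective_imp_surjective)
  then obtain T' where T': "\<And>x. T (T' x) = x"
    by (metis surjD)
  define g where "g = (indicator (ball 0 1) :: 'a \<Rightarrow> ennreal)"
  have [measurable]: "g \<in> borel_measurable borel" unfolding g_def by (intro borel_measurable_indicator) simp
  have gT: "g (T x) = g x" for x by (simp add: g_def indicator_def norm_T)
  have gm: "g (- x) = g x" for x by (simp add: g_def indicator_def)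
  have g_int: "(\<integral>\<^sup>+ x. g x \<partial>lborel) = emeasure lborel (ball 0 1 :: 'a set)"
    by (simp add: g_def)
  have "(\<integral>\<^sup>+ x. f (T x) \<partial>lborel) * (\<integral>\<^sup>+ y. g y \<partial>lborel)
      = (\<integral>\<^sup>+ x. (\<integral>\<^sup>+ y. f (T x) * g (y + T x) \<partial>lborel) \<partial>lborel)"
    by (simp add: nn_integral_cmult nn_integral_multc nn_integral_lborel_translate)
  also have "\<dots> = (\<integral>\<^sup>+ y. (\<integral>\<^sup>+ x. f (T x) * g (y + T x) \<partial>lborel) \<partial>lborel)"
    by (rule lborel_pair.Fubini') measurable
  also have "\<dots> = (\<integral>\<^sup>+ y. (\<integral>\<^sup>+ x. f (T x - y) * g (T x) \<partial>lborel) \<partial>lborel)"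
  \<comment> \<open>For fixed y the shift x -> x - T' y removes the offset from \<open>g\<close> and
    hands it to \<open>f\<close>; this is where surjectivity of T enters.\<close>
  proof (rule nn_integral_cong)
    fix y
    have "(\<integral>\<^sup>+ x. f (T x) * g (y + T x) \<partial>lborel) = (\<integral>\<^sup>+ x. f (T (x + - T' y)) * g (y + T (x + - T' y)) \<partial>lborel)"
      by (rule nn_integral_lborel_translate[symmetric]) measurable
    then show "(\<integral>\<^sup>+ x. f (T x) * g (y + T x) \<partial>lborel) = (\<integral>\<^sup>+ x. f (T x - y) * g (T x) \<partial>lborel)"
      by (simp add: linear_diff[OF lin] T')
  qed
  also have "\<dots> = (\<integral>\<^sup>+ x. (\<integral>\<^sup>+ y. f (T x - y) * g (T x) \<partial>lborel) \<partial>lborel)"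
    by (rule lborel_pair.Fubini') measurable
  also have "\<dots> = (\<integral>\<^sup>+ x. (\<integral>\<^sup>+ y. f y \<partial>lborel) * g x \<partial>lborel)"
  proof (rule nn_integral_cong)
    fix x
    have "(\<integral>\<^sup>+ y. f (T x - y) \<partial>lborel) = (\<integral>\<^sup>+ y. f (T x - (- y)) \<partial>lborel)"
      by (rule nn_integral_lborel_minus[symmetric]) measurable
    also have "\<dots> = (\<integral>\<^sup>+ y. f y \<partial>lborel)"
      using nn_integral_lborel_translate[OF f, of "T x"] by (simp add: add.commute)
    finally show "(\<integral>\<^sup>+ y. f (T x - y) * g (T x) \<partial>lborel) = (\<integral>\<^sup>+ y. f y \<partial>lborel) * g x"
      by (simp add: nn_integral_multc gT)
  qed
  also have "\<dots> = (\<integral>\<^sup>+ y. f y \<partial>lborel) * (\<integral>\<^sup>+ x. g x \<partial>lborel)"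
    by (simp add: nn_integral_cmult)
  finally have eq: "(\<integral>\<^sup>+ x. f (T x) \<partial>lborel) * emeasure lborel (ball 0 1 :: 'a set)
      = (\<integral>\<^sup>+ x. f x \<partial>lborel) * emeasure lborel (ball 0 1 :: 'a set)"
    by (simp only: g_int)
  have "emeasure lborel (ball 0 1 :: 'a set) \<noteq> 0"
    using emeasure_lborel_ball_finite[of "0::'a" 1] content_ball_pos[of 1 "0::'a"]
    by (auto simp: emeasure_eq_ennreal_measure)
  moreover have "emeasure lborel (ball 0 1 :: 'a set) \<noteq> \<infinity>"
    using emeasure_lborel_ball_finite[of "0::'a" 1] by auto
  ultimately show ?thesis
    using eq by (simp add: mult.commute[of _ "emeasure lborel (ball 0 1)"] ennreal_mult_cancel_left)
qed

definition shell :: "'a::euclidean_space set" where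
  "shell = {y. 1 < norm y \<and> norm y < exp 1}"

lemma sets_shell [measurable]: "shell \<in> sets borel"
  unfolding shell_def by measurable

lemma nn_integral_inverse_Ioo:
  assumes "0 < a" "a \<le> b"
  shows "(\<integral>\<^sup>+ r. ennreal (1 / r) * indicator {a<..<b} r \<partial>lborel) = ennreal (ln (b / a))"
proof -
  have "(\<integral>\<^sup>+ r. ennreal (1 / r) * indicator {a<..<b} r \<partial>lborel)
      = (\<integral>\<^sup>+ r. ennreal (1 / r) * indicator {a..b} r \<partial>lborel)"
  proof (rule nn_integral_cong_AE)
    show "AE r in lborel. ennreal (1 / r) * indicator {a<..<b} r = ennreal (1 / r) * indicator {a..b} r"
      using AE_lborel_singleton[of a] AE_lborel_singleton[of b]
      by eventually_elim (auto simp: indicator_def)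
  qed
  also have "\<dots> = ennreal (ln b - ln a)"
    using assms by (intro nn_integral_FTC_Icc) (auto intro!: derivative_eq_intros simp: field_simps)
  finally show ?thesis using assms by (simp add: ln_div)
qed

text \<open>Polar coordinates without a surface measure: average the dilations of the integral against
  the scale-invariant density \<open>d\<lambda>/\<lambda>\<close>, restricted to those \<open>\<lambda>\<close> that move the point into the shell,
  which has logarithmic width one.\<close>

lemma nn_integral_shell:
  fixes f :: "'a::euclidean_space \<Rightarrow> ennreal"
  assumes [measurable]: "f \<in> borel_measurable borel"
  shows "(\<integral>\<^sup>+ z. f z \<partial>lborel) = (\<integral>\<^sup>+ y. indicator shell y *
    (\<integral>\<^sup>+ r. f (r *\<^sub>R y) * ennreal (r ^ (DIM('a) - 1)) * indicator {0<..} r \<partial>lborel) \<partial>lborel)"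
proof -
  have shell1: "(\<integral>\<^sup>+ r. ennreal (1 / r) * indicator {0<..} r * indicator shell ((1 / r) *\<^sub>R z) \<partial>lborel) = 1"
    if "z \<noteq> 0" for z :: 'a
  proof -
    have "(\<integral>\<^sup>+ r. ennreal (1 / r) * indicator {0<..} r * indicator shell ((1 / r) *\<^sub>R z) \<partial>lborel)
        = (\<integral>\<^sup>+ r. ennreal (1 / r) * indicator {norm z / exp 1 <..< norm z} r \<partial>lborel)"
    proof (rule nn_integral_cong)
      fix r :: real
      have "r > 0 \<and> (1 / r) *\<^sub>R z \<in> shell \<longleftrightarrow> r \<in> {norm z / exp 1 <..< norm z}"
      proof (cases "r > 0")
        case True
        then have "norm ((1 / r) *\<^sub>R z) = norm z / r" by simp
        moreover have "1 < norm z / r \<longleftrightarrow> r < norm z" "norm z / r < exp 1 \<longleftrightarrow> norm z / exp 1 < r"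
          using True by (simp_all add: pos_less_divide_eq pos_divide_less_eq mult.commute)
        ultimately show ?thesis using True by (auto simp: shell_def)
      next
        case False
        moreover have "0 \<le> norm z / exp 1" by simp
        ultimately show ?thesis unfolding greaterThanLessThan_iff by linarith
      qed
      then show "ennreal (1 / r) * indicator {0<..} r * indicator shell ((1 / r) *\<^sub>R z)
        = ennreal (1 / r) * indicator {norm z / exp 1 <..< norm z} r"
        by (auto simp: indicator_def)
    qed
    also have "\<dots> = ennreal (ln (norm z / (norm z / exp 1)))"
      using that by (intro nn_integral_inverse_Ioo) (simp_all add: pos_divide_le_eq)
    also have "\<dots> = 1" using that by simp
    finally show ?thesis .
  qed
  have "(\<integral>\<^sup>+ z. f z \<partial>lborel) = (\<integral>\<^sup>+ z. (\<integral>\<^sup>+ r. f z * (ennreal (1 / r) * indicator {0<..} r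
      * indicator shell ((1 / r) *\<^sub>R z)) \<partial>lborel) \<partial>lborel)"
  proof (rule nn_integral_cong_AE)
    show "AE z in lborel. f z = (\<integral>\<^sup>+ r. f z * (ennreal (1 / r) * indicator {0<..} r
      * indicator shell ((1 / r) *\<^sub>R z)) \<partial>lborel)"
      using AE_lborel_singleton[of 0] by eventually_elim (subst nn_integral_cmult, simp_all add: shell1)
  qed
  also have "\<dots> = (\<integral>\<^sup>+ r. (\<integral>\<^sup>+ z. f z * (ennreal (1 / r) * indicator {0<..} r
      * indicator shell ((1 / r) *\<^sub>R z)) \<partial>lborel) \<partial>lborel)"
    by (rule lborel_pair.Fubini'[symmetric]) measurable
  also have "\<dots> = (\<integral>\<^sup>+ r. (\<integral>\<^sup>+ y. indicator shell y * 
      (f (r *\<^sub>R y) * ennreal (r ^ (DIM('a) - 1)) * indicator {0<..} r) \<partial>lborel) \<partial>lborel)"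
  proof (rule nn_integral_cong)
    fix r :: real
    show "(\<integral>\<^sup>+ z. f z * (ennreal (1 / r) * indicator {0<..} r * indicator shell ((1 / r) *\<^sub>R z)) \<partial>lborel)
      = (\<integral>\<^sup>+ y. indicator shell y * (f (r *\<^sub>R y) * ennreal (r ^ (DIM('a) - 1)) * indicator {0<..} r) \<partial>lborel)"
    proof (cases "r > 0")
      case True
      \<comment> \<open>The density 1 / r uses up one factor of the Jacobian r^N, leaving the
        familiar r^(N - 1).\<close>
      have pw: "r ^ DIM('a) * (1 / r) = r ^ (DIM('a) - 1)"
        using True power_minus_mult[of "DIM('a)" r] by (simp add: divide_eq_eq)
      have "(\<integral>\<^sup>+ z. f z * (ennreal (1 / r) * indicator {0<..} r * indicator shell ((1 / r) *\<^sub>R z)) \<partial>lborel)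
        = ennreal (r ^ DIM('a)) * (\<integral>\<^sup>+ y. f (r *\<^sub>R y) * (ennreal (1 / r) * indicator shell y) \<partial>lborel)"
        using True by (subst nn_integral_lborel_scale[of _ r]) auto
      also have "\<dots> = (\<integral>\<^sup>+ y. ennreal (r ^ DIM('a)) * ennreal (1 / r) * (f (r *\<^sub>R y) * indicator shell y) \<partial>lborel)"
        by (subst nn_integral_cmult[symmetric]) (auto simp: mult_ac)
      also have "ennreal (r ^ DIM('a)) * ennreal (1 / r) = ennreal (r ^ (DIM('a) - 1))"
        using True pw by (simp add: ennreal_mult[symmetric])
      finally show ?thesis using True by (simp add: mult_ac)
    qed simp
  qed
  also have "\<dots> = (\<integral>\<^sup>+ y. (\<integral>\<^sup>+ r. indicator shell y * 
      (f (r *\<^sub>R y) * ennreal (r ^ (DIM('a) - 1)) * indicator {0<..} r) \<partial>lborel) \<partial>lborel)"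
    by (rule lborel_pair.Fubini') measurable
  finally show ?thesis by (simp add: nn_integral_cmult)
qed

lemma nn_integral_powr_Ioc:
  assumes "a > 0" "b \<ge> 0"
  shows "(\<integral>\<^sup>+ r. ennreal (r powr (a - 1)) * indicator {0<..b} r \<partial>lborel) = ennreal (b powr a / a)"
proof -
  have "(\<integral>\<^sup>+ r. ennreal (r powr (a - 1)) * indicator {0<..b} r \<partial>lborel)
      = (\<integral>\<^sup>+ r. ennreal (r powr (a - 1)) * indicator {0..b} r \<partial>lborel)"
  proof (rule nn_integral_cong_AE)
    show "AE r in lborel. ennreal (r powr (a - 1)) * indicator {0<..b} r
        = ennreal (r powr (a - 1)) * indicator {0..b} r"
      using AE_lborel_singleton[of 0] by eventually_elim (auto simp: indicator_def)
  qed
  also have "\<dots> = ennreal (b powr a / a)"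
    using has_integral_powr_from_0[of "a - 1" b] assms
    by (intro nn_integral_has_integral_lebesgue') auto
  finally show ?thesis .
qed

lemma nn_integral_powr_atLeast:
  assumes "a > 0" "b > 0"
  shows "(\<integral>\<^sup>+ r. ennreal (r powr (- a - 1)) * indicator {b..} r \<partial>lborel) = ennreal (b powr (- a) / a)"
  using has_integral_powr_to_inf[of "- a - 1" b] assms
  by (intro nn_integral_has_integral_lebesgue') auto

lemma nn_integral_powr_greaterThan:
  assumes "a > 0" "b > 0"
  shows "(\<integral>\<^sup>+ r. ennreal (r powr (- a - 1)) * indicator {b<..} r \<partial>lborel) = ennreal (b powr (- a) / a)"
proof -
  have "(\<integral>\<^sup>+ r. ennreal (r powr (- a - 1)) * indicator {b<..} r \<partial>lborel)
      = (\<integral>\<^sup>+ r. ennreal (r powr (- a - 1)) * indicator {b..} r \<partial>lborel)"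
  proof (rule nn_integral_cong_AE)
    show "AE r in lborel. ennreal (r powr (- a - 1)) * indicator {b<..} r
        = ennreal (r powr (- a - 1)) * indicator {b..} r"
      using AE_lborel_singleton[of b] by eventually_elim (auto simp: indicator_def)
  qed
  then show ?thesis using nn_integral_powr_atLeast[OF assms] by simp
qed

section \<open>Moments of the fractional kernel\<close>

definition kern :: "real \<Rightarrow> 'a::euclidean_space \<Rightarrow> ennreal" where
  "kern s z = ennreal (1 / norm z powr (real DIM('a) + s))"

lemma measurable_kern [measurable]: "kern s \<in> borel_measurable borel"
  unfolding kern_def[abs_def] by measurable

lemma kern_minus [simp]: "kern s (- z) = kern s z"
  by (simp add: kern_def)

text \<open>In polar coordinates the next two constants are the area of the unit sphere and the integral of
  \<open>\<bar>\<theta> \<bullet> e\<bar>\<^sup>s\<close> over it, because the shell has logarithmic width one.\<close>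

definition shell_mass :: "'a::euclidean_space itself \<Rightarrow> ennreal" where
  "shell_mass _ = (\<integral>\<^sup>+ y. indicator shell y * ennreal (1 / norm (y :: 'a) ^ DIM('a)) \<partial>lborel)"

definition dir_moment :: "'a::euclidean_space \<Rightarrow> real \<Rightarrow> ennreal" where
  "dir_moment e s = (\<integral>\<^sup>+ y. indicator shell y *
     ennreal ((\<bar>y \<bullet> e\<bar> / norm y) powr s / norm y ^ DIM('a)) \<partial>lborel)"

lemma power_pred_eq_powr:
  assumes "r > 0"
  shows "r ^ (DIM('a::euclidean_space) - Suc 0) = r powr (real DIM('a) - 1)"
  using assms DIM_positive[where 'a='a]
  by (simp add: powr_realpow[symmetric] of_nat_diff Suc_leI)

lemma shell_pos: "y \<in> shell \<Longrightarrow> norm y > 0"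
  by (auto simp: shell_def)

text \<open>The kernel is homogeneous of degree -(N + s), so the Jacobian r^(N - 1) leaves r powr (-
  s - 1) on every ray. The next three kernel integrals thereby reduce to one radial power integral
  each.\<close>

lemma nn_integral_kern_polar:
  fixes h :: "'a::euclidean_space \<Rightarrow> ennreal" and s :: real
  assumes [measurable]: "h \<in> borel_measurable borel"
  shows "(\<integral>\<^sup>+ z. kern s z * h z \<partial>lborel) = (\<integral>\<^sup>+ y. indicator shell y * (ennreal (1 / norm y powr (DIM('a) + s)) *
    (\<integral>\<^sup>+ r. ennreal (r powr (- s - 1)) * h (r *\<^sub>R y) * indicator {0<..} r \<partial>lborel)) \<partial>lborel)"
proof -
  have "(\<integral>\<^sup>+ z. kern s z * h z \<partial>lborel)
    = (\<integral>\<^sup>+ y. indicator shell y * (\<integral>\<^sup>+ r. kern s (r *\<^sub>R y) * h (r *\<^sub>R y) *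
         ennreal (r ^ (DIM('a) - 1)) * indicator {0<..} r \<partial>lborel) \<partial>lborel)"
    by (rule nn_integral_shell) measurable
  also have "\<dots> = (\<integral>\<^sup>+ y. indicator shell y * (ennreal (1 / norm y powr (DIM('a) + s)) *
    (\<integral>\<^sup>+ r. ennreal (r powr (- s - 1)) * h (r *\<^sub>R y) * indicator {0<..} r \<partial>lborel)) \<partial>lborel)"
  proof (intro nn_integral_cong arg_cong[of _ _ "\<lambda>v. indicator shell y * v" for y])
    fix y :: 'a
    have "kern s (r *\<^sub>R y) * h (r *\<^sub>R y) * ennreal (r ^ (DIM('a) - 1)) * indicator {0<..} r
      = ennreal (1 / norm y powr (DIM('a) + s)) * (ennreal (r powr (- s - 1)) * h (r *\<^sub>R y) * indicator {0<..} r)" for r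
    proof (cases "r > 0")
      case True
      have "r powr (real DIM('a) - 1) = r powr (- s - 1) * r powr (real DIM('a) + s)"
        by (simp add: powr_add[symmetric])
      then have kern_r: "kern s (r *\<^sub>R y) * ennreal (r ^ (DIM('a) - 1))
        = ennreal (1 / norm y powr (DIM('a) + s)) * ennreal (r powr (- s - 1))"
        using True by (simp add: kern_def power_pred_eq_powr powr_mult ennreal_mult[symmetric])
      have "kern s (r *\<^sub>R y) * h (r *\<^sub>R y) * ennreal (r ^ (DIM('a) - 1)) * indicator {0<..} r
        = kern s (r *\<^sub>R y) * ennreal (r ^ (DIM('a) - 1)) * (h (r *\<^sub>R y) * indicator {0<..} r)"
        by (simp only: mult_ac)
      then show ?thesis unfolding kern_r by (simp only: mult.assoc)
    qed simp
    then show "(\<integral>\<^sup>+ r. kern s (r *\<^sub>R y) * h (r *\<^sub>R y) * ennreal (r ^ (DIM('a) - 1)) * indicator {0<..} r \<partial>lborel)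
      = ennreal (1 / norm y powr (DIM('a) + s)) *
        (\<integral>\<^sup>+ r. ennreal (r powr (- s - 1)) * h (r *\<^sub>R y) * indicator {0<..} r \<partial>lborel)"
      by (simp add: nn_integral_cmult)
  qed
  finally show ?thesis .
qed

text \<open>The radial integral from R / |y| on produces a factor |y|^s, which cancels the s in
  |y|^(N + s); the constant left over no longer depends on s.\<close>

lemma nn_integral_kern_far:
  assumes "0 < s" "0 < R"
  shows "(\<integral>\<^sup>+ z. kern s (z :: 'a::euclidean_space) * indicator {z. norm z > R} z \<partial>lborel)
    = shell_mass TYPE('a) * ennreal (R powr (- s) / s)"
proof -
  have "(\<integral>\<^sup>+ z. kern s (z :: 'a) * indicator {z. norm z > R} z \<partial>lborel)
    = (\<integral>\<^sup>+ y. indicator shell y * ennreal (1 / norm (y :: 'a) ^ DIM('a)) * ennreal (R powr (- s) / s) \<partial>lborel)"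
  proof (subst nn_integral_kern_polar, measurable, rule nn_integral_cong)
    fix y :: 'a
    show "indicator shell y * (ennreal (1 / norm y powr (DIM('a) + s)) *
        (\<integral>\<^sup>+ r. ennreal (r powr (- s - 1)) * indicator {z. norm z > R} (r *\<^sub>R y) * indicator {0<..} r \<partial>lborel))
       = indicator shell y * ennreal (1 / norm y ^ DIM('a)) * ennreal (R powr (- s) / s)"
    proof (cases "y \<in> shell")
      case True
      then have y: "norm y > 0" by (rule shell_pos)
      have R: "R / norm y > 0" using y assms by simp
      have "indicator {z. norm z > R} (r *\<^sub>R y) * indicator {0<..} r = (indicator {R / norm y<..} r :: ennreal)" for r
      proof (cases "r > 0")
        case True
        then show ?thesis using y by (auto simp: indicator_def pos_divide_less_eq)
      qed (use R in \<open>auto simp: indicator_def\<close>)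
      then have "(\<integral>\<^sup>+ r. ennreal (r powr (- s - 1)) * indicator {z. norm z > R} (r *\<^sub>R y) * indicator {0<..} r \<partial>lborel)
        = ennreal ((R / norm y) powr (- s) / s)"
        using nn_integral_powr_greaterThan[OF assms(1) R] by (simp add: mult.assoc)
      then show ?thesis
        using y assms by (simp add: mult.assoc ennreal_mult[symmetric] powr_add powr_minus powr_divide powr_realpow field_simps)
    qed simp
  qed
  also have "\<dots> = shell_mass TYPE('a) * ennreal (R powr (- s) / s)"
    by (simp add: nn_integral_multc shell_mass_def)
  finally show ?thesis .
qed

text \<open>The factor |z . e| tames the singularity at the origin, and this is where 1 / (1 - s)
  comes from. The vector \<open>e\<close> has arbitrary length, so that gradients can be inserted
  for it.\<close>

lemma nn_integral_kern_near:
  fixes e :: "'a::euclidean_space"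
  assumes "s < 1" "0 < R"
  shows "(\<integral>\<^sup>+ z. kern s z * ennreal \<bar>z \<bullet> e\<bar> * indicator {z. norm z \<le> R} z \<partial>lborel)
    = dir_moment e 1 * ennreal (R powr (1 - s) / (1 - s))"
proof -
  have "(\<integral>\<^sup>+ z. kern s z * (ennreal \<bar>z \<bullet> e\<bar> * indicator {z. norm z \<le> R} z) \<partial>lborel)
    = (\<integral>\<^sup>+ y. indicator shell y * (ennreal (1 / norm y powr (DIM('a) + s)) *
        (\<integral>\<^sup>+ r. ennreal (r powr (- s - 1)) * (ennreal \<bar>(r *\<^sub>R y) \<bullet> e\<bar> * indicator {z. norm z \<le> R} (r *\<^sub>R y)) *
          indicator {0<..} r \<partial>lborel)) \<partial>lborel)"
    by (rule nn_integral_kern_polar) measurable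
  also have "\<dots> = (\<integral>\<^sup>+ y. indicator shell y * ennreal ((\<bar>y \<bullet> e\<bar> / norm y) powr 1 / norm y ^ DIM('a)) * ennreal (R powr (1 - s) / (1 - s)) \<partial>lborel)"
  proof (rule nn_integral_cong)
    fix y :: 'a
    show "indicator shell y * (ennreal (1 / norm y powr (DIM('a) + s)) *
        (\<integral>\<^sup>+ r. ennreal (r powr (- s - 1)) * (ennreal \<bar>(r *\<^sub>R y) \<bullet> e\<bar> * indicator {z. norm z \<le> R} (r *\<^sub>R y)) *
          indicator {0<..} r \<partial>lborel))
       = indicator shell y * ennreal ((\<bar>y \<bullet> e\<bar> / norm y) powr 1 / norm y ^ DIM('a)) * ennreal (R powr (1 - s) / (1 - s))"
    proof (cases "y \<in> shell")
      case True
      then have y: "norm y > 0" by (rule shell_pos)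
      have "ennreal (r powr (- s - 1)) * (ennreal \<bar>(r *\<^sub>R y) \<bullet> e\<bar> * indicator {z. norm z \<le> R} (r *\<^sub>R y)) * indicator {0<..} r
        = ennreal \<bar>y \<bullet> e\<bar> * (ennreal (r powr ((1 - s) - 1)) * indicator {0<..R / norm y} r)" for r
      proof (cases "r > 0")
        case r: True
        then have "r powr (- s - 1) * (r * \<bar>y \<bullet> e\<bar>) = \<bar>y \<bullet> e\<bar> * r powr (- s)"
          by (simp add: powr_diff)
        then show ?thesis
          using r y by (auto simp: indicator_def pos_le_divide_eq abs_mult ennreal_mult[symmetric])
      qed simp
      then have "(\<integral>\<^sup>+ r. ennreal (r powr (- s - 1)) * (ennreal \<bar>(r *\<^sub>R y) \<bullet> e\<bar> * indicator {z. norm z \<le> R} (r *\<^sub>R y)) *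
          indicator {0<..} r \<partial>lborel) = ennreal \<bar>y \<bullet> e\<bar> * ennreal ((R / norm y) powr (1 - s) / (1 - s))"
        using nn_integral_powr_Ioc[of "1 - s" "R / norm y"] assms by (simp add: nn_integral_cmult)
      moreover have "1 / norm y powr (DIM('a) + s) * (\<bar>y \<bullet> e\<bar> * ((R / norm y) powr (1 - s) / (1 - s)))
         = (\<bar>y \<bullet> e\<bar> / norm y) powr 1 / norm y ^ DIM('a) * (R powr (1 - s) / (1 - s))"
        using y assms by (simp add: powr_add powr_diff powr_divide powr_realpow)
      ultimately show ?thesis
        using assms by (simp only: mult.assoc) ((subst ennreal_mult[symmetric], simp, simp)+, simp only:)
    qed simp
  qed
  also have "\<dots> = dir_moment e 1 * ennreal (R powr (1 - s) / (1 - s))"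
    unfolding dir_moment_def by (rule nn_integral_multc) measurable
  finally show ?thesis by (simp add: mult.assoc)
qed

text \<open>On the ray through y the condition becomes r \<ge> t / |y . e|. The resulting power t
  powr (- s) is the Hardy weight at distance t from a hyperplane.\<close>

lemma nn_integral_kern_slab:
  fixes e :: "'a::euclidean_space"
  assumes "0 < s" "0 < t"
  shows "(\<integral>\<^sup>+ z. kern s z * indicator {z. \<bar>z \<bullet> e\<bar> \<ge> t} z \<partial>lborel)
    = dir_moment e s * ennreal (t powr (- s) / s)"
proof -
  have "(\<integral>\<^sup>+ z. kern s z * indicator {z. \<bar>z \<bullet> e\<bar> \<ge> t} z \<partial>lborel)
    = (\<integral>\<^sup>+ y. indicator shell y * (ennreal (1 / norm y powr (DIM('a) + s)) *
        (\<integral>\<^sup>+ r. ennreal (r powr (- s - 1)) * indicator {z. \<bar>z \<bullet> e\<bar> \<ge> t} (r *\<^sub>R y) * indicator {0<..} r \<partial>lborel)) \<partial>lborel)"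
    by (rule nn_integral_kern_polar) measurable
  also have "\<dots> = (\<integral>\<^sup>+ y. indicator shell y * ennreal ((\<bar>y \<bullet> e\<bar> / norm y) powr s / norm y ^ DIM('a)) * ennreal (t powr (- s) / s) \<partial>lborel)"
  proof (rule nn_integral_cong)
    fix y :: 'a
    show "indicator shell y * (ennreal (1 / norm y powr (DIM('a) + s)) *
        (\<integral>\<^sup>+ r. ennreal (r powr (- s - 1)) * indicator {z. \<bar>z \<bullet> e\<bar> \<ge> t} (r *\<^sub>R y) * indicator {0<..} r \<partial>lborel))
       = indicator shell y * ennreal ((\<bar>y \<bullet> e\<bar> / norm y) powr s / norm y ^ DIM('a)) * ennreal (t powr (- s) / s)"
    proof (cases "y \<in> shell \<and> y \<bullet> e \<noteq> 0")
      case True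
      then have y: "norm y > 0" and ye: "\<bar>y \<bullet> e\<bar> > 0" using shell_pos by auto
      have T: "t / \<bar>y \<bullet> e\<bar> > 0" using ye assms by simp
      have "indicator {z. \<bar>z \<bullet> e\<bar> \<ge> t} (r *\<^sub>R y) * indicator {0<..} r = (indicator {t / \<bar>y \<bullet> e\<bar>..} r :: ennreal)" for r
      proof (cases "r > 0")
        case True
        then show ?thesis using ye by (auto simp: indicator_def pos_divide_le_eq abs_mult)
      qed (use T in \<open>auto simp: indicator_def\<close>)
      then have "(\<integral>\<^sup>+ r. ennreal (r powr (- s - 1)) * indicator {z. \<bar>z \<bullet> e\<bar> \<ge> t} (r *\<^sub>R y) * indicator {0<..} r \<partial>lborel)
        = ennreal ((t / \<bar>y \<bullet> e\<bar>) powr (- s) / s)"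
        using nn_integral_powr_atLeast[OF assms(1) T] by (simp add: mult.assoc)
      moreover have "1 / norm y powr (DIM('a) + s) * ((t / \<bar>y \<bullet> e\<bar>) powr (- s) / s)
        = (\<bar>y \<bullet> e\<bar> / norm y) powr s / norm y ^ DIM('a) * (t powr (- s) / s)"
        using y ye assms by (simp add: powr_add powr_minus powr_divide powr_realpow) (simp add: field_simps)
      ultimately show ?thesis
        using True assms by (simp add: mult.assoc ennreal_mult[symmetric])
    next
      \<comment> \<open>A ray orthogonal to \<open>e\<close> never meets the set, as t > 0, and
        correspondingly 0 powr s = 0 on the right.\<close>
      case False
      then show ?thesis using assms by (auto simp: indicator_def)
    qed
  qed
  also have "\<dots> = dir_moment e s * ennreal (t powr (- s) / s)"
    unfolding dir_moment_def by (rule nn_integral_multc) measurable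
  finally show ?thesis .
qed

text \<open>The cosine |y . e| / |y| is at most one, so a smaller exponent only increases its power.
  This replaces the s-dependent constant of the lower bounds by the one of the limit.\<close>

lemma dir_moment_1_le:
  fixes e :: "'a::euclidean_space"
  assumes "norm e = 1" "0 < s" "s \<le> 1"
  shows "dir_moment e 1 \<le> dir_moment e s"
  unfolding dir_moment_def
proof (intro nn_integral_mono)
  fix y :: 'a
  show "indicator shell y * ennreal ((\<bar>y \<bullet> e\<bar> / norm y) powr 1 / norm y ^ DIM('a))
    \<le> indicator shell y * ennreal ((\<bar>y \<bullet> e\<bar> / norm y) powr s / norm y ^ DIM('a))"
  proof (cases "y \<in> shell")
    case True
    have "\<bar>y \<bullet> e\<bar> / norm y \<le> 1"
      using Cauchy_Schwarz_ineq2[of y e] assms by (simp add: divide_le_eq)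
    then have "(\<bar>y \<bullet> e\<bar> / norm y) powr 1 \<le> (\<bar>y \<bullet> e\<bar> / norm y) powr s"
      using assms by (intro powr_mono') auto
    then show ?thesis by (intro mult_left_mono ennreal_leI divide_right_mono) auto
  qed simp
qed

lemma shell_mass_finite: "shell_mass TYPE('a::euclidean_space) < \<infinity>"
proof -
  have "shell_mass TYPE('a) \<le> (\<integral>\<^sup>+ y. indicator (ball 0 (exp 1)) (y :: 'a) \<partial>lborel)"
    unfolding shell_mass_def
    by (intro nn_integral_mono) (auto simp: indicator_def shell_def divide_le_eq one_le_power)
  also have "\<dots> < \<infinity>" using emeasure_lborel_ball_finite[of "0 :: 'a"] by simp
  finally show ?thesis .
qed

lemma dir_moment_finite:
  fixes e :: "'a::euclidean_space"
  assumes "norm e = 1"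
  shows "dir_moment e 1 < \<infinity>"
proof -
  have "dir_moment e 1 \<le> shell_mass TYPE('a)"
    unfolding dir_moment_def shell_mass_def
  proof (intro nn_integral_mono mult_left_mono ennreal_leI divide_right_mono)
    fix y :: 'a
    show "(\<bar>y \<bullet> e\<bar> / norm y) powr 1 \<le> 1"
      using Cauchy_Schwarz_ineq2[of y e] assms by (simp add: divide_le_eq)
  qed auto
  then show ?thesis using shell_mass_finite[where 'a='a] by (rule le_less_trans)
qed

text \<open>The ball of radius 1/2 about \<open>2 *\<^sub>R e\<close> lies in the shell, because 5/2
  \<le> \<open>exp 1\<close>, and the cosine is bounded away from zero there. Positivity keeps the
  limiting quotient from degenerating to 0 / 0.\<close>

lemma dir_moment_pos:
  fixes e :: "'a::euclidean_space"
  assumes "norm e = 1"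
  shows "dir_moment e 1 > 0"
proof -
  have "0 < ennreal (1 / (exp 1 * exp 1 ^ DIM('a))) * emeasure lborel (ball (2 *\<^sub>R e) (1/2))"
    using content_ball_pos[of "1/2" "2 *\<^sub>R e"] emeasure_lborel_ball_finite[of "2 *\<^sub>R e" "1/2"]
    by (auto simp: emeasure_eq_ennreal_measure ennreal_zero_less_mult_iff)
  also have "\<dots> = (\<integral>\<^sup>+ y. ennreal (1 / (exp 1 * exp 1 ^ DIM('a))) * indicator (ball (2 *\<^sub>R e) (1/2)) y \<partial>lborel)"
    by (rule nn_integral_cmult_indicator[symmetric]) simp
  also have "\<dots> \<le> dir_moment e 1"
    unfolding dir_moment_def
  proof (intro nn_integral_mono)
    fix y :: 'a
    show "ennreal (1 / (exp 1 * exp 1 ^ DIM('a))) * indicator (ball (2 *\<^sub>R e) (1/2)) y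
      \<le> indicator shell y * ennreal ((\<bar>y \<bullet> e\<bar> / norm y) powr 1 / norm y ^ DIM('a))"
    proof (cases "y \<in> ball (2 *\<^sub>R e) (1/2)")
      case True
      then have d: "norm (2 *\<^sub>R e - y) < 1/2" by (simp add: dist_norm)
      have "2 - norm y \<le> norm (2 *\<^sub>R e - y)" "norm y - 2 \<le> norm (2 *\<^sub>R e - y)"
        using norm_triangle_ineq2[of "2 *\<^sub>R e" y] norm_triangle_ineq2[of y "2 *\<^sub>R e"] assms
        by (simp_all add: norm_minus_commute)
      moreover have "exp (1::real) \<ge> 5/2" using exp_ge_one_plus_x_over_n_power_n[of 2 1] exp_lower_Taylor_quadratic[of 1] by simp
      ultimately have y: "1 < norm y" "norm y < exp 1" using d by linarith+
      have "(2 *\<^sub>R e - y) \<bullet> e \<le> norm (2 *\<^sub>R e - y)"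
        using norm_cauchy_schwarz[of "2 *\<^sub>R e - y" e] assms by simp
      then have "1 \<le> y \<bullet> e"
        using d assms by (simp add: inner_diff_left power2_norm_eq_inner[symmetric])
      then have le: "1 / exp 1 \<le> \<bar>y \<bullet> e\<bar> / norm y"
        using y by (intro frac_le) auto
      have pos: "0 < norm y ^ DIM('a)" using y by (intro zero_less_power) linarith
      have "norm y ^ DIM('a) \<le> exp 1 ^ DIM('a)"
        using y by (intro power_mono) auto
      then have "1 / exp 1 / exp 1 ^ DIM('a) \<le> \<bar>y \<bullet> e\<bar> / norm y / norm y ^ DIM('a)"
        by (intro frac_le[OF _ le pos]) auto
      then show ?thesis using True y by (auto simp: shell_def intro!: ennreal_leI)
    qed simp
  qed
  finally show ?thesis .
qed

lemma abs_inner_DIM_1: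
  fixes e :: "'a::euclidean_space"
  assumes "DIM('a) = 1" "norm e = 1"
  shows "\<bar>y \<bullet> e\<bar> = norm y"
proof -
  obtain b :: 'a where b: "Basis = {b}" using assms(1) by (meson card_1_singletonE)
  have nb: "norm b = 1" by (rule norm_Basis) (simp add: b)
  have *: "x = (x \<bullet> b) *\<^sub>R b" for x using euclidean_representation[of x] by (simp add: b)
  have norm_eq: "norm x = \<bar>x \<bullet> b\<bar>" for x
    using arg_cong[OF *[of x], of norm] nb by simp
  have "y \<bullet> e = (y \<bullet> b) * (e \<bullet> b)"
    using arg_cong[OF *[of e], of "\<lambda>v. y \<bullet> v"] by (simp add: mult.commute)
  then show ?thesis using norm_eq[of y] norm_eq[of e] assms(2) by (simp add: abs_mult)
qed

lemma dir_moment_DIM_1_eq_shell_mass: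
  fixes e :: "'a::euclidean_space"
  assumes "DIM('a) = 1" "norm e = 1"
  shows "dir_moment e s = shell_mass TYPE('a)"
  unfolding dir_moment_def shell_mass_def abs_inner_DIM_1[OF assms]
  by (intro nn_integral_cong) (auto simp: indicator_def shell_def)

text \<open>For exponent 0 the kernel in dimension one is 1 / |z|, so its product with |z . e| is 1
  off the origin. The near integral at s = 0 and R = 1 is then the length of the unit ball, which
  evaluates the moment.\<close>

lemma dir_moment_DIM_1:
  fixes e :: "'a::euclidean_space"
  assumes "DIM('a) = 1" "norm e = 1"
  shows "dir_moment e s = 2"
proof -
  have "emeasure lborel (cball (0::'a) 1) = ennreal (measure lborel (cball (0::'a) 1))"
    using emeasure_lborel_cball_finite[of "0::'a" 1] by (simp add: emeasure_eq_ennreal_measure)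
  also have "measure lborel (cball (0::'a) 1) = 2"
    using content_cball[of 1 "0::'a"] unit_ball_vol_1 assms(1) by simp
  finally have "2 = emeasure lborel (cball (0::'a) 1)" by simp
  also have "\<dots> = (\<integral>\<^sup>+ z. indicator (cball 0 1) (z :: 'a) \<partial>lborel)"
    by simp
  also have "\<dots> = (\<integral>\<^sup>+ z. kern 0 z * ennreal \<bar>z \<bullet> e\<bar> * indicator {z. norm z \<le> 1} z \<partial>lborel)"
  proof (rule nn_integral_cong_AE)
    show "AE z in lborel. indicator (cball 0 1) z = kern 0 z * ennreal \<bar>z \<bullet> e\<bar> * indicator {z. norm z \<le> 1} z"
      using AE_lborel_singleton[of 0]
    proof eventually_elim
      case (elim z)
      then show ?case
        unfolding abs_inner_DIM_1[OF assms]
        by (auto simp: kern_def assms(1) indicator_def ennreal_mult[symmetric])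
    qed
  qed
  also have "\<dots> = dir_moment e 1"
    by (subst nn_integral_kern_near) auto
  finally show ?thesis using dir_moment_DIM_1_eq_shell_mass[OF assms] by metis
qed

lemma shell_mass_DIM_1:
  assumes "DIM('a::euclidean_space) = 1"
  shows "shell_mass TYPE('a) = 2"
  using dir_moment_DIM_1[OF assms, of "SOME b. b \<in> Basis"] dir_moment_DIM_1_eq_shell_mass[OF assms, of "SOME b. b \<in> Basis"]
    norm_Basis[OF SOME_Basis, where 'a='a] by metis

text \<open>Some orthogonal map takes one vector to the other and preserves the shell, the norm and
  Lebesgue measure. So a single constant serves all supporting hyperplanes and all gradient
  directions.\<close>

lemma dir_moment_rotate:
  fixes e e' :: "real ^ 'n"
  assumes "norm e = norm e'"
  shows "dir_moment e s = dir_moment e' s"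
proof -
  obtain T where T: "orthogonal_transformation T" "T e = e'"
    using orthogonal_transformation_exists[OF assms] by blast
  have "dir_moment e' s = (\<integral>\<^sup>+ y. indicator shell (T y) *
     ennreal ((\<bar>T y \<bullet> e'\<bar> / norm (T y)) powr s / norm (T y) ^ DIM(real ^ 'n)) \<partial>lborel)"
    unfolding dir_moment_def by (rule nn_integral_lborel_orthogonal[OF T(1), symmetric]) measurable
  also have "\<dots> = dir_moment e s"
    unfolding dir_moment_def using T
    by (auto simp: orthogonal_transformation_norm shell_def orthogonal_transformation_def indicator_def intro!: nn_integral_cong)
  finally show ?thesis by simp
qed

section \<open>The seminorm as a kernel average of translation differences\<close>

lemma gagliardo_seminorm_translate:
  fixes u :: "'a::euclidean_space \<Rightarrow> real"
  assumes [measurable]: "u \<in> borel_measurable borel"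
  shows "gagliardo_seminorm s u = (\<integral>\<^sup>+ z. kern s z * (\<integral>\<^sup>+ x. ennreal \<bar>u (x + z) - u x\<bar> \<partial>lborel) \<partial>lborel)"
proof -
  have "gagliardo_seminorm s u = (\<integral>\<^sup>+ x. (\<integral>\<^sup>+ y. ennreal \<bar>u x - u y\<bar> * kern s (y - x) \<partial>lborel) \<partial>lborel)"
    unfolding gagliardo_seminorm_def nn_integral_completion kern_def
    by (simp add: ennreal_mult[symmetric] norm_minus_commute)
  also have "\<dots> = (\<integral>\<^sup>+ x. (\<integral>\<^sup>+ z. kern s z * ennreal \<bar>u (x + z) - u x\<bar> \<partial>lborel) \<partial>lborel)"
  proof (rule nn_integral_cong)
    fix x
    show "(\<integral>\<^sup>+ y. ennreal \<bar>u x - u y\<bar> * kern s (y - x) \<partial>lborel) = (\<integral>\<^sup>+ z. kern s z * ennreal \<bar>u (x + z) - u x\<bar> \<partial>lborel)"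
      by (subst nn_integral_lborel_translate[symmetric, of _ x]) (auto simp: algebra_simps abs_minus_commute)
  qed
  also have "\<dots> = (\<integral>\<^sup>+ z. (\<integral>\<^sup>+ x. kern s z * ennreal \<bar>u (x + z) - u x\<bar> \<partial>lborel) \<partial>lborel)"
    by (rule lborel_pair.Fubini') measurable
  finally show ?thesis by (simp add: nn_integral_cmult)
qed

lemma gagliardo_seminorm_lborel:
  fixes u :: "'a::euclidean_space \<Rightarrow> real"
  shows "gagliardo_seminorm s u = (\<integral>\<^sup>+ x. (\<integral>\<^sup>+ y. ennreal \<bar>u x - u y\<bar> * kern s (x - y) \<partial>lborel) \<partial>lborel)"
  unfolding gagliardo_seminorm_def nn_integral_completion kern_def
  by (simp add: ennreal_mult[symmetric] norm_minus_commute)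

lemma hardy_integral_lborel:
  "hardy_integral s \<Omega> u = (\<integral>\<^sup>+ x\<in>\<Omega>. ennreal (\<bar>u x\<bar> / boundary_dist \<Omega> x powr s) \<partial>lborel)"
  unfolding hardy_integral_def nn_integral_completion ..

section \<open>Smooth functions and mollification\<close>

lemma k_times_cont_diff_SucI:
  assumes "\<And>x. (f has_derivative D x) (at x)" and "\<And>v. k_times_cont_diff k (\<lambda>x. D x v)"
  shows "k_times_cont_diff (Suc k) f"
proof -
  have "frechet_derivative f (at x) = D x" for x
    using frechet_derivative_at[OF assms(1)[of x]] by simp
  then show ?thesis using assms by (auto simp: differentiable_def)
qed

lemma k_times_cont_diff_Suc_has_derivative:
  "k_times_cont_diff (Suc k) f \<Longrightarrow> (f has_derivative frechet_derivative f (at x)) (at x)"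
  by (simp add: frechet_derivative_works)

lemma k_times_cont_diff_SucD: "k_times_cont_diff (Suc k) f \<Longrightarrow> k_times_cont_diff k f"
proof (induction k arbitrary: f)
  case 0
  then show ?case
    by (auto intro!: continuous_at_imp_continuous_on differentiable_imp_continuous_within)
next
  case (Suc k)
  then show ?case by (auto simp del: k_times_cont_diff.simps(2) simp: k_times_cont_diff.simps(2)[of "Suc k" f] k_times_cont_diff.simps(2)[of k f])
qed

lemma k_times_cont_diff_const: "k_times_cont_diff k (\<lambda>x. c)"
proof (induction k arbitrary: c)
  case (Suc k)
  show ?case by (rule k_times_cont_diff_SucI[where D = "\<lambda>x v. 0"]) (auto intro: Suc)
qed auto

lemma k_times_cont_diff_add:
  "k_times_cont_diff k f \<Longrightarrow> k_times_cont_diff k g \<Longrightarrow> k_times_cont_diff k (\<lambda>x. f x + g x)"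
proof (induction k arbitrary: f g)
  case (Suc k)
  show ?case
  proof (rule k_times_cont_diff_SucI)
    show "((\<lambda>x. f x + g x) has_derivative (\<lambda>v. frechet_derivative f (at x) v + frechet_derivative g (at x) v)) (at x)" for x
      using Suc.prems by (intro has_derivative_add k_times_cont_diff_Suc_has_derivative)
    show "k_times_cont_diff k (\<lambda>x. frechet_derivative f (at x) v + frechet_derivative g (at x) v)" for v
      using Suc.prems by (intro Suc.IH) auto
  qed
qed (auto intro: continuous_on_add)

lemma k_times_cont_diff_mult:
  "k_times_cont_diff k f \<Longrightarrow> k_times_cont_diff k g \<Longrightarrow> k_times_cont_diff k (\<lambda>x. f x * g x)"
proof (induction k arbitrary: f g)
  case (Suc k)
  show ?case
  proof (rule k_times_cont_diff_SucI)
    show "((\<lambda>x. f x * g x) has_derivative (\<lambda>v. f x * frechet_derivative g (at x) v + frechet_derivative f (at x) v * g x)) (at x)" for x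
      using Suc.prems by (intro has_derivative_mult k_times_cont_diff_Suc_has_derivative)
    show "k_times_cont_diff k (\<lambda>x. f x * frechet_derivative g (at x) v + frechet_derivative f (at x) v * g x)" for v
      using Suc.prems k_times_cont_diff_SucD[OF Suc.prems(1)] k_times_cont_diff_SucD[OF Suc.prems(2)]
      by (intro k_times_cont_diff_add Suc.IH) auto
  qed
qed (auto intro: continuous_on_mult)

lemma k_times_cont_diff_inner: "k_times_cont_diff k (\<lambda>x. x \<bullet> w)"
proof (cases k)
  case (Suc k')
  show ?thesis unfolding Suc
    by (rule k_times_cont_diff_SucI[where D = "\<lambda>x v. v \<bullet> w"])
       (auto intro!: derivative_eq_intros k_times_cont_diff_const)
qed (auto intro: continuous_intros)

lemma k_times_cont_diff_inner_self: "k_times_cont_diff k (\<lambda>x. x \<bullet> x)"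
proof (cases k)
  case (Suc k')
  show ?thesis unfolding Suc
  proof (rule k_times_cont_diff_SucI)
    show "((\<lambda>x. x \<bullet> x) has_derivative (\<lambda>v. x \<bullet> v + v \<bullet> x)) (at x)" for x :: 'a
      by (auto intro!: derivative_eq_intros)
    show "k_times_cont_diff k' (\<lambda>x. x \<bullet> v + v \<bullet> x)" for v :: 'a
      by (subst (2) inner_commute) (intro k_times_cont_diff_add k_times_cont_diff_inner)
  qed
qed (auto intro: continuous_intros)

text \<open>For a family closed under differentiation the chain rule reproduces the claim: a
  derivative of the composition is h' o f times a derivative of f, and h' is again in
  \<open>H\<close>. One induction on k thus handles all members at once.\<close>

lemma k_times_cont_diff_compose:
  fixes H :: "(real \<Rightarrow> real) set"
  assumes H: "\<And>h. h \<in> H \<Longrightarrow> \<exists>h'\<in>H. \<forall>t. (h has_real_derivative h' t) (at t)"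
  shows "h \<in> H \<Longrightarrow> k_times_cont_diff k f \<Longrightarrow> k_times_cont_diff k (\<lambda>x. h (f x))"
proof (induction k arbitrary: h)
  case 0
  obtain h' where "\<forall>t. (h has_real_derivative h' t) (at t)" using H[OF 0(1)] by blast
  then have "continuous_on UNIV h" by (auto intro!: continuous_at_imp_continuous_on DERIV_isCont)
  then show ?case using 0 continuous_on_compose2[of UNIV h UNIV f] by simp
next
  case (Suc k)
  obtain h' where h': "h' \<in> H" "\<And>t. (h has_real_derivative h' t) (at t)" using H[OF Suc(2)] by blast
  show ?case
  proof (rule k_times_cont_diff_SucI)
    show "((\<lambda>x. h (f x)) has_derivative (\<lambda>v. h' (f x) * frechet_derivative f (at x) v)) (at x)" for x
      using has_derivative_compose[OF k_times_cont_diff_Suc_has_derivative[OF Suc.prems(2)] h'(2)[of "f x", unfolded has_field_derivative_def]] .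
    show "k_times_cont_diff k (\<lambda>x. h' (f x) * frechet_derivative f (at x) v)" for v
      using Suc.prems by (intro k_times_cont_diff_mult Suc.IH[OF h'(1) k_times_cont_diff_SucD]) auto
  qed
qed

text \<open>Keeping an arbitrary polynomial factor makes the family closed under differentiation;
  the classical flat function is the case p = 1.\<close>

definition flat_exp :: "real poly \<Rightarrow> real \<Rightarrow> real" where
  "flat_exp p t = (if t > 0 then poly p (1 / t) * exp (- (1 / t)) else 0)"

lemma poly_times_exp_tendsto_0: "((\<lambda>y. poly p y * exp (- y)) \<longlongrightarrow> (0::real)) at_top"
proof -
  have "((\<lambda>y. \<Sum>i\<le>degree p. coeff p i * (y ^ i / exp y)) \<longlongrightarrow> (\<Sum>i\<le>degree p. coeff p i * 0)) at_top"
    by (intro tendsto_intros tendsto_power_div_exp_0)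
  then show ?thesis
    by (simp add: poly_altdef sum_distrib_right exp_minus divide_inverse mult.assoc)
qed

lemma flat_exp_tendsto_0: "(flat_exp p \<longlongrightarrow> 0) (at 0)"
proof (rule filterlim_split_at)
  have "\<forall>\<^sub>F t in at_left 0. 0 = flat_exp p t"
    by (auto simp: eventually_at_filter flat_exp_def)
  then show "(flat_exp p \<longlongrightarrow> 0) (at_left 0)" by (rule Lim_transform_eventually[OF tendsto_const])
  have "\<forall>\<^sub>F y in at_top. poly p y * exp (- y) = flat_exp p (inverse y)"
    using eventually_gt_at_top[of 0] by eventually_elim (simp add: flat_exp_def inverse_eq_divide)
  then show "(flat_exp p \<longlongrightarrow> 0) (at_right 0)"
    unfolding filterlim_at_right_to_top by (rule Lim_transform_eventually[OF poly_times_exp_tendsto_0])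
qed

text \<open>With y = 1 / t one has d/dt = - y^2 d/dy, which turns p(y) exp(-y) into y^2 (p - p')(y)
  exp(-y).\<close>

lemma flat_exp_has_derivative:
  "(flat_exp p has_real_derivative flat_exp (monom 1 2 * (p - pderiv p)) t) (at t)"
proof -
  consider "t > 0" | "t < 0" | "t = 0" by linarith
  then show ?thesis
  proof cases
    case 1
    have inv: "((\<lambda>t. 1 / t) has_real_derivative - (1 / t\<^sup>2)) (at t)"
      using 1 by (auto intro!: derivative_eq_intros simp: power2_eq_square)
    have "((\<lambda>t. exp (- (1 / t))) has_real_derivative exp (- (1 / t)) * - (- (1 / t\<^sup>2))) (at t)"
      by (rule DERIV_chain2[OF DERIV_exp DERIV_minus[OF inv]])
    from DERIV_mult[OF DERIV_chain2[OF poly_DERIV inv] this]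
    have "((\<lambda>t. poly p (1 / t) * exp (- (1 / t))) has_real_derivative
        flat_exp (monom 1 2 * (p - pderiv p)) t) (at t)"
      by (rule DERIV_cong) (use 1 in \<open>simp add: flat_exp_def poly_monom power_one_over algebra_simps\<close>)
    moreover have "\<forall>\<^sub>F x in nhds t. flat_exp p x = poly p (1 / x) * exp (- (1 / x))"
      using eventually_nhds_in_open[of "{0<..}" t] 1 by (auto simp: flat_exp_def elim!: eventually_mono)
    ultimately show ?thesis
      by (subst DERIV_cong_ev[OF refl _ refl]) assumption+
  next
    case 2
    have "\<forall>\<^sub>F x in nhds t. flat_exp p x = 0"
      using eventually_nhds_in_open[of "{..<0}" t] 2 by (auto simp: flat_exp_def elim!: eventually_mono)
    then have "(flat_exp p has_real_derivative 0) (at t)"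
      using DERIV_cong_ev[of t t "flat_exp p" "\<lambda>_. 0" 0 0] by simp
    then show ?thesis using 2 by (simp add: flat_exp_def)
  next
    case 3
    \<comment> \<open>At the origin, dividing by h multiplies p by its variable, so the difference
      quotient is again a member of the family and tends to 0.\<close>
    have "((\<lambda>h. (flat_exp p (0 + h) - flat_exp p 0) / h) \<longlongrightarrow> 0) (at 0)"
    proof (rule Lim_transform_eventually[OF flat_exp_tendsto_0[of "monom 1 1 * p"]])
      show "\<forall>\<^sub>F h in at 0. flat_exp (monom 1 1 * p) h = (flat_exp p (0 + h) - flat_exp p 0) / h"
        by (auto simp: eventually_at_filter flat_exp_def poly_monom)
    qed
    then show ?thesis using 3 by (simp add: DERIV_def flat_exp_def)
  qed
qed

text \<open>Composing the flat function with \<delta>^2 - |x|^2 involves only a polynomial in x and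
  gives a function that is positive exactly on the open ball; dividing by its integral normalizes
  it.\<close>

lemma smooth_bump:
  fixes \<delta> :: real
  assumes "\<delta> > 0"
  obtains \<rho> :: "'a::euclidean_space \<Rightarrow> real"
  where "smooth \<rho>" "\<And>x. \<rho> x \<ge> 0" "\<And>x. norm x \<ge> \<delta> \<Longrightarrow> \<rho> x = 0" "integral\<^sup>L lborel \<rho> = 1" "integrable lborel \<rho>"
proof -
  define f where "f = (\<lambda>x :: 'a. flat_exp 1 (\<delta>\<^sup>2 + (- 1) * (x \<bullet> x)))"
  have sm: "k_times_cont_diff k f" for k
    unfolding f_def
  proof (rule k_times_cont_diff_compose[where H = "range flat_exp" and h = "flat_exp 1"])
    show "k_times_cont_diff k (\<lambda>x :: 'a. \<delta>\<^sup>2 + (- 1) * (x \<bullet> x))"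
      by (intro k_times_cont_diff_add k_times_cont_diff_mult k_times_cont_diff_const k_times_cont_diff_inner_self)
    fix h assume "h \<in> range flat_exp"
    then obtain p where "h = flat_exp p" by blast
    then show "\<exists>h'\<in>range flat_exp. \<forall>t. (h has_real_derivative h' t) (at t)"
      using flat_exp_has_derivative[of p] by (intro bexI[of _ "flat_exp (monom 1 2 * (p - pderiv p))"]) simp_all
  qed simp
  have cont: "continuous_on UNIV f" using sm[of 0] by simp
  have nonneg: "f x \<ge> 0" for x by (simp add: f_def flat_exp_def)
  have pos_iff: "f x > 0 \<longleftrightarrow> norm x < \<delta>" for x
  proof -
    have "x \<bullet> x < \<delta>\<^sup>2 \<longleftrightarrow> norm x < \<delta>"
      using norm_lt_square[of x \<delta>] assms by simp
    then show ?thesis by (simp add: f_def flat_exp_def)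
  qed
  have zero: "norm x \<ge> \<delta> \<Longrightarrow> f x = 0" for x
    using pos_iff[of x] nonneg[of x] by linarith
  have eq: "f = (\<lambda>x. indicator (cball 0 \<delta>) x *\<^sub>R f x)"
    using zero by (auto simp: indicator_def fun_eq_iff)
  have int: "integrable lborel f"
    by (subst eq) (rule borel_integrable_compact, auto intro: continuous_on_subset[OF cont])
  have "integral\<^sup>L lborel f \<noteq> 0"
  proof
    assume "integral\<^sup>L lborel f = 0"
    then have "AE x in lborel. f x = 0"
      using integral_nonneg_eq_0_iff_AE[OF int] nonneg by simp
    then have "AE x in lborel. x \<notin> ball (0::'a) \<delta>"
      by eventually_elim (use pos_iff in \<open>auto simp: dist_norm less_le\<close>)
    then have "emeasure lborel (ball (0::'a) \<delta>) = 0"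
      by (subst (asm) AE_iff_measurable[where N = "ball (0::'a) \<delta>"]) auto
    then show False
      using content_ball_pos[OF assms, of "0::'a"] by (simp add: measure_def)
  qed
  moreover have "integral\<^sup>L lborel f \<ge> 0" using nonneg by simp
  ultimately have c: "integral\<^sup>L lborel f > 0" by linarith
  show thesis
  proof (rule that[of "\<lambda>x. 1 / integral\<^sup>L lborel f * f x"])
    show "smooth (\<lambda>x. 1 / integral\<^sup>L lborel f * f x)"
      unfolding smooth_def by (intro allI k_times_cont_diff_mult k_times_cont_diff_const sm)
  qed (use c nonneg zero int in auto)
qed

lemma smooth_continuous: "smooth f \<Longrightarrow> continuous_on UNIV f"
  unfolding smooth_def using k_times_cont_diff.simps(1) by blast

lemma smooth_has_derivative: "smooth f \<Longrightarrow> (f has_derivative frechet_derivative f (at x)) (at x)"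
  unfolding smooth_def using k_times_cont_diff_Suc_has_derivative by blast

lemma smooth_frechet: "smooth f \<Longrightarrow> smooth (\<lambda>x. frechet_derivative f (at x) v)"
  unfolding smooth_def using k_times_cont_diff.simps(2) by blast

text \<open>All derivatives fall on \<open>\<rho>\<close>, so continuity of \<open>v\<close>
  suffices. The domain is a fixed box, to which the Leibniz rule for parameter integrals applies;
  the induction passes from \<open>\<rho>\<close> to its directional derivatives.\<close>

lemma smooth_convolution:
  fixes v \<rho> :: "'a::euclidean_space \<Rightarrow> real"
  assumes v: "continuous_on UNIV v" and \<rho>: "smooth \<rho>"
  shows "smooth (\<lambda>x. integral (cbox a b) (\<lambda>y. v y * \<rho> (x - y)))"
proof -
  have "k_times_cont_diff k (\<lambda>x. integral (cbox a b) (\<lambda>y. v y * \<rho> (x - y)))" for k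
    using \<rho>
  proof (induction k arbitrary: \<rho>)
    case 0
    show ?case unfolding k_times_cont_diff.simps
      by (intro integral_continuous_on_param)
         (auto simp: split_beta intro!: continuous_intros continuous_on_compose2[OF v] continuous_on_compose2[OF smooth_continuous[OF 0]])
  next
    case (Suc k)
    \<comment> \<open>The Leibniz rule asks for the derivative as one continuous map into bounded
      linear functionals; its continuity is checked on basis vectors.\<close>
    define D where "D = (\<lambda>x y. v y *\<^sub>R Blinfun (frechet_derivative \<rho> (at (x - y))))"
    have D_apply: "blinfun_apply (D x y) w = v y * frechet_derivative \<rho> (at (x - y)) w" for x y w
      unfolding D_def
      by (simp add: scaleR_blinfun.rep_eq bounded_linear_Blinfun_apply has_derivative_bounded_linear[OF smooth_has_derivative[OF Suc.prems]])
    have cont_D: "continuous_on (UNIV \<times> cbox a b) (\<lambda>(x, y). D x y)"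
    proof (rule continuous_on_blinfun_componentwise)
      fix i :: 'a assume "i \<in> Basis"
      show "continuous_on (UNIV \<times> cbox a b) (\<lambda>z. blinfun_apply (case z of (x, y) \<Rightarrow> D x y) i)"
        unfolding split_beta D_apply
        by (auto intro!: continuous_intros continuous_on_compose2[OF v]
           continuous_on_compose2[OF smooth_continuous[OF smooth_frechet[OF Suc.prems]]])
    qed
    have integ: "(\<lambda>y. v y * \<rho> (x - y)) integrable_on cbox a b" for x
      by (intro integrable_continuous continuous_intros continuous_on_compose2[OF v]
           continuous_on_compose2[OF smooth_continuous[OF Suc.prems]]) auto
    have "((\<lambda>x. integral (cbox a b) (\<lambda>y. v y * \<rho> (x - y))) has_derivative
       blinfun_apply (integral (cbox a b) (D x))) (at x)" for x
    proof (rule leibniz_rule[where U = UNIV])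
      fix x t :: 'a
      have "((\<lambda>x. \<rho> (x - t)) has_derivative (\<lambda>w. frechet_derivative \<rho> (at (x - t)) w)) (at x)"
        by (rule has_derivative_compose[of "\<lambda>x. x - t" "\<lambda>w. w", OF _ smooth_has_derivative[OF Suc.prems]])
           (auto intro!: derivative_eq_intros)
      then have "((\<lambda>x. v t * \<rho> (x - t)) has_derivative (\<lambda>w. v t * frechet_derivative \<rho> (at (x - t)) w)) (at x)"
        by (rule has_derivative_mult_right)
      then show "((\<lambda>x. v t * \<rho> (x - t)) has_derivative blinfun_apply (D x t)) (at x)"
        by (simp add: D_apply[abs_def] fun_eq_iff[of "blinfun_apply (D x t)", THEN iffD2, rule_format])
    qed (use cont_D integ in auto)
    moreover have "D x integrable_on cbox a b" for x
      using continuous_on_compose2[OF cont_D, of "cbox a b" "\<lambda>y. (x, y)"]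
      by (intro integrable_continuous) (simp add: continuous_on_Pair image_subset_iff)
    then have "blinfun_apply (integral (cbox a b) (D x)) w = integral (cbox a b) (\<lambda>y. v y * frechet_derivative \<rho> (at (x - y)) w)" for x w
      by (simp add: blinfun_apply_integral D_apply)
    ultimately show ?case
      using Suc.IH[OF smooth_frechet[OF Suc.prems]]
      by (intro k_times_cont_diff_SucI[where D = "\<lambda>x. blinfun_apply (integral (cbox a b) (D x))"]) simp_all
  qed
  then show ?thesis unfolding smooth_def by blast
qed

section \<open>Gradients of smooth functions\<close>

definition gradient :: "('a::euclidean_space \<Rightarrow> real) \<Rightarrow> 'a \<Rightarrow> 'a" where
  "gradient f x = adjoint (frechet_derivative f (at x)) 1"

lemma inner_gradient:
  assumes "smooth f"
  shows "frechet_derivative f (at x) v = gradient f x \<bullet> v"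
  using adjoint_works[of "frechet_derivative f (at x)" v 1] has_derivative_linear[OF smooth_has_derivative[OF assms]]
  by (simp add: gradient_def inner_commute)

lemma smooth_has_gradient:
  assumes "smooth f"
  shows "(f has_derivative (\<lambda>v. gradient f x \<bullet> v)) (at x)"
  using smooth_has_derivative[OF assms] by (simp add: inner_gradient[OF assms, abs_def])

lemma continuous_on_gradient_inner:
  "smooth f \<Longrightarrow> continuous_on UNIV (\<lambda>x. gradient f x \<bullet> v)"
  using smooth_continuous[OF smooth_frechet[of f v]] by (simp add: inner_gradient)

lemma measurable_gradient:
  "smooth f \<Longrightarrow> gradient f \<in> borel_measurable borel"
  unfolding borel_measurable_euclidean_space[of "gradient f" borel]
  using continuous_on_gradient_inner by (blast intro: borel_measurable_continuous_onI)

text \<open>Differentiate in the direction of the gradient g itself: the derivative is |g|^2, while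
  the difference quotients are at most L |g|.\<close>

lemma norm_gradient_le:
  assumes f: "smooth f" and L: "\<And>x y. \<bar>f x - f y\<bar> \<le> L * norm (x - y)"
  shows "norm (gradient f x) \<le> L"
proof -
  define g where "g = gradient f x"
  have "((\<lambda>h. f (x + h *\<^sub>R g)) has_derivative (\<lambda>h. g \<bullet> (h *\<^sub>R g))) (at 0)"
  proof (rule has_derivative_compose[where f = "\<lambda>h. x + h *\<^sub>R g" and g = f])
    show "((\<lambda>h. x + h *\<^sub>R g) has_derivative (\<lambda>h. h *\<^sub>R g)) (at 0)"
      by (auto intro!: derivative_eq_intros)
    show "(f has_derivative (\<lambda>v. g \<bullet> v)) (at (x + 0 *\<^sub>R g))"
      using smooth_has_gradient[OF f, of x] by (simp add: g_def)
  qed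
  then have "((\<lambda>h. f (x + h *\<^sub>R g)) has_real_derivative (norm g)\<^sup>2) (at 0)"
    unfolding has_field_derivative_def power2_norm_eq_inner
    by (rule has_derivative_eq_rhs) (simp add: fun_eq_iff)
  then have "((\<lambda>h. (f (x + h *\<^sub>R g) - f x) / h) \<longlongrightarrow> (norm g)\<^sup>2) (at 0)"
    by (simp add: DERIV_def)
  moreover have "\<forall>\<^sub>F h in at 0. (f (x + h *\<^sub>R g) - f x) / h \<le> L * norm g"
  proof -
    have "(f (x + h *\<^sub>R g) - f x) / h \<le> L * norm g" if "h \<noteq> 0" for h :: real
    proof -
      have "(f (x + h *\<^sub>R g) - f x) / h \<le> \<bar>f (x + h *\<^sub>R g) - f x\<bar> / \<bar>h\<bar>"
        by (metis abs_divide abs_ge_self)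
      also have "\<dots> \<le> L * norm (h *\<^sub>R g) / \<bar>h\<bar>"
        using L[of "x + h *\<^sub>R g" x] by (intro divide_right_mono) auto
      also have "\<dots> = L * norm g" using that by simp
      finally show ?thesis .
    qed
    then show ?thesis by (auto simp: eventually_at_filter)
  qed
  ultimately have "(norm g)\<^sup>2 \<le> L * norm g"
    by (rule tendsto_upperbound) simp
  then have "norm g \<le> L \<or> norm g = 0"
    by (cases "norm g = 0") (simp_all add: power2_eq_square)
  moreover have "0 \<le> L"
    using order_trans[OF abs_ge_zero L[of "SOME b. b \<in> Basis" 0]] norm_Basis[OF SOME_Basis, where 'a='a] by simp
  ultimately show ?thesis unfolding g_def by auto
qed

lemma gradient_eq_0:
  assumes f: "smooth f" and U: "open U" "x \<in> U" "\<And>y. y \<in> U \<Longrightarrow> f y = c"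
  shows "gradient f x = 0"
proof -
  have "((\<lambda>y. c) has_derivative (\<lambda>v. gradient f x \<bullet> v)) (at x)"
    by (rule has_derivative_transform_within_open[OF smooth_has_gradient[OF f] U(1,2)]) (simp add: U(3))
  moreover have "((\<lambda>y. c) has_derivative (\<lambda>v. 0)) (at x)" by simp
  ultimately have "(\<lambda>v. gradient f x \<bullet> v) = (\<lambda>v. 0)" by (rule has_derivative_unique)
  then have "gradient f x \<bullet> gradient f x = 0" by metis
  then show ?thesis by simp
qed

text \<open>A weighted average of translates of \<open>v\<close> inherits the bounds and the
  Lipschitz constant without loss, and keeps the value c wherever \<open>v\<close> equals c within
  distance \<open>\<delta>\<close>. Keeping L exactly matters because the slope of the cutoff enters
  a sharp constant.\<close>

lemma smooth_approximation:
  fixes v :: "'a::euclidean_space \<Rightarrow> real"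
  assumes v: "\<And>x y. \<bar>v x - v y\<bar> \<le> L * norm (x - y)" "\<And>x. 0 \<le> v x" "\<And>x. v x \<le> 1"
    and supp: "bounded {x. v x \<noteq> 0}" and "\<delta> > 0"
  obtains \<phi> where "smooth \<phi>" "\<And>x. 0 \<le> \<phi> x" "\<And>x. \<phi> x \<le> 1"
    "\<And>x y. \<bar>\<phi> x - \<phi> y\<bar> \<le> L * norm (x - y)"
    "\<And>x c. (\<And>y. norm (x - y) < \<delta> \<Longrightarrow> v y = c) \<Longrightarrow> \<phi> x = c"
proof -
  obtain \<rho> :: "'a \<Rightarrow> real" where \<rho>: "smooth \<rho>" "\<And>x. \<rho> x \<ge> 0" "\<And>x. norm x \<ge> \<delta> \<Longrightarrow> \<rho> x = 0"
     "integral\<^sup>L lborel \<rho> = 1" "integrable lborel \<rho>"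
    using smooth_bump[OF \<open>\<delta> > 0\<close>] by blast
  obtain a where a: "{x. v x \<noteq> 0} \<subseteq> cbox (- a) a"
    using bounded_subset_cbox_symmetric[OF supp] by blast
  have "0 \<le> L"
    using order_trans[OF abs_ge_zero v(1)[of "SOME b. b \<in> Basis" 0]] norm_Basis[OF SOME_Basis, where 'a='a] by simp
  then have "L-lipschitz_on UNIV v"
    using v(1) by (auto intro!: lipschitz_onI simp: dist_norm)
  then have cont_v: "continuous_on UNIV v"
    by (rule lipschitz_on_continuous_on)
  have [measurable]: "v \<in> borel_measurable borel" "\<rho> \<in> borel_measurable borel"
    using cont_v smooth_continuous[OF \<rho>(1)] by (auto intro: borel_measurable_continuous_onI)
  define \<phi> where "\<phi> = (\<lambda>x. integral (cbox (- a) a) (\<lambda>y. v y * \<rho> (x - y)))"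
  have int: "integrable lborel (\<lambda>w. v (x - w) * \<rho> w)" for x
  proof (rule Bochner_Integration.integrable_bound[OF \<rho>(5)])
    have "norm (v (x - w) * \<rho> w) \<le> norm (\<rho> w)" for w
      using v(2,3)[of "x - w"] \<rho>(2)[of w] mult_left_le_one_le[of "\<rho> w" "v (x - w)"] by simp
    then show "AE w in lborel. norm (v (x - w) * \<rho> w) \<le> norm (\<rho> w)" by simp
  qed simp
  \<comment> \<open>Smoothness comes from the form with x inside \<open>\<rho>\<close>, the
    estimates from the form with x inside \<open>v\<close>; the reflection w -> x - w links the
    two.\<close>
  have conv: "\<phi> x = (\<integral>w. v (x - w) * \<rho> w \<partial>lborel)" for x
  proof -
    have reflect: "distr lborel borel (\<lambda>w. x - w) = (lborel :: 'a measure)"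
      using lborel_affine[of "-1" x] by (simp add: density_1)
    have int': "integrable lborel (\<lambda>y. v y * \<rho> (x - y))"
      using integrable_distr[of "\<lambda>w. x - w" lborel borel "\<lambda>w. v (x - w) * \<rho> w"] int[of x]
      unfolding reflect by simp
    have "(\<integral>w. v (x - w) * \<rho> w \<partial>lborel) = (\<integral>w. v (x - w) * \<rho> w \<partial>distr lborel borel (\<lambda>w. x - w))"
      by (simp add: reflect)
    also have "\<dots> = (\<integral>y. v y * \<rho> (x - y) \<partial>lborel)"
      by (subst integral_distr) auto
    also have "\<dots> = (LINT y:cbox (- a) a|lborel. v y * \<rho> (x - y))"
      unfolding set_lebesgue_integral_def using a
      by (intro Bochner_Integration.integral_cong) (auto simp: indicator_def)
    also have "\<dots> = \<phi> x"
      unfolding \<phi>_def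
      by (rule set_borel_integral_eq_integral, unfold set_integrable_def, rule integrable_mult_indicator[OF _ int']) simp
    finally show ?thesis by simp
  qed
  show thesis
  proof (rule that[of \<phi>])
    show "smooth \<phi>" unfolding \<phi>_def by (rule smooth_convolution[OF cont_v \<rho>(1)])
    show "0 \<le> \<phi> x" for x unfolding conv using v(2) \<rho>(2) by simp
    have "\<phi> x \<le> (\<integral>w. \<rho> w \<partial>lborel)" for x
      unfolding conv using v(2,3) \<rho>(2) mult_left_le_one_le by (intro integral_mono int \<rho>(5)) blast
    then show "\<phi> x \<le> 1" for x by (simp add: \<rho>(4))
    show "\<bar>\<phi> x - \<phi> y\<bar> \<le> L * norm (x - y)" for x y
    proof -
      have "\<phi> x - \<phi> y = (\<integral>w. v (x - w) * \<rho> w - v (y - w) * \<rho> w \<partial>lborel)"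
        unfolding conv by (intro Bochner_Integration.integral_diff[symmetric] int)
      also have "\<bar>\<dots>\<bar> \<le> (\<integral>w. norm (v (x - w) * \<rho> w - v (y - w) * \<rho> w) \<partial>lborel)"
        using integral_norm_bound[of lborel "\<lambda>w. v (x - w) * \<rho> w - v (y - w) * \<rho> w"] by simp
      also have "\<dots> \<le> (\<integral>w. L * norm (x - y) * \<rho> w \<partial>lborel)"
      proof (intro integral_mono)
        fix w
        have "norm (v (x - w) * \<rho> w - v (y - w) * \<rho> w) = \<bar>v (x - w) - v (y - w)\<bar> * \<rho> w"
          using \<rho>(2) by (simp add: abs_mult left_diff_distrib[symmetric])
        also have "\<dots> \<le> L * norm (x - y) * \<rho> w"
          using v(1)[of "x - w" "y - w"] \<rho>(2) by (intro mult_right_mono) auto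
        finally show "norm (v (x - w) * \<rho> w - v (y - w) * \<rho> w) \<le> L * norm (x - y) * \<rho> w" .
      next
        show "integrable lborel (\<lambda>w. norm (v (x - w) * \<rho> w - v (y - w) * \<rho> w))"
          by (intro Bochner_Integration.integrable_norm Bochner_Integration.integrable_diff int)
        show "integrable lborel (\<lambda>w. L * norm (x - y) * \<rho> w)"
          by (intro integrable_mult_right \<rho>(5))
      qed
      also have "\<dots> = L * norm (x - y)" using \<rho>(4) by simp
      finally show ?thesis .
    qed
    show "\<phi> x = c" if "\<And>y. norm (x - y) < \<delta> \<Longrightarrow> v y = c" for x c
    proof -
      have "v (x - w) * \<rho> w = c * \<rho> w" for w
        using that[of "x - w"] \<rho>(3)[of w] by (cases "norm w < \<delta>") auto
      then have "\<phi> x = (\<integral>w. c * \<rho> w \<partial>lborel)" unfolding conv by (simp only:)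
      then show ?thesis using \<rho>(4) by simp
    qed
  qed
qed

section \<open>Cutoff functions for boundary layers\<close>

abbreviation inner_layer :: "'a::metric_space set \<Rightarrow> real \<Rightarrow> 'a set" where
  "inner_layer E r \<equiv> {x \<in> E. infdist x (- E) \<le> r}"

lemma cutoff_exists:
  fixes E :: "'a::euclidean_space set"
  assumes E: "open E" "bounded E" and "r > 0" "q > 1"
  obtains \<phi> where "\<phi> \<in> test_functions E" "\<And>x. 0 \<le> \<phi> x" "\<And>x. \<phi> x \<le> 1"
    "\<And>x. r \<le> infdist x (- E) \<Longrightarrow> \<phi> x = 1" "\<And>x. x \<notin> E \<Longrightarrow> \<phi> x = 0"
    "\<And>x. norm (gradient \<phi> x) \<le> q / r * indicator (inner_layer E r) x"
proof -
  \<comment> \<open>The profile of slope q / r is 0 up to depth 2 \<delta> and 1 from depth 2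
    \<delta> + r / q = r - \<delta> on. Mollifying at scale \<delta> moves both thresholds by
    \<delta>, so the support stays compact in E and the value 1 is reached at depth r.\<close>
  define \<delta> where "\<delta> = (r - r / q) / 3"
  have "r / q < r" using assms by (simp add: divide_less_eq)
  then have \<delta>: "\<delta> > 0" by (simp add: \<delta>_def)
  have r_eq: "r = r / q + 3 * \<delta>" by (simp add: \<delta>_def field_simps)
  define d where "d = (\<lambda>x. infdist x (- E))"
  have d_lip: "\<bar>d x - d y\<bar> \<le> norm (x - y)" for x y
    using infdist_triangle_abs[of x "- E" y] by (simp add: d_def dist_norm)
  have "- E \<noteq> {}"
  proof
    assume "- E = {}"
    then have "E = UNIV" by auto
    then show False using E(2) by simp
  qed
  then have d_pos: "d x > 0 \<longleftrightarrow> x \<in> E" for x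
    using in_closed_iff_infdist_zero[of "- E" x] E(1) infdist_nonneg[of x "- E"]
    by (auto simp: d_def less_le)
  define v where "v = (\<lambda>x. min 1 (max 0 ((d x - 2 * \<delta>) * (q / r))))"
  have qr: "q / r > 0" using assms by simp
  have v_lip: "\<bar>v x - v y\<bar> \<le> q / r * norm (x - y)" for x y
  proof -
    have clamp: "\<bar>min 1 (max 0 s) - min 1 (max 0 t)\<bar> \<le> \<bar>s - t\<bar>" for s t :: real by linarith
    have "\<bar>v x - v y\<bar> \<le> \<bar>(d x - 2 * \<delta>) * (q / r) - (d y - 2 * \<delta>) * (q / r)\<bar>"
      unfolding v_def by (rule clamp)
    also have "\<dots> = \<bar>(q / r) * (d x - d y)\<bar>"
      by (rule arg_cong[of _ _ abs]) (simp add: algebra_simps)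
    also have "\<dots> = q / r * \<bar>d x - d y\<bar>" using qr by (simp only: abs_mult abs_of_pos)
    also have "\<dots> \<le> q / r * norm (x - y)" using d_lip qr by (intro mult_left_mono) auto
    finally show ?thesis .
  qed
  have v_0: "v x = 0" if "d x \<le> 2 * \<delta>" for x
  proof -
    have "(d x - 2 * \<delta>) * (q / r) \<le> 0" using that qr by (intro mult_nonpos_nonneg) auto
    then show ?thesis by (simp add: v_def)
  qed
  have v_1: "v x = 1" if "r - \<delta> \<le> d x" for x
  proof -
    have "r / q * (q / r) \<le> (d x - 2 * \<delta>) * (q / r)"
      using that r_eq qr by (intro mult_right_mono) linarith+
    moreover have "r / q * (q / r) = 1" using assms by simp
    ultimately show ?thesis by (simp add: v_def)
  qed
  have "{x. v x \<noteq> 0} \<subseteq> E"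
  proof safe
    fix x assume "v x \<noteq> 0"
    then have "2 * \<delta> < d x" using v_0[of x] by linarith
    then show "x \<in> E" using d_pos[of x] \<delta> by linarith
  qed
  then have "bounded {x. v x \<noteq> 0}" using E(2) bounded_subset by blast
  moreover have "0 \<le> v x" "v x \<le> 1" for x by (simp_all add: v_def)
  ultimately obtain \<phi> where \<phi>: "smooth \<phi>" "\<And>x. 0 \<le> \<phi> x" "\<And>x. \<phi> x \<le> 1"
    "\<And>x y. \<bar>\<phi> x - \<phi> y\<bar> \<le> q / r * norm (x - y)"
    "\<And>x c. (\<And>y. norm (x - y) < \<delta> \<Longrightarrow> v y = c) \<Longrightarrow> \<phi> x = c"
    using smooth_approximation[OF v_lip _ _ _ \<delta>] by metis
  have phi_0: "\<phi> x = 0" if "d x \<le> \<delta>" for x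
  proof (rule \<phi>(5), rule v_0)
    fix y assume "norm (x - y) < \<delta>"
    then show "d y \<le> 2 * \<delta>" using d_lip[of x y] that by linarith
  qed
  have phi_1: "\<phi> x = 1" if "r \<le> d x" for x
  proof (rule \<phi>(5), rule v_1)
    fix y assume "norm (x - y) < \<delta>"
    then show "r - \<delta> \<le> d y" using d_lip[of x y] that by linarith
  qed
  have cont_d: "continuous_on UNIV d" unfolding d_def by (intro continuous_intros)
  have supp: "closure {x. \<phi> x \<noteq> 0} \<subseteq> {x. \<delta> \<le> d x}"
  proof (rule closure_minimal)
    show "{x. \<phi> x \<noteq> 0} \<subseteq> {x. \<delta> \<le> d x}" using phi_0 by (auto intro: ccontr simp: not_le)
    show "closed {x. \<delta> \<le> d x}" by (rule closed_Collect_le[OF continuous_on_const cont_d])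
  qed
  also have "\<dots> \<subseteq> E" using d_pos \<delta> by (auto dest: less_le_trans)
  finally have supp_E: "closure {x. \<phi> x \<noteq> 0} \<subseteq> E" .
  show thesis
  proof (rule that[of \<phi>])
    have "compact (closure {x. \<phi> x \<noteq> 0})"
      using bounded_subset[OF E(2) order_trans[OF closure_subset supp_E]] by simp
    then show "\<phi> \<in> test_functions E" using \<phi>(1) supp_E by (simp add: test_functions_def)
    show "\<phi> x = 1" if "r \<le> infdist x (- E)" for x using phi_1 that by (simp add: d_def)
    show "\<phi> x = 0" if "x \<notin> E" for x using subset_trans[OF closure_subset supp_E] that by auto
    show "norm (gradient \<phi> x) \<le> q / r * indicator (inner_layer E r) x" for x
    proof (cases "x \<in> E \<and> infdist x (- E) \<le> r")
      case True
      then show ?thesis using norm_gradient_le[OF \<phi>(1,4)] by simp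
    next
      case False
      \<comment> \<open>Off the layer the mollified function is constant near x: it is 0 on the open
        set of depth below \<delta> and 1 on that of depth above r.\<close>
      then consider "d x \<le> 0" | "d x > r" using d_pos[of x] unfolding d_def by linarith
      then have "gradient \<phi> x = 0"
      proof cases
        case 1
        show ?thesis
          by (rule gradient_eq_0[OF \<phi>(1), of "{x. d x < \<delta>}" _ 0])
             (use 1 \<delta> phi_0 open_Collect_less[OF cont_d continuous_on_const] in auto)
      next
        case 2
        show ?thesis
          by (rule gradient_eq_0[OF \<phi>(1), of "{x. r < d x}" _ 1])
             (use 2 phi_1 open_Collect_less[OF continuous_on_const cont_d] in auto)
      qed
      then show ?thesis using assms by (simp add: indicator_def)
    qed
  qed (use \<phi> in auto)
qed

text \<open>Integrate the derivative along the segment from x to x + z. After the integrals are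
  exchanged, translation invariance makes every t in [0, 1] contribute the same amount.\<close>

lemma smooth_translation_le:
  fixes f :: "'a::euclidean_space \<Rightarrow> real"
  assumes f: "smooth f"
  shows "(\<integral>\<^sup>+ x. ennreal \<bar>f (x + z) - f x\<bar> \<partial>lborel) \<le> (\<integral>\<^sup>+ x. ennreal \<bar>gradient f x \<bullet> z\<bar> \<partial>lborel)"
proof -
  note [measurable] = measurable_gradient[OF f]
  have "ennreal \<bar>f (x + z) - f x\<bar> \<le> (\<integral>\<^sup>+ t. ennreal \<bar>gradient f (x + t *\<^sub>R z) \<bullet> z\<bar> * indicator {0..1} t \<partial>lborel)" for x
  proof -
    define F where "F = (\<lambda>t. gradient f (x + t *\<^sub>R z) \<bullet> z)"
    have cont: "continuous_on {0..1} F"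
      unfolding F_def
      by (intro continuous_on_compose2[OF continuous_on_gradient_inner[OF f], of _ "\<lambda>t. x + t *\<^sub>R z"] continuous_intros) auto
    have "(F has_integral (f (x + 1 *\<^sub>R z) - f (x + 0 *\<^sub>R z))) {0..1}"
    proof (rule fundamental_theorem_of_calculus)
      fix t :: real
      have "((\<lambda>t. f (x + t *\<^sub>R z)) has_derivative (\<lambda>h. gradient f (x + t *\<^sub>R z) \<bullet> (h *\<^sub>R z))) (at t within {0..1})"
      proof (rule has_derivative_compose[where f = "\<lambda>t. x + t *\<^sub>R z" and g = f])
        show "((\<lambda>t. x + t *\<^sub>R z) has_derivative (\<lambda>h. h *\<^sub>R z)) (at t within {0..1})"
          by (auto intro!: derivative_eq_intros)
      qed (rule smooth_has_gradient[OF f])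
      then show "((\<lambda>t. f (x + t *\<^sub>R z)) has_vector_derivative F t) (at t within {0..1})"
        by (simp add: has_vector_derivative_def F_def)
    qed simp
    then have "f (x + z) - f x = integral {0..1} F" by (simp add: integral_unique)
    also have "\<bar>\<dots>\<bar> \<le> integral {0..1} (\<lambda>t. \<bar>F t\<bar>)"
      using Henstock_Kurzweil_Integration.integral_norm_bound_integral[of F "{0..1}" "\<lambda>t. \<bar>F t\<bar>"] cont
      by (auto intro!: integrable_continuous_real continuous_intros)
    finally have "ennreal \<bar>f (x + z) - f x\<bar> \<le> ennreal (integral {0..1} (\<lambda>t. \<bar>F t\<bar>))"
      by (rule ennreal_leI)
    also have "\<dots> = (\<integral>\<^sup>+ t. ennreal \<bar>F t\<bar> * indicator {0..1} t \<partial>lborel)"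
      using cont by (intro nn_integral_has_integral_lebesgue'[symmetric] integrable_integral integrable_continuous_real continuous_intros) auto
    finally show ?thesis by (simp add: F_def)
  qed
  then have "(\<integral>\<^sup>+ x. ennreal \<bar>f (x + z) - f x\<bar> \<partial>lborel)
     \<le> (\<integral>\<^sup>+ x. (\<integral>\<^sup>+ t. ennreal \<bar>gradient f (x + t *\<^sub>R z) \<bullet> z\<bar> * indicator {0..1} t \<partial>lborel) \<partial>lborel)"
    by (intro nn_integral_mono)
  also have "\<dots> = (\<integral>\<^sup>+ t. (\<integral>\<^sup>+ x. ennreal \<bar>gradient f (x + t *\<^sub>R z) \<bullet> z\<bar> * indicator {0..1} t \<partial>lborel) \<partial>lborel)"
    by (rule lborel_pair.Fubini') measurable
  also have "\<dots> = (\<integral>\<^sup>+ t. (\<integral>\<^sup>+ x. ennreal \<bar>gradient f x \<bullet> z\<bar> \<partial>lborel) * indicator {0..1::real} t \<partial>lborel)"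
  proof (rule nn_integral_cong)
    fix t :: real
    show "(\<integral>\<^sup>+ x. ennreal \<bar>gradient f (x + t *\<^sub>R z) \<bullet> z\<bar> * indicator {0..1} t \<partial>lborel)
      = (\<integral>\<^sup>+ x. ennreal \<bar>gradient f x \<bullet> z\<bar> \<partial>lborel) * indicator {0..1} t"
      by (subst nn_integral_multc) (simp_all add: nn_integral_lborel_translate[of "\<lambda>x. ennreal \<bar>gradient f x \<bullet> z\<bar>"])
  qed
  also have "\<dots> = (\<integral>\<^sup>+ x. ennreal \<bar>gradient f x \<bullet> z\<bar> \<partial>lborel)"
    by (subst nn_integral_cmult) simp_all
  finally show ?thesis .
qed

section \<open>Upper bounds from cutoff functions\<close>

text \<open>A segment from x to a point outside crosses the frontier, so the frontier is no farther
  away than the complement; as \<Omega> is open, the frontier is also part of the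
  complement.\<close>

lemma boundary_dist_eq_infdist:
  fixes \<Omega> :: "'a::euclidean_space set"
  assumes "open \<Omega>" "\<Omega> \<noteq> UNIV" "x \<in> \<Omega>"
  shows "boundary_dist \<Omega> x = infdist x (- \<Omega>)"
proof -
  have ne: "- \<Omega> \<noteq> {}" using assms by auto
  have front: "\<exists>z\<in>frontier \<Omega>. dist x z \<le> dist x y" if "y \<in> - \<Omega>" for y
  proof -
    have "closed_segment x y \<inter> frontier \<Omega> \<noteq> {}"
      using that assms(3) by (intro connected_Int_frontier) auto
    then obtain z where "z \<in> closed_segment x y" "z \<in> frontier \<Omega>" by blast
    then show ?thesis using dist_in_closed_segment[of z x y] by (auto simp: dist_commute)
  qed
  obtain y where y: "y \<in> - \<Omega>" "infdist x (- \<Omega>) = dist x y"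
    using infdist_attains_inf[OF _ ne] assms(1) by (metis closed_def double_complement)
  obtain z where z: "z \<in> frontier \<Omega>" "dist x z \<le> dist x y" using front[OF y(1)] by blast
  have "infdist x (frontier \<Omega>) \<le> infdist x (- \<Omega>)"
    unfolding y(2) using infdist_le2[OF z] .
  moreover have "frontier \<Omega> \<subseteq> - \<Omega>"
    using assms(1) by (auto simp: frontier_def interior_open)
  then have "infdist x (- \<Omega>) \<le> infdist x (frontier \<Omega>)"
    using z by (intro infdist_mono) auto
  ultimately show ?thesis by (simp add: boundary_dist_def)
qed

lemma boundary_dist_pos:
  assumes "open \<Omega>" "\<Omega> \<noteq> UNIV" "x \<in> \<Omega>"
  shows "boundary_dist \<Omega> x > 0"
  unfolding boundary_dist_eq_infdist[OF assms]
  using assms by (intro infdist_pos_not_in_closed) auto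

lemma continuous_boundary_dist: "continuous_on UNIV (boundary_dist \<Omega>)"
  unfolding boundary_dist_def[abs_def] by (intro continuous_intros)

lemma measurable_boundary_dist [measurable]: "boundary_dist \<Omega> \<in> borel_measurable borel"
  using continuous_boundary_dist by (rule borel_measurable_continuous_onI)

lemma measurable_infdist [measurable]: "(\<lambda>x :: 'a::euclidean_space. infdist x A) \<in> borel_measurable borel"
  by (intro borel_measurable_continuous_onI continuous_intros)

lemma nn_integral_le_cmult_emeasure:
  assumes "\<And>x. f x \<le> c * indicator A x" and "A \<in> sets M"
  shows "(\<integral>\<^sup>+ x. ennreal (f x) \<partial>M) \<le> ennreal c * emeasure M A"
proof -
  have "ennreal (f x) \<le> ennreal c * indicator A x" for x
    using ennreal_leI[OF assms(1)[of x]] by (cases "x \<in> A") auto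
  then have "(\<integral>\<^sup>+ x. ennreal (f x) \<partial>M) \<le> (\<integral>\<^sup>+ x. ennreal c * indicator A x \<partial>M)"
    by (rule nn_integral_mono)
  then show ?thesis by (simp add: nn_integral_cmult_indicator[OF assms(2)])
qed

text \<open>Away from the origin the kernel is integrable and every translation difference is at
  most twice the L^1 norm; regularity of \<open>u\<close> matters only for |z| \<le> R.\<close>

lemma gagliardo_seminorm_split:
  fixes u :: "'a::euclidean_space \<Rightarrow> real"
  assumes [measurable]: "u \<in> borel_measurable borel" and "0 < s" "0 < R"
  shows "gagliardo_seminorm s u \<le>
    (\<integral>\<^sup>+ z. kern s z * (\<integral>\<^sup>+ x. ennreal \<bar>u (x + z) - u x\<bar> \<partial>lborel) * indicator {z. norm z \<le> R} z \<partial>lborel)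
    + shell_mass TYPE('a) * ennreal (R powr (- s) / s) * (2 * (\<integral>\<^sup>+ x. ennreal \<bar>u x\<bar> \<partial>lborel))"
proof -
  define P where "P = (\<lambda>z. \<integral>\<^sup>+ x. ennreal \<bar>u (x + z) - u x\<bar> \<partial>lborel)"
  have [measurable]: "P \<in> borel_measurable borel" unfolding P_def by measurable
  define I where "I = (\<integral>\<^sup>+ x. ennreal \<bar>u x\<bar> \<partial>lborel)"
  have P_le: "P z \<le> 2 * I" for z
  proof -
    have "P z \<le> (\<integral>\<^sup>+ x. ennreal \<bar>u (x + z)\<bar> + ennreal \<bar>u x\<bar> \<partial>lborel)"
      unfolding P_def by (intro nn_integral_mono) (auto simp: ennreal_plus[symmetric] simp del: ennreal_plus intro!: ennreal_leI)
    also have "\<dots> = 2 * I"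
      by (subst nn_integral_add)
         (simp_all add: nn_integral_lborel_translate[of "\<lambda>x. ennreal \<bar>u x\<bar>"] I_def mult_2)
    finally show ?thesis .
  qed
  have "gagliardo_seminorm s u = (\<integral>\<^sup>+ z. kern s z * P z \<partial>lborel)"
    unfolding P_def by (rule gagliardo_seminorm_translate) measurable
  also have "\<dots> \<le> (\<integral>\<^sup>+ z. kern s z * P z * indicator {z. norm z \<le> R} z
      + kern s z * indicator {z. norm z > R} z * (2 * I) \<partial>lborel)"
  proof (intro nn_integral_mono)
    fix z :: 'a
    show "kern s z * P z \<le> kern s z * P z * indicator {z. norm z \<le> R} z
      + kern s z * indicator {z. norm z > R} z * (2 * I)"
      using P_le[of z] by (cases "norm z \<le> R") (auto intro: mult_left_mono)
  qed
  also have "\<dots> = (\<integral>\<^sup>+ z. kern s z * P z * indicator {z. norm z \<le> R} z \<partial>lborel)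
      + (\<integral>\<^sup>+ z. kern s (z :: 'a) * indicator {z. norm z > R} z * (2 * I) \<partial>lborel)"
    by (rule nn_integral_add) measurable
  also have "(\<integral>\<^sup>+ z. kern s (z :: 'a) * indicator {z. norm z > R} z * (2 * I) \<partial>lborel)
      = shell_mass TYPE('a) * ennreal (R powr (- s) / s) * (2 * I)"
    using nn_integral_kern_far[OF assms(2,3), where 'a='a]
    by (subst nn_integral_multc) simp_all
  finally show ?thesis by (simp add: P_def I_def)
qed

text \<open>For exponent one the moment is homogeneous of degree one in its vector, and rotation
  invariance does the rest.\<close>

lemma dir_moment_1_eq:
  fixes e g :: "real ^ 'n"
  assumes "norm e = 1"
  shows "dir_moment g 1 = ennreal (norm g) * dir_moment e 1"
proof (cases "g = 0")
  case False
  have "dir_moment g 1 = (\<integral>\<^sup>+ y. ennreal (norm g) * (indicator shell y *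
     ennreal ((\<bar>y \<bullet> (g /\<^sub>R norm g)\<bar> / norm y) powr 1 / norm y ^ DIM(real ^ 'n))) \<partial>lborel)"
    unfolding dir_moment_def
  proof (rule nn_integral_cong)
    fix y :: "real ^ 'n"
    have "(\<bar>y \<bullet> g\<bar> / norm y) powr 1 / norm y ^ DIM(real ^ 'n)
        = norm g * ((\<bar>y \<bullet> (g /\<^sub>R norm g)\<bar> / norm y) powr 1 / norm y ^ DIM(real ^ 'n))"
      using False by (simp add: abs_mult)
    then show "indicator shell y * ennreal ((\<bar>y \<bullet> g\<bar> / norm y) powr 1 / norm y ^ DIM(real ^ 'n))
      = ennreal (norm g) * (indicator shell y *
         ennreal ((\<bar>y \<bullet> (g /\<^sub>R norm g)\<bar> / norm y) powr 1 / norm y ^ DIM(real ^ 'n)))"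
      by (simp add: ennreal_mult[symmetric] indicator_def)
  qed
  also have "\<dots> = ennreal (norm g) * dir_moment (g /\<^sub>R norm g) 1"
    unfolding dir_moment_def by (rule nn_integral_cmult) measurable
  also have "dir_moment (g /\<^sub>R norm g) 1 = dir_moment e 1"
    using False assms by (intro dir_moment_rotate) simp
  finally show ?thesis .
qed (simp add: dir_moment_def)

text \<open>The near part is integrated in z first. For each x this gives the norm of the gradient
  times the sharp constant \<open>dir_moment e 1\<close>, so that the leading term is the total
  variation of \<open>f\<close>.\<close>

lemma gagliardo_seminorm_smooth_le:
  fixes f :: "real ^ 'n \<Rightarrow> real" and e :: "real ^ 'n"
  assumes f: "smooth f" and e: "norm e = 1" and s: "0 < s" "s < 1" and "0 < R"
  shows "gagliardo_seminorm s f \<le>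
    dir_moment e 1 * ennreal (R powr (1 - s) / (1 - s)) * (\<integral>\<^sup>+ x. ennreal (norm (gradient f x)) \<partial>lborel)
    + shell_mass TYPE(real ^ 'n) * ennreal (R powr (- s) / s) * (2 * (\<integral>\<^sup>+ x. ennreal \<bar>f x\<bar> \<partial>lborel))"
proof -
  note [measurable] = measurable_gradient[OF f] borel_measurable_continuous_onI[OF smooth_continuous[OF f]]
  have "(\<integral>\<^sup>+ z. kern s z * (\<integral>\<^sup>+ x. ennreal \<bar>f (x + z) - f x\<bar> \<partial>lborel) * indicator {z. norm z \<le> R} z \<partial>lborel)
    \<le> (\<integral>\<^sup>+ z. kern s z * (\<integral>\<^sup>+ x. ennreal \<bar>gradient f x \<bullet> z\<bar> \<partial>lborel) * indicator {z. norm z \<le> R} z \<partial>lborel)"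
    by (intro nn_integral_mono mult_right_mono mult_left_mono smooth_translation_le[OF f]) auto
  also have "\<dots> = (\<integral>\<^sup>+ z. (\<integral>\<^sup>+ x. kern s z * ennreal \<bar>gradient f x \<bullet> z\<bar> * indicator {z. norm z \<le> R} z \<partial>lborel) \<partial>lborel)"
    by (simp add: nn_integral_cmult nn_integral_multc)
  also have "\<dots> = (\<integral>\<^sup>+ x. (\<integral>\<^sup>+ z. kern s z * ennreal \<bar>gradient f x \<bullet> z\<bar> * indicator {z. norm z \<le> R} z \<partial>lborel) \<partial>lborel)"
    by (rule lborel_pair.Fubini') measurable
  also have "\<dots> = (\<integral>\<^sup>+ x. dir_moment e 1 * ennreal (R powr (1 - s) / (1 - s)) * ennreal (norm (gradient f x)) \<partial>lborel)"
  proof (rule nn_integral_cong)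
    fix x
    show "(\<integral>\<^sup>+ z. kern s z * ennreal \<bar>gradient f x \<bullet> z\<bar> * indicator {z. norm z \<le> R} z \<partial>lborel)
      = dir_moment e 1 * ennreal (R powr (1 - s) / (1 - s)) * ennreal (norm (gradient f x))"
      using nn_integral_kern_near[OF s(2) \<open>0 < R\<close>, of "gradient f x"] dir_moment_1_eq[OF e, of "gradient f x"]
      by (simp add: inner_commute mult_ac)
  qed
  also have "\<dots> = dir_moment e 1 * ennreal (R powr (1 - s) / (1 - s)) * (\<integral>\<^sup>+ x. ennreal (norm (gradient f x)) \<partial>lborel)"
    by (rule nn_integral_cmult) measurable
  finally show ?thesis
    using order_trans[OF gagliardo_seminorm_split[of f s R] add_right_mono] s \<open>0 < R\<close> by simp
qed

section \<open>Test functions and homogeneity\<close>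

lemma test_functions_measurable: "u \<in> test_functions \<Omega> \<Longrightarrow> u \<in> borel_measurable borel"
  by (auto simp: test_functions_def intro: borel_measurable_continuous_onI smooth_continuous)

lemma test_functions_mono: "u \<in> test_functions E \<Longrightarrow> E \<subseteq> \<Omega> \<Longrightarrow> u \<in> test_functions \<Omega>"
  by (auto simp: test_functions_def)

lemma nonzero_in_closure: "u x \<noteq> 0 \<Longrightarrow> x \<in> closure {x. u x \<noteq> 0}"
  by (rule subsetD[OF closure_subset]) simp

lemma test_functions_outside: "u \<in> test_functions \<Omega> \<Longrightarrow> x \<notin> \<Omega> \<Longrightarrow> u x = 0"
  using nonzero_in_closure[of u x] by (auto simp: test_functions_def)

lemma test_functions_cmult:
  assumes "u \<in> test_functions \<Omega>"
  shows "(\<lambda>x. c * u x) \<in> test_functions \<Omega>"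
proof -
  have sub: "closure {x. c * u x \<noteq> 0} \<subseteq> closure {x. u x \<noteq> 0}"
    by (intro closure_mono) auto
  moreover have "compact (closure {x. c * u x \<noteq> 0})"
    using assms bounded_subset[OF compact_imp_bounded sub] by (auto simp: test_functions_def compact_eq_bounded_closed)
  moreover have "smooth (\<lambda>x. c * u x)"
    using assms unfolding test_functions_def smooth_def
    by (intro allI k_times_cont_diff_mult k_times_cont_diff_const) auto
  ultimately show ?thesis using assms by (auto simp: test_functions_def)
qed

lemma test_functions_bounded:
  assumes "u \<in> test_functions \<Omega>"
  obtains B where "\<And>x. \<bar>u x\<bar> \<le> B"
proof -
  define K where "K = closure {x. u x \<noteq> 0}"
  have "compact (u ` K)"
    using assms smooth_continuous[of u]
    by (intro compact_continuous_image) (auto simp: K_def test_functions_def intro: continuous_on_subset)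
  then obtain B where B: "\<And>y. y \<in> u ` K \<Longrightarrow> norm y \<le> B"
    using compact_imp_bounded bounded_iff by metis
  have "\<bar>u x\<bar> \<le> max B 0" for x
  proof (cases "u x = 0")
    case False
    then have "x \<in> K" unfolding K_def by (rule nonzero_in_closure)
    then show ?thesis using B[of "u x"] by auto
  qed simp
  then show thesis by (rule that)
qed

lemma test_functions_integral_finite:
  assumes u: "u \<in> test_functions \<Omega>"
  shows "(\<integral>\<^sup>+ x. ennreal \<bar>u x\<bar> \<partial>lborel) < \<infinity>"
proof -
  obtain B where B: "\<And>x. \<bar>u x\<bar> \<le> B" using test_functions_bounded[OF u] by blast
  define K where "K = closure {x. u x \<noteq> 0}"
  have K: "compact K" using u by (simp add: K_def test_functions_def)
  have "(\<integral>\<^sup>+ x. ennreal \<bar>u x\<bar> \<partial>lborel) \<le> (\<integral>\<^sup>+ x. ennreal B * indicator K x \<partial>lborel)"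
  proof (intro nn_integral_mono)
    fix x
    have "x \<notin> K \<Longrightarrow> u x = 0" unfolding K_def using nonzero_in_closure[of u x] by blast
    then show "ennreal \<bar>u x\<bar> \<le> ennreal B * indicator K x"
      using B[of x] by (cases "x \<in> K") (auto intro: ennreal_leI)
  qed
  also have "\<dots> = ennreal B * emeasure lborel K"
    using K by (intro nn_integral_cmult_indicator) (simp add: borel_compact)
  also have "\<dots> < \<infinity>" using emeasure_compact_finite[OF K] by (simp add: ennreal_mult_less_top)
  finally show ?thesis .
qed

text \<open>On the compact support the distance to the boundary has a positive minimum. Finiteness
  is what allows test functions to be normalized.\<close>

lemma hardy_integral_finite:
  assumes u: "u \<in> test_functions \<Omega>" and \<Omega>: "open \<Omega>" "\<Omega> \<noteq> UNIV" and "0 < s"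
  shows "hardy_integral s \<Omega> u < \<infinity>"
proof -
  define K where "K = closure {x. u x \<noteq> 0}"
  have K: "compact K" "K \<subseteq> \<Omega>" using u by (simp_all add: K_def test_functions_def)
  have u0: "x \<notin> K \<Longrightarrow> u x = 0" for x unfolding K_def using nonzero_in_closure[of u x] by blast
  obtain c where c: "c > 0" "\<And>x. x \<in> K \<Longrightarrow> c \<le> boundary_dist \<Omega> x"
  proof (cases "K = {}")
    case False
    obtain x0 where "x0 \<in> K" "\<And>x. x \<in> K \<Longrightarrow> boundary_dist \<Omega> x0 \<le> boundary_dist \<Omega> x"
      using continuous_attains_inf[OF K(1) False continuous_on_subset[OF continuous_boundary_dist]] by blast
    then show ?thesis using that boundary_dist_pos[OF \<Omega>] K(2) by blast
  qed (use that[of 1] in auto)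
  have "hardy_integral s \<Omega> u \<le> (\<integral>\<^sup>+ x. ennreal (1 / c powr s) * ennreal \<bar>u x\<bar> \<partial>lborel)"
    unfolding hardy_integral_lborel
  proof (intro nn_integral_mono)
    fix x
    show "ennreal (\<bar>u x\<bar> / boundary_dist \<Omega> x powr s) * indicator \<Omega> x \<le> ennreal (1 / c powr s) * ennreal \<bar>u x\<bar>"
    proof (cases "x \<in> K")
      case True
      then have "c powr s \<le> boundary_dist \<Omega> x powr s"
        using c \<open>0 < s\<close> by (intro powr_mono2) auto
      then have "\<bar>u x\<bar> / boundary_dist \<Omega> x powr s \<le> \<bar>u x\<bar> / c powr s"
        using c(1) by (intro divide_left_mono mult_pos_pos) (auto intro: less_le_trans[of 0 "c powr s"])
      then have "ennreal (\<bar>u x\<bar> / boundary_dist \<Omega> x powr s) \<le> ennreal (1 / c powr s) * ennreal \<bar>u x\<bar>"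
        by (simp add: ennreal_mult[symmetric] ennreal_leI)
      then show ?thesis by (auto simp: indicator_def)
    qed (simp add: u0)
  qed
  also have "\<dots> = ennreal (1 / c powr s) * (\<integral>\<^sup>+ x. ennreal \<bar>u x\<bar> \<partial>lborel)"
    using test_functions_measurable[OF u] by (intro nn_integral_cmult) measurable
  also have "\<dots> < \<infinity>" using test_functions_integral_finite[OF u] by (simp add: ennreal_mult_less_top)
  finally show ?thesis .
qed

lemma hardy_integral_cmult:
  assumes [measurable]: "u \<in> borel_measurable borel" "\<Omega> \<in> sets borel"
  shows "hardy_integral s \<Omega> (\<lambda>x. c * u x) = ennreal \<bar>c\<bar> * hardy_integral s \<Omega> u"
proof -
  have "hardy_integral s \<Omega> (\<lambda>x. c * u x) = (\<integral>\<^sup>+ x. ennreal \<bar>c\<bar> * (ennreal (\<bar>u x\<bar> / boundary_dist \<Omega> x powr s) * indicator \<Omega> x) \<partial>lborel)"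
    unfolding hardy_integral_lborel
    by (intro nn_integral_cong) (simp add: abs_mult ennreal_mult[symmetric] indicator_def)
  also have "\<dots> = ennreal \<bar>c\<bar> * hardy_integral s \<Omega> u"
    unfolding hardy_integral_lborel by (rule nn_integral_cmult) measurable
  finally show ?thesis .
qed

lemma gagliardo_seminorm_cmult:
  assumes [measurable]: "u \<in> borel_measurable borel"
  shows "gagliardo_seminorm s (\<lambda>x. c * u x) = ennreal \<bar>c\<bar> * gagliardo_seminorm s u"
proof -
  have "(\<lambda>x. c * u x) \<in> borel_measurable borel" by measurable
  then have "gagliardo_seminorm s (\<lambda>x. c * u x)
     = (\<integral>\<^sup>+ z. kern s z * (\<integral>\<^sup>+ x. ennreal \<bar>c\<bar> * ennreal \<bar>u (x + z) - u x\<bar> \<partial>lborel) \<partial>lborel)"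
    by (simp add: gagliardo_seminorm_translate right_diff_distrib[symmetric] abs_mult ennreal_mult)
  also have "\<dots> = (\<integral>\<^sup>+ z. ennreal \<bar>c\<bar> * (kern s z * (\<integral>\<^sup>+ x. ennreal \<bar>u (x + z) - u x\<bar> \<partial>lborel)) \<partial>lborel)"
    by (simp add: nn_integral_cmult mult_ac)
  also have "\<dots> = ennreal \<bar>c\<bar> * gagliardo_seminorm s u"
    unfolding gagliardo_seminorm_translate[OF assms] by (rule nn_integral_cmult) measurable
  finally show ?thesis .
qed

text \<open>Homogeneous form of the infimum: divide \<open>u\<close> by its Hardy integral h, which
  is finite and, outside the trivial case, positive.\<close>

lemma hardy_constant_mult_le:
  assumes u: "u \<in> test_functions \<Omega>" and \<Omega>: "open \<Omega>" "\<Omega> \<noteq> UNIV" and "0 < s"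
  shows "hardy_constant s \<Omega> * hardy_integral s \<Omega> u \<le> gagliardo_seminorm s u"
proof (cases "hardy_integral s \<Omega> u = 0")
  case False
  have meas: "u \<in> borel_measurable borel" "\<Omega> \<in> sets borel"
    using test_functions_measurable[OF u] \<Omega>(1) by auto
  obtain h where h: "hardy_integral s \<Omega> u = ennreal h" "h > 0"
    using hardy_integral_finite[OF assms] False by (cases "hardy_integral s \<Omega> u") auto
  have "hardy_integral s \<Omega> (\<lambda>x. (1 / h) * u x) = 1"
    unfolding hardy_integral_cmult[OF meas] h using h(2) by (simp add: ennreal_mult[symmetric])
  then have "hardy_constant s \<Omega> \<le> gagliardo_seminorm s (\<lambda>x. (1 / h) * u x)"
    unfolding hardy_constant_def using test_functions_cmult[OF u, of "1 / h"]
    by (intro Inf_lower CollectI exI[of _ "\<lambda>x. (1 / h) * u x"]) blast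
  also have "\<dots> = ennreal (1 / h) * gagliardo_seminorm s u"
    unfolding gagliardo_seminorm_cmult[OF meas(1)] using h(2) by simp
  finally have "hardy_constant s \<Omega> * ennreal h \<le> ennreal (1 / h) * gagliardo_seminorm s u * ennreal h"
    by (rule mult_right_mono) simp
  also have "\<dots> = ennreal (1 / h) * ennreal h * gagliardo_seminorm s u" by (simp add: mult_ac)
  also have "ennreal (1 / h) * ennreal h = 1" using h(2) by (simp add: ennreal_mult[symmetric])
  finally show ?thesis by (simp add: h)
qed simp

lemma hardy_constant_ge:
  assumes "\<And>u. u \<in> test_functions \<Omega> \<Longrightarrow> C * hardy_integral s \<Omega> u \<le> gagliardo_seminorm s u"
  shows "C \<le> hardy_constant s \<Omega>"
  unfolding hardy_constant_def 
proof (rule Inf_greatest)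
  fix a assume "a \<in> {gagliardo_seminorm s u |u. u \<in> test_functions \<Omega> \<and> hardy_integral s \<Omega> u = 1}"
  then obtain u where u: "a = gagliardo_seminorm s u" "u \<in> test_functions \<Omega>" "hardy_integral s \<Omega> u = 1"
    by blast
  then show "C \<le> a" using assms[OF u(2)] by simp
qed

text \<open>The cutoffs of \<open>E\<close> have total gradient mass at most \<open>q M\<close> along a suitable sequence of widths,
  and the factor \<open>q > 1\<close> is the price for mollification.\<close>

lemma hardy_constant_upper:
  fixes E \<Omega> :: "(real ^ 'n) set" and e :: "real ^ 'n"
  assumes E: "open E" "bounded E" "E \<subseteq> \<Omega>" and \<Omega>: "open \<Omega>" "\<Omega> \<noteq> UNIV"
    and s: "0 < s" "s < 1" and e: "norm e = 1" and "0 < R" "0 \<le> M"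
    and layer: "\<And>\<rho>. \<rho> > 0 \<Longrightarrow> \<exists>r. 0 < r \<and> r < \<rho> \<and> emeasure lborel (inner_layer E r) \<le> ennreal (M * r)"
  shows "hardy_constant s \<Omega> * (\<integral>\<^sup>+ x\<in>E. ennreal (1 / boundary_dist \<Omega> x powr s) \<partial>lborel)
    \<le> dir_moment e 1 * ennreal (M * R powr (1 - s) / (1 - s))
      + shell_mass TYPE(real ^ 'n) * ennreal (2 * R powr (- s) / s) * emeasure lborel E"
    (is "?h * ?I \<le> ?A + ?B")
proof -
  define w where "w = (\<lambda>x. ennreal (1 / boundary_dist \<Omega> x powr s))"
  have [measurable]: "w \<in> borel_measurable borel" unfolding w_def by measurable
  have [measurable]: "E \<in> sets borel" "\<Omega> \<in> sets borel" using E \<Omega> by auto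
  \<comment> \<open>The Hardy weight over the points of depth at least \<rho>. Every cutoff of width
    r < \<rho> equals one there, so it is enough that admissible widths r occur arbitrarily close to
    zero.\<close>
  define J where "J = (\<lambda>\<rho>. \<integral>\<^sup>+ x. w x * indicator {x \<in> E. \<rho> \<le> infdist x (- E)} x \<partial>lborel)"
  have approx: "?h * J \<rho> \<le> ennreal q * ?A + ?B" if "\<rho> > 0" "q > 1" for \<rho> q
  proof -
    obtain r where r: "0 < r" "r < \<rho>" "emeasure lborel (inner_layer E r) \<le> ennreal (M * r)"
      using layer[OF \<open>\<rho> > 0\<close>] by blast
    obtain \<phi> where \<phi>: "\<phi> \<in> test_functions E" "\<And>x. 0 \<le> \<phi> x" "\<And>x. \<phi> x \<le> 1"
      "\<And>x. r \<le> infdist x (- E) \<Longrightarrow> \<phi> x = 1" "\<And>x. x \<notin> E \<Longrightarrow> \<phi> x = 0"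
      "\<And>x. norm (gradient \<phi> x) \<le> q / r * indicator (inner_layer E r) x"
      by (rule cutoff_exists[OF E(1,2) r(1) \<open>q > 1\<close>], rule that)
    have \<phi>\<Omega>: "\<phi> \<in> test_functions \<Omega>" using test_functions_mono[OF \<phi>(1) E(3)] .
    have sm: "smooth \<phi>" using \<phi>(1) by (simp add: test_functions_def)
    have "J \<rho> \<le> hardy_integral s \<Omega> \<phi>"
      unfolding J_def hardy_integral_lborel
    proof (intro nn_integral_mono)
      fix x
      show "w x * indicator {x \<in> E. \<rho> \<le> infdist x (- E)} x
        \<le> ennreal (\<bar>\<phi> x\<bar> / boundary_dist \<Omega> x powr s) * indicator \<Omega> x"
        using \<phi>(4)[of x] r(2) E(3) by (cases "x \<in> E \<and> \<rho> \<le> infdist x (- E)") (auto simp: w_def)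
    qed
    then have "?h * J \<rho> \<le> ?h * hardy_integral s \<Omega> \<phi>" by (rule mult_left_mono) simp
    also have "\<dots> \<le> gagliardo_seminorm s \<phi>"
      by (rule hardy_constant_mult_le[OF \<phi>\<Omega> \<Omega> s(1)])
    also have "\<dots> \<le> dir_moment e 1 * ennreal (R powr (1 - s) / (1 - s)) * (\<integral>\<^sup>+ x. ennreal (norm (gradient \<phi> x)) \<partial>lborel)
        + shell_mass TYPE(real ^ 'n) * ennreal (R powr (- s) / s) * (2 * (\<integral>\<^sup>+ x. ennreal \<bar>\<phi> x\<bar> \<partial>lborel))"
      by (rule gagliardo_seminorm_smooth_le[OF sm e s \<open>0 < R\<close>])
    also have "\<dots> \<le> dir_moment e 1 * ennreal (R powr (1 - s) / (1 - s)) * ennreal (q * M)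
        + shell_mass TYPE(real ^ 'n) * ennreal (R powr (- s) / s) * (2 * emeasure lborel E)"
    proof (intro add_mono mult_left_mono)
      have "(\<integral>\<^sup>+ x. ennreal (norm (gradient \<phi> x)) \<partial>lborel) \<le> ennreal (q / r) * emeasure lborel (inner_layer E r)"
        by (intro nn_integral_le_cmult_emeasure \<phi>(6)) measurable
      also have "\<dots> \<le> ennreal (q / r) * ennreal (M * r)"
        using r(3) by (rule mult_left_mono) simp
      also have "\<dots> = ennreal (q * M)"
        using r(1) \<open>q > 1\<close> \<open>0 \<le> M\<close> by (simp add: ennreal_mult[symmetric])
      finally show "(\<integral>\<^sup>+ x. ennreal (norm (gradient \<phi> x)) \<partial>lborel) \<le> ennreal (q * M)" .
      have "(\<integral>\<^sup>+ x. ennreal \<bar>\<phi> x\<bar> \<partial>lborel) \<le> (\<integral>\<^sup>+ x. indicator E x \<partial>lborel)"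
      proof (intro nn_integral_mono)
        fix x
        show "ennreal \<bar>\<phi> x\<bar> \<le> indicator E x"
          using \<phi>(2,3,5)[of x] by (cases "x \<in> E") auto
      qed
      then show "(\<integral>\<^sup>+ x. ennreal \<bar>\<phi> x\<bar> \<partial>lborel) \<le> emeasure lborel E" by simp
    qed auto
    also have "dir_moment e 1 * ennreal (R powr (1 - s) / (1 - s)) * ennreal (q * M)
      = ennreal q * (dir_moment e 1 * (ennreal M * ennreal (R powr (1 - s) / (1 - s))))"
    proof -
      have "ennreal (q * M) = ennreal q * ennreal M" using \<open>q > 1\<close> \<open>0 \<le> M\<close> by (intro ennreal_mult) auto
      then show ?thesis by (simp only: mult_ac)
    qed
    also have "ennreal M * ennreal (R powr (1 - s) / (1 - s)) = ennreal (M * R powr (1 - s) / (1 - s))"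
      using \<open>0 \<le> M\<close> s by (simp add: ennreal_mult[symmetric])
    also have "shell_mass TYPE(real ^ 'n) * ennreal (R powr (- s) / s) * (2 * emeasure lborel E)
       = shell_mass TYPE(real ^ 'n) * (ennreal 2 * ennreal (R powr (- s) / s)) * emeasure lborel E"
      by (simp add: mult_ac)
    also have "ennreal 2 * ennreal (R powr (- s) / s) = ennreal (2 * R powr (- s) / s)"
      using s by (simp add: ennreal_mult[symmetric] del: ennreal_numeral)
    finally show ?thesis .
  qed
  have d_pos: "infdist x (- E) > 0" if "x \<in> E" for x
    using that E(1,3) \<Omega>(2) by (intro infdist_pos_not_in_closed) auto
  have "?I = (\<integral>\<^sup>+ x. (SUP n. w x * indicator {x \<in> E. 1 / Suc n \<le> infdist x (- E)} x) \<partial>lborel)"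
  proof (rule nn_integral_cong)
    fix x
    have "(SUP n. w x * indicator {x \<in> E. 1 / Suc n \<le> infdist x (- E)} x) = w x * indicator E x"
    proof (rule antisym)
      show "(SUP n. w x * indicator {x \<in> E. 1 / Suc n \<le> infdist x (- E)} x) \<le> w x * indicator E x"
        by (intro SUP_least mult_left_mono) (auto simp: indicator_def)
      show "w x * indicator E x \<le> (SUP n. w x * indicator {x \<in> E. 1 / Suc n \<le> infdist x (- E)} x)"
      proof (cases "x \<in> E")
        case True
        obtain n where "1 / Suc n < infdist x (- E)"
          using d_pos[OF True] nat_approx_posE by metis
        then show ?thesis using True by (intro SUP_upper2[of n]) auto
      qed simp
    qed
    then show "ennreal (1 / boundary_dist \<Omega> x powr s) * indicator E x
      = (SUP n. w x * indicator {x \<in> E. 1 / Suc n \<le> infdist x (- E)} x)"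
      by (simp add: w_def)
  qed
  also have "\<dots> = (SUP n. J (1 / Suc n))"
    unfolding J_def
  proof (rule nn_integral_monotone_convergence_SUP)
    show "incseq (\<lambda>n x. w x * indicator {x \<in> E. 1 / real (Suc n) \<le> infdist x (- E)} x)"
    proof (intro incseq_SucI le_funI mult_left_mono)
      fix n x
      have "1 / real (Suc (Suc n)) \<le> 1 / real (Suc n)" by (intro divide_left_mono) auto
      then show "indicator {x \<in> E. 1 / real (Suc n) \<le> infdist x (- E)} x
         \<le> (indicator {x \<in> E. 1 / real (Suc (Suc n)) \<le> infdist x (- E)} x :: ennreal)"
        by (auto simp: indicator_def)
    qed simp
  qed measurable
  finally have "?h * ?I = (SUP n. ?h * J (1 / Suc n))"
    by (simp add: SUP_mult_left_ennreal)
  \<comment> \<open>With q fixed, the depth tends to zero by monotone convergence; only afterwards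
    does q tend to one.\<close>
  then have bound: "?h * ?I \<le> ennreal (1 + 1 / Suc n) * ?A + ?B" for n
    by (simp only:) (rule SUP_least, rule approx, simp_all)
  have "?A < top" using dir_moment_finite[OF e] by (simp add: ennreal_mult_less_top)
  then have "(\<lambda>n. ?A * ennreal (1 + 1 / Suc n)) \<longlonglongrightarrow> ?A * ennreal (1 + 0)"
    by (intro ennreal_tendsto_cmult tendsto_ennrealI tendsto_add tendsto_const LIMSEQ_Suc[OF lim_1_over_n])
  then have "(\<lambda>n. ?A * ennreal (1 + 1 / Suc n) + ?B) \<longlonglongrightarrow> ?A * ennreal (1 + 0) + ?B"
    by (intro tendsto_add tendsto_const)
  then have "?h * ?I \<le> ?A * ennreal (1 + 0) + ?B"
    using bound by (intro LIMSEQ_le_const[of _ _ "?h * ?I"]) (auto simp: mult.commute)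
  then show ?thesis by simp
qed

section \<open>Lower bounds for convex sets and half-spaces\<close>

text \<open>Write f powr (- s) as the integral of s t powr (- s - 1) over t \<ge> f and exchange the
  integrals. Hardy integrals are then controlled by the measures of layers alone.\<close>

lemma nn_integral_layer_cake:
  fixes f :: "'a::euclidean_space \<Rightarrow> real"
  assumes [measurable]: "f \<in> borel_measurable borel" "E \<in> sets borel" and pos: "\<And>x. x \<in> E \<Longrightarrow> f x > 0" and "s > 0"
  shows "(\<integral>\<^sup>+ x\<in>E. ennreal (1 / f x powr s) \<partial>lborel) =
    (\<integral>\<^sup>+ t. ennreal (s * t powr (- s - 1)) * emeasure lborel {x \<in> E. f x \<le> t} * indicator {0<..} t \<partial>lborel)"
proof -
  have "(\<integral>\<^sup>+ x\<in>E. ennreal (1 / f x powr s) \<partial>lborel)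
    = (\<integral>\<^sup>+ x. (\<integral>\<^sup>+ t. ennreal (s * t powr (- s - 1)) * indicator {0<..} t * indicator {x \<in> E. f x \<le> t} x \<partial>lborel) \<partial>lborel)"
  proof (rule nn_integral_cong)
    fix x
    show "ennreal (1 / f x powr s) * indicator E x
      = (\<integral>\<^sup>+ t. ennreal (s * t powr (- s - 1)) * indicator {0<..} t * indicator {x \<in> E. f x \<le> t} x \<partial>lborel)"
    proof (cases "x \<in> E")
      case True
      have "(\<integral>\<^sup>+ t. ennreal (s * t powr (- s - 1)) * indicator {0<..} t * indicator {x \<in> E. f x \<le> t} x \<partial>lborel)
        = (\<integral>\<^sup>+ t. ennreal s * (ennreal (t powr (- s - 1)) * indicator {f x..} t) \<partial>lborel)"
        using pos[OF True] True \<open>s > 0\<close>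
        by (intro nn_integral_cong) (auto simp: indicator_def ennreal_mult)
      also have "\<dots> = ennreal s * ennreal (f x powr (- s) / s)"
        using nn_integral_powr_atLeast[OF \<open>s > 0\<close> pos[OF True]] by (simp add: nn_integral_cmult)
      also have "\<dots> = ennreal (1 / f x powr s)"
        using \<open>s > 0\<close> by (simp add: ennreal_mult[symmetric] powr_minus_divide)
      finally show ?thesis using True by simp
    qed simp
  qed
  also have "\<dots> = (\<integral>\<^sup>+ t. (\<integral>\<^sup>+ x. ennreal (s * t powr (- s - 1)) * indicator {0<..} t * indicator {x \<in> E. f x \<le> t} x \<partial>lborel) \<partial>lborel)"
    by (rule lborel_pair.Fubini') measurable
  also have "\<dots> = (\<integral>\<^sup>+ t. ennreal (s * t powr (- s - 1)) * emeasure lborel {x \<in> E. f x \<le> t} * indicator {0<..} t \<partial>lborel)"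
    by (intro nn_integral_cong) (simp add: nn_integral_cmult mult_ac)
  finally show ?thesis .
qed

text \<open>m min(t, t0) is the layer function of a set that fills up at rate m until it is
  exhausted at depth t0. The lower bound for cutoffs and the bathtub bound on intervals both compare
  with this profile.\<close>

lemma nn_integral_powr_min:
  assumes "0 < s" "s < 1" "0 < t0" "0 \<le> m"
  shows "(\<integral>\<^sup>+ t. ennreal (s * t powr (- s - 1)) * ennreal (m * min t t0) * indicator {0<..} t \<partial>lborel)
    = ennreal (m * t0 powr (1 - s) / (1 - s))"
proof -
  have "(\<integral>\<^sup>+ t. ennreal (s * t powr (- s - 1)) * ennreal (m * min t t0) * indicator {0<..} t \<partial>lborel)
    = (\<integral>\<^sup>+ t. ennreal (s * m) * (ennreal (t powr ((1 - s) - 1)) * indicator {0<..t0} t)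
       + ennreal (s * m * t0) * (ennreal (t powr (- s - 1)) * indicator {t0<..} t) \<partial>lborel)"
  proof (rule nn_integral_cong)
    fix t :: real
    have "t powr (- s - 1) * t = t powr (- s)" if "t > 0"
      using that by (simp add: powr_diff)
    then have "s * t powr (- s - 1) * (m * t) = s * m * t powr (- s)" if "t > 0"
      using that by (metis mult.assoc mult.commute)
    then show "ennreal (s * t powr (- s - 1)) * ennreal (m * min t t0) * indicator {0<..} t
      = ennreal (s * m) * (ennreal (t powr ((1 - s) - 1)) * indicator {0<..t0} t)
       + ennreal (s * m * t0) * (ennreal (t powr (- s - 1)) * indicator {t0<..} t)"
      using assms by (cases "t > 0"; cases "t \<le> t0") (auto simp: ennreal_mult[symmetric] min_def mult_ac)
  qed
  also have "\<dots> = ennreal (s * m) * ennreal (t0 powr (1 - s) / (1 - s)) + ennreal (s * m * t0) * ennreal (t0 powr (- s) / s)"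
    using nn_integral_powr_Ioc[of "1 - s" t0] nn_integral_powr_greaterThan[of s t0] assms
    by (subst nn_integral_add) (simp_all add: nn_integral_cmult)
  also have "\<dots> = ennreal (s * m * (t0 powr (1 - s) / (1 - s)) + s * m * t0 * (t0 powr (- s) / s))"
    using assms by (simp add: ennreal_mult[symmetric] ennreal_plus[symmetric] del: ennreal_plus)
  also have "s * m * (t0 powr (1 - s) / (1 - s)) + s * m * t0 * (t0 powr (- s) / s) = m * t0 powr (1 - s) / (1 - s)"
  proof -
    have "t0 powr (1 - s) = t0 * t0 powr (- s)" using assms by (simp add: powr_diff powr_minus_divide)
    then show ?thesis using assms by (simp add: field_simps)
  qed
  finally show ?thesis .
qed

lemma nn_integral_layer_ge:
  fixes f :: "'a::euclidean_space \<Rightarrow> real"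
  assumes f [measurable]: "f \<in> borel_measurable borel" "E \<in> sets borel" and pos: "\<And>x. x \<in> E \<Longrightarrow> f x > 0"
    and s: "0 < s" "s < 1" and "0 < t0" "0 \<le> m"
    and layer: "\<And>t. 0 < t \<Longrightarrow> t < t0 \<Longrightarrow> ennreal (m * t) \<le> emeasure lborel {x \<in> E. f x \<le> t}"
  shows "ennreal (m * t0 powr (1 - s) / (1 - s)) \<le> (\<integral>\<^sup>+ x\<in>E. ennreal (1 / f x powr s) \<partial>lborel)"
proof -
  have le: "ennreal (m * min t t0) \<le> emeasure lborel {x \<in> E. f x \<le> t}" if "t > 0" for t
  proof (cases "t < t0")
    case False
    \<comment> \<open>The layer hypothesis stops short of t0, so the bound there is obtained as the
      left limit of the bounds for r < t0.\<close>
    have "ennreal (m * t0) \<le> emeasure lborel {x \<in> E. f x \<le> t}"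
    proof (rule tendsto_upperbound)
      show "((\<lambda>r. ennreal (m * r)) \<longlongrightarrow> ennreal (m * t0)) (at_left t0)"
        by (intro tendsto_ennrealI tendsto_intros)
      have "\<forall>\<^sub>F r in at_left t0. r \<in> {0<..<t0}"
        using \<open>0 < t0\<close> by (rule eventually_at_left_real)
      then show "\<forall>\<^sub>F r in at_left t0. ennreal (m * r) \<le> emeasure lborel {x \<in> E. f x \<le> t}"
      proof eventually_elim
        case (elim r)
        then have "ennreal (m * r) \<le> emeasure lborel {x \<in> E. f x \<le> r}" by (intro layer) auto
        also have "\<dots> \<le> emeasure lborel {x \<in> E. f x \<le> t}"
          using elim False by (intro emeasure_mono) auto
        finally show ?case .
      qed
    qed simp
    then show ?thesis using False by simp
  qed (use layer that in simp)
  have "ennreal (m * t0 powr (1 - s) / (1 - s))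
    = (\<integral>\<^sup>+ t. ennreal (s * t powr (- s - 1)) * ennreal (m * min t t0) * indicator {0<..} t \<partial>lborel)"
    by (rule nn_integral_powr_min[symmetric]) fact+
  also have "\<dots> \<le> (\<integral>\<^sup>+ t. ennreal (s * t powr (- s - 1)) * emeasure lborel {x \<in> E. f x \<le> t} * indicator {0<..} t \<partial>lborel)"
  proof (intro nn_integral_mono)
    fix t :: real
    show "ennreal (s * t powr (- s - 1)) * ennreal (m * min t t0) * indicator {0<..} t
      \<le> ennreal (s * t powr (- s - 1)) * emeasure lborel {x \<in> E. f x \<le> t} * indicator {0<..} t"
      using le[of t] by (cases "t > 0") (auto intro: mult_left_mono)
  qed
  also have "\<dots> = (\<integral>\<^sup>+ x\<in>E. ennreal (1 / f x powr s) \<partial>lborel)"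
    by (rule nn_integral_layer_cake[symmetric]) fact+
  finally show ?thesis .
qed

lemma nn_integral_layer_le:
  fixes f :: "'a::euclidean_space \<Rightarrow> real"
  assumes f [measurable]: "f \<in> borel_measurable borel" "E \<in> sets borel" and pos: "\<And>x. x \<in> E \<Longrightarrow> f x > 0"
    and s: "0 < s" "s < 1" and "0 < t0" "0 \<le> m"
    and layer: "\<And>t. 0 < t \<Longrightarrow> emeasure lborel {x \<in> E. f x \<le> t} \<le> ennreal (m * min t t0)"
  shows "(\<integral>\<^sup>+ x\<in>E. ennreal (1 / f x powr s) \<partial>lborel) \<le> ennreal (m * t0 powr (1 - s) / (1 - s))"
proof -
  have "(\<integral>\<^sup>+ x\<in>E. ennreal (1 / f x powr s) \<partial>lborel)
    = (\<integral>\<^sup>+ t. ennreal (s * t powr (- s - 1)) * emeasure lborel {x \<in> E. f x \<le> t} * indicator {0<..} t \<partial>lborel)"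
    by (rule nn_integral_layer_cake) fact+
  also have "\<dots> \<le> (\<integral>\<^sup>+ t. ennreal (s * t powr (- s - 1)) * ennreal (m * min t t0) * indicator {0<..} t \<partial>lborel)"
  proof (intro nn_integral_mono)
    fix t :: real
    show "ennreal (s * t powr (- s - 1)) * emeasure lborel {x \<in> E. f x \<le> t} * indicator {0<..} t
      \<le> ennreal (s * t powr (- s - 1)) * ennreal (m * min t t0) * indicator {0<..} t"
      using layer[of t] by (cases "t > 0") (auto intro: mult_left_mono)
  qed
  also have "\<dots> = ennreal (m * t0 powr (1 - s) / (1 - s))"
    by (rule nn_integral_powr_min) fact+
  finally show ?thesis .
qed

text \<open>The kernel is even and t > 0, so the exterior of the slab splits into two disjoint
  half-spaces of equal weight.\<close>

lemma nn_integral_kern_halfspace: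
  fixes e :: "'a::euclidean_space"
  assumes "0 < s" "0 < t"
  shows "2 * (\<integral>\<^sup>+ z. kern s z * indicator {z. z \<bullet> e \<ge> t} z \<partial>lborel) = dir_moment e s * ennreal (t powr (- s) / s)"
proof -
  define I where "I = (\<integral>\<^sup>+ z. kern s z * indicator {z. z \<bullet> e \<ge> t} z \<partial>lborel)"
  have "(\<integral>\<^sup>+ z. kern s (- z) * indicator {z. z \<bullet> e \<ge> t} (- z) \<partial>lborel) = I"
    unfolding I_def by (rule nn_integral_lborel_minus) measurable
  then have neg: "(\<integral>\<^sup>+ z. kern s z * indicator {z. - (z \<bullet> e) \<ge> t} z \<partial>lborel) = I"
    by (simp add: indicator_def)
  have "dir_moment e s * ennreal (t powr (- s) / s) = (\<integral>\<^sup>+ z. kern s z * indicator {z. \<bar>z \<bullet> e\<bar> \<ge> t} z \<partial>lborel)"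
    by (rule nn_integral_kern_slab[symmetric]) fact+
  also have "\<dots> = (\<integral>\<^sup>+ z. kern s z * indicator {z. z \<bullet> e \<ge> t} z + kern s z * indicator {z. - (z \<bullet> e) \<ge> t} z \<partial>lborel)"
    using \<open>0 < t\<close> by (intro nn_integral_cong) (auto simp: indicator_def)
  also have "\<dots> = I + I"
    using neg unfolding I_def by (subst nn_integral_add) auto
  finally show ?thesis by (simp add: I_def mult_2)
qed

text \<open>Separate \<Omega> from a nearest outside point p. The hyperplane has distance at most |x
  - p| from x, so everything at least that far in the normal direction is outside.\<close>

lemma convex_complement_contains_halfspace:
  fixes \<Omega> :: "'a::euclidean_space set"
  assumes "open \<Omega>" "convex \<Omega>" "\<Omega> \<noteq> UNIV" "x \<in> \<Omega>"
  obtains \<nu> where "norm \<nu> = 1" "\<And>y. (x - y) \<bullet> \<nu> \<ge> boundary_dist \<Omega> x \<Longrightarrow> y \<notin> \<Omega>"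
proof -
  have "closed (- \<Omega>)" "- \<Omega> \<noteq> {}" using assms by auto
  then obtain p where p: "p \<in> - \<Omega>" "infdist x (- \<Omega>) = dist x p"
    using infdist_attains_inf by metis
  obtain a b where a: "a \<noteq> 0" "\<And>y. y \<in> \<Omega> \<Longrightarrow> a \<bullet> y \<le> b" "b \<le> a \<bullet> p"
    using separating_hyperplane_sets[of \<Omega> "{p}"] assms p by auto
  \<comment> \<open>Openness keeps \<Omega> off the hyperplane itself, since a small push along
    \<open>a\<close> would violate the separation.\<close>
  have strict: "a \<bullet> y < b" if "y \<in> \<Omega>" for y
  proof -
    obtain r where r: "r > 0" "ball y r \<subseteq> \<Omega>" using assms(1) \<open>y \<in> \<Omega>\<close> open_contains_ball by blast
    have "y + (r / (2 * norm a)) *\<^sub>R a \<in> ball y r" using r(1) a(1) by (simp add: dist_norm)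
    then have "a \<bullet> (y + (r / (2 * norm a)) *\<^sub>R a) \<le> b" using r(2) a(2) by blast
    moreover have "0 < r / (2 * norm a) * (a \<bullet> a)" using r(1) a(1) by simp
    ultimately show ?thesis by (simp add: inner_add_right)
  qed
  show thesis
  \<comment> \<open>The sign is reversed so that the condition concerns x - y, the variable of the
    kernel.\<close>
  proof (rule that[of "- (a /\<^sub>R norm a)"])
    show "norm (- (a /\<^sub>R norm a)) = 1" using a(1) by simp
    fix y assume "(x - y) \<bullet> - (a /\<^sub>R norm a) \<ge> boundary_dist \<Omega> x"
    then have "dist x p \<le> ((y - x) \<bullet> a) / norm a"
      using boundary_dist_eq_infdist[OF assms(1,3,4)] p(2)
      by (simp add: inner_diff_left divide_inverse_commute right_diff_distrib)
    then have "norm a * dist x p \<le> a \<bullet> y - a \<bullet> x"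
      using a(1) by (simp add: pos_le_divide_eq inner_diff_right inner_commute[of _ a] mult.commute)
    moreover have "a \<bullet> (p - x) \<le> norm a * dist x p"
      using norm_cauchy_schwarz[of a "p - x"] by (simp add: dist_norm norm_minus_commute)
    ultimately have "b \<le> a \<bullet> y" using a(3) by (simp add: inner_diff_right)
    then show "y \<notin> \<Omega>" using strict[of y] by auto
  qed
qed

lemma gagliardo_seminorm_ge_convex:
  fixes \<Omega> :: "(real ^ 'n) set" and e :: "real ^ 'n"
  assumes \<Omega>: "open \<Omega>" "convex \<Omega>" "\<Omega> \<noteq> UNIV" and "norm e = 1" "0 < s"
    and u [measurable]: "u \<in> borel_measurable borel" and u0: "\<And>x. x \<notin> \<Omega> \<Longrightarrow> u x = 0"
  shows "dir_moment e s * ennreal (1 / s) * hardy_integral s \<Omega> u \<le> gagliardo_seminorm s u"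
proof -
  have [measurable]: "\<Omega> \<in> sets borel" using \<Omega> by simp
  \<comment> \<open>The total interaction of x with the complement; twice this dominates the Hardy
    weight times the constant.\<close>
  define g where "g = (\<lambda>x. \<integral>\<^sup>+ y. kern s (x - y) * indicator (- \<Omega>) y \<partial>lborel)"
  have [measurable]: "g \<in> borel_measurable borel" unfolding g_def by measurable
  have g_ge: "dir_moment e s * ennreal (1 / s) * ennreal (1 / boundary_dist \<Omega> x powr s) \<le> 2 * g x" if x: "x \<in> \<Omega>" for x
  proof -
    obtain \<nu> where \<nu>: "norm \<nu> = 1" "\<And>y. (x - y) \<bullet> \<nu> \<ge> boundary_dist \<Omega> x \<Longrightarrow> y \<notin> \<Omega>"
      using convex_complement_contains_halfspace[OF \<Omega> x] by metis
    have d: "boundary_dist \<Omega> x > 0" using boundary_dist_pos[OF \<Omega>(1,3) x] .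
    have "dir_moment e s * ennreal (1 / s) * ennreal (1 / boundary_dist \<Omega> x powr s)
      = dir_moment e s * ennreal (boundary_dist \<Omega> x powr (- s) / s)"
      using \<open>0 < s\<close> by (simp add: mult.assoc ennreal_mult[symmetric] powr_minus_divide mult.commute[of s])
    also have rot: "dir_moment e s = dir_moment \<nu> s" using \<nu>(1) \<open>norm e = 1\<close> by (intro dir_moment_rotate) simp
    also have "dir_moment \<nu> s * ennreal (boundary_dist \<Omega> x powr (- s) / s)
      = 2 * (\<integral>\<^sup>+ z. kern s z * indicator {z. z \<bullet> \<nu> \<ge> boundary_dist \<Omega> x} z \<partial>lborel)"
      by (rule nn_integral_kern_halfspace[symmetric]) fact+
    also have "(\<integral>\<^sup>+ z. kern s z * indicator {z. z \<bullet> \<nu> \<ge> boundary_dist \<Omega> x} z \<partial>lborel)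
       \<le> (\<integral>\<^sup>+ z. kern s z * indicator (- \<Omega>) (x - z) \<partial>lborel)"
    proof (intro nn_integral_mono mult_left_mono)
      fix z
      show "indicator {z. z \<bullet> \<nu> \<ge> boundary_dist \<Omega> x} z \<le> (indicator (- \<Omega>) (x - z) :: ennreal)"
        using \<nu>(2)[of "x - z"] by (auto simp: indicator_def)
    qed simp
    also have "\<dots> = (\<integral>\<^sup>+ z. kern s (- z) * indicator (- \<Omega>) (x - - z) \<partial>lborel)"
      by (rule nn_integral_lborel_minus[symmetric]) measurable
    also have "\<dots> = (\<integral>\<^sup>+ z. kern s (x - (z + x)) * indicator (- \<Omega>) (z + x) \<partial>lborel)"
      by (simp add: add.commute)
    also have "\<dots> = g x"
      unfolding g_def by (rule nn_integral_lborel_translate) measurable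
    finally show ?thesis by (simp add: rot mult_left_mono)
  qed
  have "dir_moment e s * ennreal (1 / s) * hardy_integral s \<Omega> u
    = (\<integral>\<^sup>+ x. dir_moment e s * ennreal (1 / s) * (ennreal (\<bar>u x\<bar> / boundary_dist \<Omega> x powr s) * indicator \<Omega> x) \<partial>lborel)"
    unfolding hardy_integral_lborel by (rule nn_integral_cmult[symmetric]) measurable
  also have "\<dots> \<le> (\<integral>\<^sup>+ x. 2 * (ennreal \<bar>u x\<bar> * g x * indicator \<Omega> x) \<partial>lborel)"
  proof (intro nn_integral_mono)
    fix x
    have "ennreal (\<bar>u x\<bar> / boundary_dist \<Omega> x powr s) = ennreal \<bar>u x\<bar> * ennreal (1 / boundary_dist \<Omega> x powr s)"
      by (simp add: ennreal_mult[symmetric])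
    then show "dir_moment e s * ennreal (1 / s) * (ennreal (\<bar>u x\<bar> / boundary_dist \<Omega> x powr s) * indicator \<Omega> x)
      \<le> 2 * (ennreal \<bar>u x\<bar> * g x * indicator \<Omega> x)"
      using mult_left_mono[OF g_ge[of x], of "ennreal \<bar>u x\<bar>"] by (cases "x \<in> \<Omega>") (simp_all add: mult_ac)
  qed
  also have "\<dots> = (\<integral>\<^sup>+ x. ennreal \<bar>u x\<bar> * g x * indicator \<Omega> x \<partial>lborel) + (\<integral>\<^sup>+ x. ennreal \<bar>u x\<bar> * g x * indicator \<Omega> x \<partial>lborel)"
    by (subst nn_integral_cmult) (measurable, simp add: mult_2)
  also have "(\<integral>\<^sup>+ x. ennreal \<bar>u x\<bar> * g x * indicator \<Omega> x \<partial>lborel)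
    = (\<integral>\<^sup>+ x. (\<integral>\<^sup>+ y. ennreal \<bar>u x\<bar> * indicator \<Omega> x * (kern s (x - y) * indicator (- \<Omega>) y) \<partial>lborel) \<partial>lborel)"
    unfolding g_def by (simp add: nn_integral_cmult mult_ac)
  \<comment> \<open>One of the two copies is rewritten with the points exchanged. The pairs (inside,
    outside) and (outside, inside) are disjoint sets, and on both |u x - u y| is the absolute value
    of \<open>u\<close> at the inner point.\<close>
  also have "\<dots> + \<dots> = \<dots> + (\<integral>\<^sup>+ y. (\<integral>\<^sup>+ x. ennreal \<bar>u x\<bar> * indicator \<Omega> x * (kern s (x - y) * indicator (- \<Omega>) y) \<partial>lborel) \<partial>lborel)"
    by (rule arg_cong2[where f = "(+)", OF refl], rule lborel_pair.Fubini'[symmetric]) measurable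
  also have "\<dots> = (\<integral>\<^sup>+ x. (\<integral>\<^sup>+ y. ennreal \<bar>u x\<bar> * indicator \<Omega> x * (kern s (x - y) * indicator (- \<Omega>) y)
      + ennreal \<bar>u y\<bar> * indicator \<Omega> y * (kern s (y - x) * indicator (- \<Omega>) x) \<partial>lborel) \<partial>lborel)"
    by (subst nn_integral_add[symmetric]) (measurable, simp add: nn_integral_add)
  also have "\<dots> \<le> (\<integral>\<^sup>+ x. (\<integral>\<^sup>+ y. ennreal \<bar>u x - u y\<bar> * kern s (x - y) \<partial>lborel) \<partial>lborel)"
  proof (intro nn_integral_mono)
    fix x y :: "real ^ 'n"
    have "kern s (y - x) = kern s (x - y)" using kern_minus[of s "x - y"] by simp
    then show "ennreal \<bar>u x\<bar> * indicator \<Omega> x * (kern s (x - y) * indicator (- \<Omega>) y)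
      + ennreal \<bar>u y\<bar> * indicator \<Omega> y * (kern s (y - x) * indicator (- \<Omega>) x)
      \<le> ennreal \<bar>u x - u y\<bar> * kern s (x - y)"
      using u0[of x] u0[of y] by (cases "x \<in> \<Omega>"; cases "y \<in> \<Omega>") auto
  qed
  also have "\<dots> = gagliardo_seminorm s u" by (rule gagliardo_seminorm_lborel[symmetric])
  finally show ?thesis .
qed

section \<open>Half-spaces\<close>

lemma open_half_space: "open (half_space k)"
  unfolding half_space_def by (intro open_Collect_less continuous_intros)

lemma half_space_neq_UNIV: "half_space k \<noteq> UNIV"
proof
  assume "half_space k = UNIV"
  then have "0 \<in> half_space k" by simp
  then show False by (simp add: half_space_def)
qed

lemma boundary_dist_half_space:
  assumes "x \<in> half_space k"
  shows "boundary_dist (half_space k) x = x $ k"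
proof -
  have x: "x $ k > 0" using assms by (simp add: half_space_def)
  have "x - (x $ k) *\<^sub>R axis k 1 \<in> - half_space k"
    by (simp add: half_space_def axis_def)
  then have "infdist x (- half_space k) \<le> dist x (x - (x $ k) *\<^sub>R axis k 1)"
    by (rule infdist_le)
  also have "\<dots> = x $ k" using x by (simp add: dist_norm)
  finally have le: "infdist x (- half_space k) \<le> x $ k" .
  have "closed (- half_space k)" "- half_space k \<noteq> {}"
    using open_half_space[of k] half_space_neq_UNIV[of k] by auto
  then obtain y where y: "y \<in> - half_space k" "infdist x (- half_space k) = dist x y"
    using infdist_attains_inf by metis
  have "x $ k \<le> (x - y) $ k" using y(1) by (simp add: half_space_def)
  also have "\<dots> \<le> norm (x - y)" using component_le_norm_cart[of "x - y" k] by linarith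
  finally have "x $ k \<le> infdist x (- half_space k)" by (simp add: y(2) dist_norm)
  then show ?thesis using le boundary_dist_eq_infdist[OF open_half_space half_space_neq_UNIV assms] by simp
qed

text \<open>Let I be the mass of \<open>u\<close> in the slab and J its mass above. Where x $ k
  \<le> 0 the function vanishes, so the difference integral over that part is I after a shift. Over
  the rest, with difference integral D, the triangle inequality gives J + I \<le> J + D; J is finite
  and cancels, so D is at least I as well.\<close>

lemma translation_difference_half_space:
  fixes u :: "real ^ 'n \<Rightarrow> real"
  assumes u [measurable]: "u \<in> borel_measurable borel" and u0: "\<And>x. x $ k \<le> 0 \<Longrightarrow> u x = 0"
    and fin: "(\<integral>\<^sup>+ x. ennreal \<bar>u x\<bar> \<partial>lborel) < \<infinity>" and z: "z $ k > 0"
  shows "2 * (\<integral>\<^sup>+ x. ennreal \<bar>u x\<bar> * indicator {x. x $ k \<le> z $ k} x \<partial>lborel)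
    \<le> (\<integral>\<^sup>+ x. ennreal \<bar>u (x + z) - u x\<bar> \<partial>lborel)"
proof -
  have [measurable]: "(\<lambda>x. x $ k) \<in> borel_measurable borel"
    by (intro borel_measurable_continuous_onI continuous_intros)
  define v where "v = (\<lambda>x. ennreal \<bar>u x\<bar>)"
  have [measurable]: "v \<in> borel_measurable borel" unfolding v_def by measurable
  have v0: "x $ k \<le> 0 \<Longrightarrow> v x = 0" for x using u0 by (simp add: v_def)
  define I where "I = (\<integral>\<^sup>+ x. v x * indicator {x. x $ k \<le> z $ k} x \<partial>lborel)"
  define J where "J = (\<integral>\<^sup>+ x. v x * indicator {x. x $ k > z $ k} x \<partial>lborel)"
  have IJ: "(\<integral>\<^sup>+ x. v x \<partial>lborel) = J + I"
    unfolding I_def J_def by (subst nn_integral_add[symmetric]) (auto intro!: nn_integral_cong simp: indicator_def)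
  have J_fin: "J \<noteq> \<infinity>" using IJ fin by (auto simp: v_def)
  define D where "D = (\<lambda>x. ennreal \<bar>u (x + z) - u x\<bar>)"
  have [measurable]: "D \<in> borel_measurable borel" unfolding D_def by measurable
  have left: "(\<integral>\<^sup>+ x. D x * indicator {x. x $ k \<le> 0} x \<partial>lborel) = I"
  proof -
    have "(\<integral>\<^sup>+ x. D x * indicator {x. x $ k \<le> 0} x \<partial>lborel)
      = (\<integral>\<^sup>+ x. v (x + z) * indicator {x. x $ k \<le> z $ k} (x + z) \<partial>lborel)"
      using u0 by (intro nn_integral_cong) (auto simp: D_def v_def indicator_def)
    also have "\<dots> = I" unfolding I_def by (rule nn_integral_lborel_translate) measurable
    finally show ?thesis .
  qed
  have "J + I \<le> (\<integral>\<^sup>+ x. v (x + z) * indicator {x. x $ k > z $ k} (x + z) + D x * indicator {x. x $ k > 0} x \<partial>lborel)"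
    unfolding IJ[symmetric]
  proof (intro nn_integral_mono)
    fix x
    have "v x \<le> v (x + z) + D x"
      unfolding v_def D_def by (auto simp: ennreal_plus[symmetric] simp del: ennreal_plus intro!: ennreal_leI)
    then show "v x \<le> v (x + z) * indicator {x. x $ k > z $ k} (x + z) + D x * indicator {x. x $ k > 0} x"
      using v0[of x] by (cases "x $ k > 0") auto
  qed
  also have "\<dots> = (\<integral>\<^sup>+ x. v (x + z) * indicator {x. x $ k > z $ k} (x + z) \<partial>lborel) + (\<integral>\<^sup>+ x. D x * indicator {x. x $ k > 0} x \<partial>lborel)"
    by (rule nn_integral_add) measurable
  also have "(\<integral>\<^sup>+ x. v (x + z) * indicator {x. x $ k > z $ k} (x + z) \<partial>lborel) = J"
    unfolding J_def by (rule nn_integral_lborel_translate) measurable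
  finally have right: "I \<le> (\<integral>\<^sup>+ x. D x * indicator {x. x $ k > 0} x \<partial>lborel)"
    using J_fin by (simp add: ennreal_add_left_cancel_le)
  have "2 * I \<le> (\<integral>\<^sup>+ x. D x * indicator {x. x $ k \<le> 0} x \<partial>lborel) + (\<integral>\<^sup>+ x. D x * indicator {x. x $ k > 0} x \<partial>lborel)"
    unfolding left mult_2 using right by (rule add_left_mono)
  also have "\<dots> = (\<integral>\<^sup>+ x. D x \<partial>lborel)"
    by (subst nn_integral_add[symmetric]) (auto intro!: nn_integral_cong simp: indicator_def)
  finally show ?thesis by (simp add: I_def D_def v_def)
qed

text \<open>For fixed x in the half-space the kernel mass of {z. |z $ k| \<ge> x $ k} is a constant
  times the Hardy weight at x. The Hardy integral is therefore a kernel average over z of slab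
  masses, each at most half the translation difference.\<close>

lemma gagliardo_seminorm_ge_half_space:
  fixes u :: "real ^ 'n \<Rightarrow> real" and e :: "real ^ 'n"
  assumes u [measurable]: "u \<in> borel_measurable borel" and u0: "\<And>x. x \<notin> half_space k \<Longrightarrow> u x = 0"
    and fin: "(\<integral>\<^sup>+ x. ennreal \<bar>u x\<bar> \<partial>lborel) < \<infinity>" and "norm e = 1" "0 < s"
  shows "2 * dir_moment e s * ennreal (1 / s) * hardy_integral s (half_space k) u \<le> gagliardo_seminorm s u"
proof -
  have [measurable]: "(\<lambda>x. x $ k) \<in> borel_measurable borel"
    by (intro borel_measurable_continuous_onI continuous_intros)
  have [measurable]: "half_space k \<in> sets borel" by (rule borel_open[OF open_half_space])
  have u0': "x $ k \<le> 0 \<Longrightarrow> u x = 0" for x using u0[of x] by (simp add: half_space_def)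
  define P where "P = (\<lambda>z. \<integral>\<^sup>+ x. ennreal \<bar>u (x + z) - u x\<bar> \<partial>lborel)"
  have P_minus: "P (- z) = P z" for z
  proof -
    have "P (- z) = (\<integral>\<^sup>+ x. ennreal \<bar>u (x + z + - z) - u (x + z)\<bar> \<partial>lborel)"
      unfolding P_def by (rule nn_integral_lborel_translate[symmetric]) measurable
    then show ?thesis by (simp add: P_def abs_minus_commute)
  qed
  define Q where "Q = (\<lambda>z :: real ^ 'n. \<integral>\<^sup>+ x. ennreal \<bar>u x\<bar> * indicator {x. x $ k \<le> \<bar>z $ k\<bar>} x \<partial>lborel)"
  have PQ: "2 * Q z \<le> P z" for z
  proof -
    \<comment> \<open>The slab estimate covers displacements with positive component; evenness of
      \<open>P\<close> covers the negative ones, and for component zero the slab carries no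
      mass.\<close>
    consider "z $ k > 0" | "(- z) $ k > 0" | "z $ k = 0" by fastforce
    then show ?thesis
    proof cases
      case 1
      then show ?thesis using translation_difference_half_space[OF u u0' fin 1] by (simp add: P_def Q_def)
    next
      case 2
      then show ?thesis using translation_difference_half_space[OF u u0' fin 2] P_minus[of z] by (simp add: P_def Q_def)
    next
      case 3
      then have "Q z = 0" using u0' unfolding Q_def
        by (intro nn_integral_0_iff_AE[THEN iffD2]) (auto simp: indicator_def)
      then show ?thesis by simp
    qed
  qed
  have axis: "(z :: real ^ 'n) \<bullet> axis k 1 = z $ k" for z by (simp add: inner_axis)
  have "2 * dir_moment e s * ennreal (1 / s) * hardy_integral s (half_space k) u
    = (\<integral>\<^sup>+ x. 2 * dir_moment e s * ennreal (1 / s) * (ennreal (\<bar>u x\<bar> / boundary_dist (half_space k) x powr s) * indicator (half_space k) x) \<partial>lborel)"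
    unfolding hardy_integral_lborel by (rule nn_integral_cmult[symmetric]) measurable
  also have "\<dots> = (\<integral>\<^sup>+ x. (\<integral>\<^sup>+ z. 2 * kern s z * (ennreal \<bar>u x\<bar> * indicator {x. x $ k \<le> \<bar>z $ k\<bar>} x) \<partial>lborel) \<partial>lborel)"
  proof (rule nn_integral_cong)
    fix x
    show "2 * dir_moment e s * ennreal (1 / s) * (ennreal (\<bar>u x\<bar> / boundary_dist (half_space k) x powr s) * indicator (half_space k) x)
      = (\<integral>\<^sup>+ z. 2 * kern s z * (ennreal \<bar>u x\<bar> * indicator {x. x $ k \<le> \<bar>z $ k\<bar>} x) \<partial>lborel)"
    proof (cases "x \<in> half_space k")
      case True
      then have x: "x $ k > 0" by (simp add: half_space_def)
      have rot: "dir_moment (axis k 1 :: real ^ 'n) s = dir_moment e s"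
        using \<open>norm e = 1\<close> by (intro dir_moment_rotate) simp
      have "(\<integral>\<^sup>+ z. 2 * kern s z * (ennreal \<bar>u x\<bar> * indicator {x. x $ k \<le> \<bar>z $ k\<bar>} x) \<partial>lborel)
         = (\<integral>\<^sup>+ z. 2 * ennreal \<bar>u x\<bar> * (kern s z * indicator {z :: real ^ 'n. \<bar>z \<bullet> axis k 1\<bar> \<ge> x $ k} z) \<partial>lborel)"
        by (intro nn_integral_cong) (auto simp: axis indicator_def mult_ac)
      also have "\<dots> = 2 * ennreal \<bar>u x\<bar> * (dir_moment e s * ennreal ((x $ k) powr (- s) / s))"
        using nn_integral_kern_slab[OF \<open>0 < s\<close> x, of "axis k 1 :: real ^ 'n"] rot by (subst nn_integral_cmult) auto
      also have "\<dots> = 2 * dir_moment e s * (ennreal \<bar>u x\<bar> * ennreal ((x $ k) powr (- s) / s))"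
        by (simp add: mult_ac)
      also have "ennreal \<bar>u x\<bar> * ennreal ((x $ k) powr (- s) / s) = ennreal (1 / s) * ennreal (\<bar>u x\<bar> / (x $ k) powr s)"
        using \<open>0 < s\<close> by (simp add: ennreal_mult[symmetric] powr_minus_divide mult.commute[of s])
      finally show ?thesis using True by (simp add: boundary_dist_half_space mult_ac)
    qed (use u0 in simp)
  qed
  also have "\<dots> = (\<integral>\<^sup>+ z. (\<integral>\<^sup>+ x. 2 * kern s z * (ennreal \<bar>u x\<bar> * indicator {x. x $ k \<le> \<bar>z $ k\<bar>} x) \<partial>lborel) \<partial>lborel)"
    by (rule lborel_pair.Fubini') measurable
  also have "\<dots> = (\<integral>\<^sup>+ z. kern s z * (2 * Q z) \<partial>lborel)"
    unfolding Q_def by (intro nn_integral_cong) (subst nn_integral_cmult, auto simp: mult_ac)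
  also have "\<dots> \<le> (\<integral>\<^sup>+ z. kern s z * P z \<partial>lborel)"
    by (intro nn_integral_mono mult_left_mono PQ) auto
  also have "\<dots> = gagliardo_seminorm s u"
    unfolding P_def by (rule gagliardo_seminorm_translate[symmetric]) measurable
  finally show ?thesis .
qed

text \<open>Every point of the bounded set \<open>\<Omega>\<close> leaves it after finitely many steps \<open>- t e\<close>, so boundedly many
  (of order \<open>1 / t\<close>) translates of the layer cover \<open>\<Omega>\<close>.\<close>

lemma emeasure_boundary_layer_ge:
  fixes \<Omega> :: "'a::euclidean_space set"
  assumes \<Omega>: "open \<Omega>" "bounded \<Omega>" "\<Omega> \<noteq> {}"
  obtains c where "c > 0" "\<And>t. 0 < t \<Longrightarrow> t < 1 \<Longrightarrow> ennreal (c * t) \<le> emeasure lborel (inner_layer \<Omega> t)"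
proof -
  have [measurable]: "\<Omega> \<in> sets borel" using \<Omega> by auto
  obtain B where B: "B > 0" "\<And>x. x \<in> \<Omega> \<Longrightarrow> norm x \<le> B" using \<Omega>(2) bounded_pos by blast
  define V where "V = measure lborel \<Omega>"
  have fin: "emeasure lborel \<Omega> < \<infinity>" using \<Omega>(2) by (rule emeasure_bounded_finite)
  then have V: "emeasure lborel \<Omega> = ennreal V" unfolding V_def by (simp add: emeasure_eq_ennreal_measure)
  have "V > 0"
  proof -
    obtain x r where "r > 0" "ball x r \<subseteq> \<Omega>" using \<Omega>(1,3) open_contains_ball by blast
    then have "measure lborel (ball x r) \<le> V"
      unfolding V_def using fin by (intro measure_mono_fmeasurable) (auto simp: fmeasurable_def)
    then show ?thesis using content_ball_pos[OF \<open>r > 0\<close>, of x] by linarith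
  qed
  define e :: 'a where "e = (SOME b. b \<in> Basis)"
  have e: "norm e = 1" unfolding e_def by (rule norm_Basis[OF SOME_Basis])
  show thesis
  proof (rule that[of "V / (2 * B + 2)"])
    show "V / (2 * B + 2) > 0" using \<open>V > 0\<close> B(1) by simp
    fix t :: real assume t: "0 < t" "t < 1"
    \<comment> \<open>The points of \<Omega> that one step of length t takes outside; the exit point
      shows that their depth is at most t.\<close>
    define A where "A = {x \<in> \<Omega>. x - t *\<^sub>R e \<notin> \<Omega>}"
    have [measurable]: "A \<in> sets borel"
      unfolding A_def by measurable
    have "A \<subseteq> inner_layer \<Omega> t"
      unfolding A_def using t by (auto intro!: infdist_le2[of "x - t *\<^sub>R e" "- \<Omega>" x t for x] simp: dist_norm e)
    moreover have meas: "inner_layer \<Omega> t \<in> sets lborel"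
      by measurable
    ultimately have A_le: "emeasure lborel A \<le> emeasure lborel (inner_layer \<Omega> t)"
      by (rule emeasure_mono)
    \<comment> \<open>n steps of length t travel farther than 2 B and hence leave \<Omega>; rounding
      up and the extra step cost at most 2 t, which is below 2.\<close>
    define n where "n = Suc (nat \<lceil>2 * B / t\<rceil>)"
    have n: "2 * B < real n * t" "real n * t \<le> 2 * B + 2"
    proof -
      have "2 * B / t < real n" unfolding n_def by linarith
      then show "2 * B < real n * t" using t by (simp add: divide_less_eq)
      have "2 * B / t \<ge> 0" using B(1) t by simp
      then have "real n \<le> 2 * B / t + 2" unfolding n_def by linarith
      then have "real n * t \<le> (2 * B / t + 2) * t" using t by (intro mult_right_mono) auto
      also have "\<dots> \<le> 2 * B + 2" using t by (simp add: distrib_right)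
      finally show "real n * t \<le> 2 * B + 2" .
    qed
    have cover: "\<Omega> \<subseteq> (\<Union>j<n. {x. x - (real j * t) *\<^sub>R e \<in> A})"
    proof
      fix x assume x: "x \<in> \<Omega>"
      have "x - (real n * t) *\<^sub>R e \<notin> \<Omega>"
      proof
        assume "x - (real n * t) *\<^sub>R e \<in> \<Omega>"
        then have "norm (x - (real n * t) *\<^sub>R e) \<le> B" by (rule B(2))
        moreover have "norm ((real n * t) *\<^sub>R e) \<le> norm x + norm (x - (real n * t) *\<^sub>R e)"
          using norm_triangle_ineq4[of x "x - (real n * t) *\<^sub>R e"] by simp
        ultimately show False using B(2)[OF x] n(1) t e by simp
      qed
      \<comment> \<open>At the first index whose point lies outside \<Omega>, the point before it
        belongs to \<open>A\<close>; this index is not 0, since x itself is in \<Omega>.\<close>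
      define m where "m = (LEAST j. x - (real j * t) *\<^sub>R e \<notin> \<Omega>)"
      have m1: "x - (real m * t) *\<^sub>R e \<notin> \<Omega>" unfolding m_def by (rule LeastI) fact
      have "m \<le> n" unfolding m_def by (rule Least_le) fact
      have "m \<noteq> 0" using m1 x by (cases "m = 0") auto
      then obtain j where j: "m = Suc j" using not0_implies_Suc by blast
      have "x - (real j * t) *\<^sub>R e \<in> \<Omega>"
        using not_less_Least[of j "\<lambda>j. x - (real j * t) *\<^sub>R e \<notin> \<Omega>"] j by (auto simp: m_def)
      moreover have "x - (real j * t) *\<^sub>R e - t *\<^sub>R e \<notin> \<Omega>"
        using m1 by (simp add: j algebra_simps)
      ultimately show "x \<in> (\<Union>j<n. {x. x - (real j * t) *\<^sub>R e \<in> A})"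
        using \<open>m \<le> n\<close> j by (auto simp: A_def)
    qed
    have transl: "emeasure lborel {x. x - v \<in> A} = emeasure lborel A" for v
    proof -
      have "emeasure lborel {x. x - v \<in> A} = (\<integral>\<^sup>+ x. indicator {x. x - v \<in> A} x \<partial>lborel)"
        by (rule nn_integral_indicator[symmetric]) measurable
      also have "\<dots> = (\<integral>\<^sup>+ x. indicator A (x + - v) \<partial>lborel)"
        by (intro nn_integral_cong) (simp add: indicator_def)
      also have "\<dots> = emeasure lborel A"
        by (subst nn_integral_lborel_translate) auto
      finally show ?thesis .
    qed
    have "ennreal V \<le> emeasure lborel (\<Union>j<n. {x. x - (real j * t) *\<^sub>R e \<in> A})"
      unfolding V[symmetric] using cover by (intro emeasure_mono) measurable
    also have "\<dots> \<le> (\<Sum>j<n. emeasure lborel {x. x - (real j * t) *\<^sub>R e \<in> A})"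
      by (rule emeasure_subadditive_finite) auto
    also have "\<dots> = ennreal (real n) * emeasure lborel A" by (simp add: transl ennreal_of_nat_eq_real_of_nat)
    finally have V_le: "ennreal V \<le> ennreal (real n) * emeasure lborel A" .
    have "V / (2 * B + 2) * t \<le> V / real n"
    proof -
      have "real n > 0" by (simp add: n_def)
      then have "t \<le> (2 * B + 2) / real n" using n(2) by (simp add: pos_le_divide_eq mult.commute)
      then have "V / (2 * B + 2) * t \<le> V / (2 * B + 2) * ((2 * B + 2) / real n)"
        using \<open>V > 0\<close> B(1) by (intro mult_left_mono) auto
      then show ?thesis using B(1) by simp
    qed
    then have "ennreal (V / (2 * B + 2) * t) \<le> ennreal (1 / real n) * ennreal V"
      by (subst ennreal_mult[symmetric]) (auto intro: ennreal_leI simp: \<open>V > 0\<close> less_imp_le)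
    also have "\<dots> \<le> ennreal (1 / real n) * (ennreal (real n) * emeasure lborel A)"
      using V_le by (rule mult_left_mono) simp
    also have "\<dots> = emeasure lborel A"
    proof -
      have "real n > 0" by (simp add: n_def)
      then have "ennreal (1 / real n) * ennreal (real n) = 1" by (simp add: ennreal_mult[symmetric])
      then show ?thesis by (simp add: mult.assoc[symmetric])
    qed
    finally show "ennreal (V / (2 * B + 2) * t) \<le> emeasure lborel (inner_layer \<Omega> t)"
      using A_le by (rule order_trans)
  qed
qed

text \<open>By convexity, the layer lies outside a copy of \<open>\<Omega>\<close> contracted by a factor \<open>1 - O(t)\<close>.\<close>

lemma emeasure_boundary_layer_le:
  fixes \<Omega> :: "'a::euclidean_space set"
  assumes \<Omega>: "open \<Omega>" "bounded \<Omega>" "\<Omega> \<noteq> {}" "convex \<Omega>"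
  obtains c t0 where "t0 > 0" "c > 0" "\<And>t. 0 < t \<Longrightarrow> t < t0 \<Longrightarrow> emeasure lborel (inner_layer \<Omega> t) \<le> ennreal (c * t)"
proof -
  have [measurable]: "\<Omega> \<in> sets borel" using \<Omega> by auto
  obtain x0 \<rho> where \<rho>: "\<rho> > 0" "ball x0 \<rho> \<subseteq> \<Omega>" using \<Omega>(1,3) open_contains_ball by blast
  define V where "V = measure lborel \<Omega>"
  have "emeasure lborel \<Omega> < \<infinity>" using \<Omega>(2) by (rule emeasure_bounded_finite)
  then have V: "emeasure lborel \<Omega> = ennreal V" unfolding V_def by (simp add: emeasure_eq_ennreal_measure)
  have "V \<ge> 0" by (simp add: V_def)
  have ne: "- \<Omega> \<noteq> {}"
  proof
    assume "- \<Omega> = {}"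
    then have "\<Omega> = UNIV" by auto
    then show False using \<Omega>(2) by simp
  qed
  show thesis
  \<comment> \<open>\<open>V + 1\<close> in place of \<open>V\<close> makes positivity of the
    constant immediate.\<close>
  proof (rule that[of "\<rho> / 2" "(V + 1) * real DIM('a) * (2 / \<rho>)"])
    show "(V + 1) * real DIM('a) * (2 / \<rho>) > 0" using \<open>V \<ge> 0\<close> \<rho>(1) by (intro mult_pos_pos) auto
    fix t assume t: "0 < t" "t < \<rho> / 2"
    \<comment> \<open>About an image point T x the contracted copy of the ball of radius \<rho> has
      radius (1 - \<mu>) \<rho> = 2 t, which leaves room for a depth strictly above t.\<close>
    define \<mu> where "\<mu> = 1 - 2 * t / \<rho>"
    have \<mu>: "0 < \<mu>" "\<mu> < 1" using t \<rho>(1) by (auto simp: \<mu>_def divide_less_eq)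
    define T where "T = (\<lambda>x. \<mu> *\<^sub>R x + (1 - \<mu>) *\<^sub>R x0)"
    define S where "S = {y. (1 / \<mu>) *\<^sub>R (y - (1 - \<mu>) *\<^sub>R x0) \<in> \<Omega>}"
    have T_S: "T x \<in> S \<longleftrightarrow> x \<in> \<Omega>" for x using \<mu> by (simp add: S_def T_def)
    have T_inv: "T ((1 / \<mu>) *\<^sub>R (y - (1 - \<mu>) *\<^sub>R x0)) = y" for y using \<mu> by (simp add: T_def)
    have [measurable]: "S \<in> sets borel" unfolding S_def by measurable
    have emS: "emeasure lborel S = ennreal (\<mu> ^ DIM('a)) * emeasure lborel \<Omega>"
    proof -
      have "emeasure lborel S = (\<integral>\<^sup>+ y. indicator S y \<partial>lborel)" by simp
      also have "\<dots> = (\<integral>\<^sup>+ y. indicator S (y + (1 - \<mu>) *\<^sub>R x0) \<partial>lborel)"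
        by (rule nn_integral_lborel_translate[symmetric]) measurable
      also have "\<dots> = ennreal (\<bar>\<mu>\<bar> ^ DIM('a)) * (\<integral>\<^sup>+ x. indicator S (\<mu> *\<^sub>R x + (1 - \<mu>) *\<^sub>R x0) \<partial>lborel)"
      proof (rule nn_integral_lborel_scale)
        show "(\<lambda>y. indicator S (y + (1 - \<mu>) *\<^sub>R x0)) \<in> borel_measurable borel" by measurable
      qed (use \<mu> in simp)
      also have "(\<integral>\<^sup>+ x. indicator S (\<mu> *\<^sub>R x + (1 - \<mu>) *\<^sub>R x0) \<partial>lborel) = (\<integral>\<^sup>+ x. indicator \<Omega> x \<partial>lborel)"
        using T_S by (intro nn_integral_cong) (simp add: T_def indicator_def)
      finally show ?thesis using \<mu> by simp
    qed
    have deep: "y \<in> \<Omega> \<and> infdist y (- \<Omega>) > t" if "y \<in> S" for y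
    proof -
      define x where "x = (1 / \<mu>) *\<^sub>R (y - (1 - \<mu>) *\<^sub>R x0)"
      have x: "x \<in> \<Omega>" "y = T x" using that T_inv[of y] by (simp_all add: S_def x_def)
      have ball: "ball y (2 * t) \<subseteq> \<Omega>"
      proof
        fix w assume "w \<in> ball y (2 * t)"
        then have w: "norm (w - y) < 2 * t" by (simp add: dist_norm norm_minus_commute)
        \<comment> \<open>Solved from w = \<mu> x + (1 - \<mu>) b. The point b lies in the ball
          about x0, so convexity puts w into \<Omega>.\<close>
        define b where "b = x0 + (1 / (1 - \<mu>)) *\<^sub>R (w - y)"
        have eq: "1 - \<mu> = 2 * t / \<rho>" by (simp add: \<mu>_def)
        have "norm (b - x0) = norm (w - y) / (1 - \<mu>)" using \<mu> by (simp add: b_def)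
        also have "\<dots> < \<rho>" using w t \<rho>(1) unfolding eq by (simp add: divide_less_eq)
        finally have "b \<in> \<Omega>" using \<rho>(2) by (auto simp: dist_norm norm_minus_commute)
        then have "\<mu> *\<^sub>R x + (1 - \<mu>) *\<^sub>R b \<in> \<Omega>"
          using \<Omega>(4) x(1) \<mu> by (intro convexD) auto
        moreover have "\<mu> *\<^sub>R x + (1 - \<mu>) *\<^sub>R b = w"
          using \<mu> by (simp add: b_def x(2) T_def scaleR_add_right)
        ultimately show "w \<in> \<Omega>" by simp
      qed
      have "closed (- \<Omega>)" using \<Omega>(1) by auto
      then obtain p where p: "p \<in> - \<Omega>" "infdist y (- \<Omega>) = dist y p"
        using infdist_attains_inf ne by metis
      have "\<not> dist y p < 2 * t" using p(1) ball by auto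
      then have "infdist y (- \<Omega>) > t" using p(2) t by linarith
      moreover have "y \<in> \<Omega>" using ball t by auto
      ultimately show ?thesis by simp
    qed
    have "emeasure lborel (inner_layer \<Omega> t) \<le> emeasure lborel (\<Omega> - S)"
      using deep by (intro emeasure_mono) (auto, force)
    also have "\<dots> = emeasure lborel \<Omega> - emeasure lborel S"
      using emS V deep by (intro emeasure_Diff) (auto simp: ennreal_mult_eq_top_iff)
    also have "\<dots> = ennreal (V - \<mu> ^ DIM('a) * V)"
      unfolding emS V using \<mu> \<open>V \<ge> 0\<close> by (simp add: ennreal_mult[symmetric] ennreal_minus)
    also have "\<dots> \<le> ennreal ((V + 1) * real DIM('a) * (2 / \<rho>) * t)"
    proof (rule ennreal_leI)
      have "1 + real DIM('a) * (- (2 * t / \<rho>)) \<le> (1 + (- (2 * t / \<rho>))) ^ DIM('a)"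
        using t \<rho>(1) by (intro Bernoulli_inequality) (simp add: divide_le_eq)
      then have "1 - \<mu> ^ DIM('a) \<le> real DIM('a) * (2 * t / \<rho>)" by (simp add: \<mu>_def)
      then have "V * (1 - \<mu> ^ DIM('a)) \<le> (V + 1) * (real DIM('a) * (2 * t / \<rho>))"
        using \<open>V \<ge> 0\<close> t \<rho>(1) \<mu> by (intro mult_mono) (auto simp: power_le_one)
      then show "V - \<mu> ^ DIM('a) * V \<le> (V + 1) * real DIM('a) * (2 / \<rho>) * t"
        by (simp add: algebra_simps add_divide_distrib)
    qed
    finally show "emeasure lborel (inner_layer \<Omega> t) \<le> ennreal ((V + 1) * real DIM('a) * (2 / \<rho>) * t)" .
  qed (use \<rho> in auto)
qed

section \<open>The limit as s tends to one\<close>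

text \<open>The set \<open>E\<close> plays the role of an almost extremal set: \<open>M\<close> bounds its perimeter from above,
  and \<open>m\<close> bounds the part of its perimeter that lies on the boundary of \<open>\<Omega>\<close> from below.\<close>

definition test_domain :: "'a::euclidean_space set \<Rightarrow> 'a set \<Rightarrow> real \<Rightarrow> real \<Rightarrow> real \<Rightarrow> bool" where
  "test_domain \<Omega> E M m t0 \<longleftrightarrow> open E \<and> bounded E \<and> E \<subseteq> \<Omega> \<and> 0 \<le> M \<and> 0 < m \<and> 0 < t0 \<and>
     (\<forall>\<rho>>0. \<exists>r. 0 < r \<and> r < \<rho> \<and> emeasure lborel (inner_layer E r) \<le> ennreal (M * r)) \<and>
     (\<forall>t. 0 < t \<longrightarrow> t < t0 \<longrightarrow> ennreal (m * t) \<le> emeasure lborel {x \<in> E. boundary_dist \<Omega> x \<le> t})"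

text \<open>The seminorm bound divided by the Hardy bound for one test set, with all constants real.
  It serves for s tending to one and, in dimension one, at fixed s, where good choices of E and R
  make it exact.\<close>

lemma hardy_constant_le_real:
  fixes E \<Omega> :: "(real ^ 'n) set" and e :: "real ^ 'n"
  assumes test: "test_domain \<Omega> E M m t0" and \<Omega>: "open \<Omega>" "\<Omega> \<noteq> UNIV"
    and s: "0 < s" "s < 1" and e: "norm e = 1" and R: "0 < R"
    and \<kappa>: "dir_moment e 1 = ennreal \<kappa>" "0 \<le> \<kappa>" and \<sigma>: "shell_mass TYPE(real ^ 'n) = ennreal \<sigma>" "0 \<le> \<sigma>"
    and V: "emeasure lborel E = ennreal V" "0 \<le> V"
  shows "hardy_constant s \<Omega>
    \<le> ennreal ((\<kappa> * (M * R powr (1 - s) / (1 - s)) + \<sigma> * (2 * R powr (- s) / s) * V) / (m * t0 powr (1 - s) / (1 - s)))"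
proof -
  have E: "open E" "bounded E" "E \<subseteq> \<Omega>" and pos: "0 < R" "0 \<le> M" "0 < m" "0 < t0"
    using test R by (simp_all add: test_domain_def)
  have layer: "\<exists>r. 0 < r \<and> r < \<rho> \<and> emeasure lborel (inner_layer E r) \<le> ennreal (M * r)" if "\<rho> > 0" for \<rho>
    using test that by (simp add: test_domain_def)
  have layer': "ennreal (m * t) \<le> emeasure lborel {x \<in> E. boundary_dist \<Omega> x \<le> t}" if "0 < t" "t < t0" for t
    using test that by (simp add: test_domain_def)
  define j where "j = m * t0 powr (1 - s) / (1 - s)"
  define a where "a = \<kappa> * (M * R powr (1 - s) / (1 - s)) + \<sigma> * (2 * R powr (- s) / s) * V"
  have j: "j > 0" using pos s by (simp add: j_def)
  have "ennreal j \<le> (\<integral>\<^sup>+ x\<in>E. ennreal (1 / boundary_dist \<Omega> x powr s) \<partial>lborel)"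
    unfolding j_def
  proof (rule nn_integral_layer_ge)
    show "E \<in> sets borel" using E(1) by auto
    show "boundary_dist \<Omega> x > 0" if "x \<in> E" for x
      using boundary_dist_pos[OF \<Omega>] that E(3) by auto
  qed (use layer' pos s in auto)
  then have "hardy_constant s \<Omega> * ennreal j
    \<le> hardy_constant s \<Omega> * (\<integral>\<^sup>+ x\<in>E. ennreal (1 / boundary_dist \<Omega> x powr s) \<partial>lborel)"
    by (rule mult_left_mono) simp
  also have "\<dots> \<le> dir_moment e 1 * ennreal (M * R powr (1 - s) / (1 - s))
      + shell_mass TYPE(real ^ 'n) * ennreal (2 * R powr (- s) / s) * emeasure lborel E"
    by (rule hardy_constant_upper) fact+
  also have "\<dots> = ennreal a"
    unfolding \<kappa>(1) \<sigma>(1) V(1) a_def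
    using s pos \<kappa>(2) \<sigma>(2) V(2) by (simp add: ennreal_mult[symmetric] ennreal_plus[symmetric] del: ennreal_plus)
  finally have le: "hardy_constant s \<Omega> * ennreal j \<le> ennreal a" .
  have "hardy_constant s \<Omega> = hardy_constant s \<Omega> * (ennreal j * ennreal (1 / j))"
    using j by (simp add: ennreal_mult[symmetric])
  also have "\<dots> = hardy_constant s \<Omega> * ennreal j * ennreal (1 / j)" by (simp only: mult.assoc)
  also have "\<dots> \<le> ennreal a * ennreal (1 / j)" using le by (rule mult_right_mono) simp
  also have "\<dots> = ennreal (a / j)"
    using j s pos \<kappa>(2) \<sigma>(2) V(2) by (subst ennreal_mult[symmetric]) (auto simp: a_def)
  finally show ?thesis by (simp add: a_def j_def)
qed

text \<open>After numerator and denominator are multiplied by 1 - s, the far interactions and the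
  volume of E carry a factor 1 - s and vanish in the limit. What survives is K M / m, at most \<eta>
  c K.\<close>

lemma hardy_constant_tendsto:
  fixes \<Omega> :: "(real ^ 'n) set" and e :: "real ^ 'n"
  assumes \<Omega>: "open \<Omega>" "\<Omega> \<noteq> UNIV" and e: "norm e = 1" and "c > 0"
    and lower: "\<And>s. 0 < s \<Longrightarrow> s < 1 \<Longrightarrow> dir_moment e 1 * ennreal c \<le> hardy_constant s \<Omega>"
    and approx: "\<And>\<eta>. \<eta> > 1 \<Longrightarrow> \<exists>E M m t0. test_domain \<Omega> E M m t0 \<and> M \<le> \<eta> * c * m"
  shows "((\<lambda>s. hardy_constant s \<Omega>) \<longlongrightarrow> dir_moment e 1 * ennreal c) (at_left 1)"
proof (rule order_tendstoI)
  have ev: "\<forall>\<^sub>F s in at_left 1. s \<in> {0<..<1::real}" by (rule eventually_at_left_real) simp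
  fix a assume a: "a < dir_moment e 1 * ennreal c"
  from ev show "\<forall>\<^sub>F s in at_left 1. a < hardy_constant s \<Omega>"
  proof eventually_elim
    case (elim s)
    then show ?case using less_le_trans[OF a lower[of s]] by simp
  qed
next
  have ev: "\<forall>\<^sub>F s in at_left 1. s \<in> {0<..<1::real}" by (rule eventually_at_left_real) simp
  fix a assume a: "dir_moment e 1 * ennreal c < a"
  obtain \<kappa> where \<kappa>: "dir_moment e 1 = ennreal \<kappa>" "\<kappa> > 0"
    using dir_moment_finite[OF e] dir_moment_pos[OF e] by (cases "dir_moment e 1") auto
  obtain \<sigma> where \<sigma>: "shell_mass TYPE(real ^ 'n) = ennreal \<sigma>" "\<sigma> \<ge> 0"
    using shell_mass_finite[where 'a="real ^ 'n"] by (cases "shell_mass TYPE(real ^ 'n)") auto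
  obtain b' where b': "dir_moment e 1 * ennreal c < b'" "b' < a" using dense[OF a] by blast
  then obtain b where b: "b' = ennreal b" "b \<ge> 0" by (cases b') auto
  have "\<kappa> * c < b"
    using b'(1) \<kappa>(2) \<open>c > 0\<close> b(2) unfolding \<kappa>(1) b(1) by (simp add: ennreal_mult[symmetric] ennreal_less_iff)
  have kc: "\<kappa> * c > 0" using \<kappa>(2) \<open>c > 0\<close> by simp
  then have "1 < b / (\<kappa> * c)" using \<open>\<kappa> * c < b\<close> by (simp add: less_divide_eq)
  \<comment> \<open>\<eta> is taken so close to one that \<kappa> \<eta> c still lies below
    b.\<close>
  then obtain \<eta> where \<eta>: "\<eta> > 1" "\<eta> < b / (\<kappa> * c)" using dense by blast
  then have \<eta>b: "\<kappa> * (\<eta> * c) < b" using kc by (simp add: less_divide_eq mult_ac)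
  obtain E M m t0 where test: "test_domain \<Omega> E M m t0" and M\<eta>: "M \<le> \<eta> * c * m"
    using approx[OF \<eta>(1)] by blast
  then have E: "open E" "bounded E" "E \<subseteq> \<Omega>" and M: "0 \<le> M" "0 < m" "0 < t0" "M \<le> \<eta> * c * m"
    by (simp_all add: test_domain_def)
  have "emeasure lborel E < \<infinity>" using E(2) by (rule emeasure_bounded_finite)
  then obtain V where V: "emeasure lborel E = ennreal V" "0 \<le> V" by (cases "emeasure lborel E") auto
  define f where "f = (\<lambda>s. (\<kappa> * M + \<sigma> * (2 / s) * V * (1 - s)) / (m * t0 powr (1 - s)))"
  have le_f: "hardy_constant s \<Omega> \<le> ennreal (f s)" if s: "0 < s" "s < 1" for s
  proof -
    have "hardy_constant s \<Omega>
      \<le> ennreal ((\<kappa> * (M * 1 powr (1 - s) / (1 - s)) + \<sigma> * (2 * 1 powr (- s) / s) * V) / (m * t0 powr (1 - s) / (1 - s)))"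
      by (rule hardy_constant_le_real[OF test \<Omega> s e _ \<kappa>(1) _ \<sigma> V]) (use \<kappa>(2) in simp_all)
    also have "(\<kappa> * (M * 1 powr (1 - s) / (1 - s)) + \<sigma> * (2 * 1 powr (- s) / s) * V) / (m * t0 powr (1 - s) / (1 - s)) = f s"
    proof -
      have "\<kappa> * (M * 1 powr (1 - s) / (1 - s)) + \<sigma> * (2 * 1 powr (- s) / s) * V
        = (\<kappa> * M + \<sigma> * (2 / s) * V * (1 - s)) / (1 - s)"
        using s by (simp add: add_divide_distrib)
      then show ?thesis using s by (simp add: f_def)
    qed
    finally show ?thesis .
  qed
  have "(f \<longlongrightarrow> (\<kappa> * M + \<sigma> * (2 / 1) * V * (1 - 1)) / (m * t0 powr (1 - 1))) (at_left 1)"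
    unfolding f_def using M by (intro tendsto_intros) auto
  then have lim: "(f \<longlongrightarrow> \<kappa> * M / m) (at_left 1)" using M by simp
  have "\<kappa> * M / m \<le> \<kappa> * (\<eta> * c * m) / m"
    using M \<kappa>(2) by (intro divide_right_mono mult_left_mono) auto
  also have "\<dots> < b" using \<eta>b M by simp
  finally have "\<forall>\<^sub>F s in at_left 1. f s < b" using lim by (intro order_tendstoD)
  from this ev show "\<forall>\<^sub>F s in at_left 1. hardy_constant s \<Omega> < a"
  proof eventually_elim
    case (elim s)
    then have "hardy_constant s \<Omega> \<le> ennreal b"
      using le_f[of s] by (auto intro: order_trans ennreal_leI less_imp_le)
    then show ?case using b'(2) b(1) by (auto intro: le_less_trans)
  qed
qed

lemma hardy_constant_ge_convex:
  fixes \<Omega> :: "(real ^ 'n) set" and e :: "real ^ 'n"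
  assumes \<Omega>: "open \<Omega>" "convex \<Omega>" "\<Omega> \<noteq> UNIV" and "norm e = 1" "0 < s"
  shows "dir_moment e s * ennreal (1 / s) \<le> hardy_constant s \<Omega>"
proof (rule hardy_constant_ge)
  fix u assume u: "u \<in> test_functions \<Omega>"
  show "dir_moment e s * ennreal (1 / s) * hardy_integral s \<Omega> u \<le> gagliardo_seminorm s u"
    using assms test_functions_measurable[OF u] test_functions_outside[OF u]
    by (intro gagliardo_seminorm_ge_convex) auto
qed

lemma hardy_constant_ge_half_space:
  fixes e :: "real ^ 'n" and k :: 'n
  assumes "norm e = 1" "0 < s"
  shows "2 * dir_moment e s * ennreal (1 / s) \<le> hardy_constant s (half_space k)"
proof (rule hardy_constant_ge)
  fix u assume u: "u \<in> test_functions (half_space k)"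
  show "2 * dir_moment e s * ennreal (1 / s) * hardy_integral s (half_space k) u \<le> gagliardo_seminorm s u"
    using assms test_functions_measurable[OF u] test_functions_outside[OF u] test_functions_integral_finite[OF u]
    by (intro gagliardo_seminorm_ge_half_space) auto
qed

lemma hardy_constant_tendsto_convex:
  fixes \<Omega> :: "(real ^ 'n) set" and e :: "real ^ 'n"
  assumes \<Omega>: "open \<Omega>" "bounded \<Omega>" "convex \<Omega>" "\<Omega> \<noteq> {}" and e: "norm e = 1"
  shows "((\<lambda>s. hardy_constant s \<Omega>) \<longlongrightarrow> dir_moment e 1 * ennreal 1) (at_left 1)"
proof (rule hardy_constant_tendsto)
  show neq: "\<Omega> \<noteq> UNIV" using \<Omega>(2) by auto
  show "dir_moment e 1 * ennreal 1 \<le> hardy_constant s \<Omega>" if s: "0 < s" "s < 1" for s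
  proof -
    have "dir_moment e 1 * ennreal 1 \<le> dir_moment e s * ennreal (1 / s)"
      using s dir_moment_1_le[OF e] by (intro mult_mono ennreal_leI) auto
    also have "\<dots> \<le> hardy_constant s \<Omega>" by (rule hardy_constant_ge_convex) fact+
    finally show ?thesis .
  qed
  fix \<eta> :: real assume "\<eta> > 1"
  let ?A = "\<lambda>t. emeasure lborel (inner_layer \<Omega> t)"
  \<comment> \<open>The linear rates that bound the layers from below for all small t. Their
    supremum is the lower limit of the layer measure divided by t; the two boundary layer estimates
    make it positive and finite.\<close>
  define S where "S = {m. \<exists>\<tau>>0. \<forall>t. 0 < t \<longrightarrow> t < \<tau> \<longrightarrow> ennreal (m * t) \<le> ?A t}"
  obtain c' where c': "c' > 0" "\<And>t. 0 < t \<Longrightarrow> t < 1 \<Longrightarrow> ennreal (c' * t) \<le> ?A t"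
    by (rule emeasure_boundary_layer_ge[OF \<Omega>(1,2,4)], rule that)
  obtain c t0 where c: "t0 > 0" "c > 0" "\<And>t. 0 < t \<Longrightarrow> t < t0 \<Longrightarrow> ?A t \<le> ennreal (c * t)"
    by (rule emeasure_boundary_layer_le[OF \<Omega>(1,2,4,3)], rule that)
  have "c' \<in> S" unfolding S_def mem_Collect_eq by (rule exI[of _ 1]) (use c'(2) in simp)
  have "m \<le> c" if "m \<in> S" for m
  proof -
    from that[unfolded S_def mem_Collect_eq]
    obtain \<tau> where "\<tau> > 0 \<and> (\<forall>t. 0 < t \<longrightarrow> t < \<tau> \<longrightarrow> ennreal (m * t) \<le> ?A t)" by (rule exE)
    then have \<tau>: "\<tau> > 0" "\<And>t. 0 < t \<Longrightarrow> t < \<tau> \<Longrightarrow> ennreal (m * t) \<le> ?A t" by simp_all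
    define t where "t = min \<tau> t0 / 2"
    have t: "0 < t" "t < \<tau>" "t < t0" using \<tau>(1) c(1) by (auto simp: t_def)
    then have "ennreal (m * t) \<le> ennreal (c * t)" by (intro order_trans[OF \<tau>(2) c(3)])
    then have "m * t \<le> c * t" using c(2) t(1) by (simp add: ennreal_le_iff)
    then show ?thesis using t(1) by simp
  qed
  then have bdd: "bdd_above S" by (rule bdd_aboveI)
  define L where "L = Sup S"
  have L: "L > 0" using cSup_upper[OF \<open>c' \<in> S\<close> bdd] c'(1) by (simp add: L_def)
  \<comment> \<open>Two losses occur, from L down to m and from L up to L \<theta>; with \<theta>
    \<theta> = \<eta> their product is the permitted one.\<close>
  define \<theta> where "\<theta> = sqrt \<eta>"
  have \<theta>: "\<theta> > 1" "\<theta> * \<theta> = \<eta>" using \<open>\<eta> > 1\<close> by (auto simp: \<theta>_def)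
  have "L / \<theta> < L" using \<theta>(1) L by (simp add: divide_less_eq)
  then obtain m where m: "m \<in> S" "L / \<theta> < m"
    using less_cSup_iff[of S "L / \<theta>"] bdd \<open>c' \<in> S\<close> unfolding L_def by blast
  have "0 < L / \<theta>" using L \<theta>(1) by simp
  then have "m > 0" using m(2) by linarith
  have "L < L * \<theta>" using \<theta>(1) L by simp
  \<comment> \<open>Because L \<theta> exceeds the supremum, its inequality fails at arbitrarily
    small t, and these t are the widths for the cutoffs.\<close>
  then have "L * \<theta> \<notin> S" using cSup_upper[OF _ bdd, of "L * \<theta>"] unfolding L_def by linarith
  then have notS: "\<exists>t. 0 < t \<and> t < \<rho> \<and> ?A t \<le> ennreal (L * \<theta> * t)" if "\<rho> > 0" for \<rho>
  proof -
    have "\<not> (\<exists>\<tau>>0. \<forall>t. 0 < t \<longrightarrow> t < \<tau> \<longrightarrow> ennreal (L * \<theta> * t) \<le> ?A t)"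
      using \<open>L * \<theta> \<notin> S\<close> by (simp only: S_def mem_Collect_eq not_False_eq_True)
    then have "\<not> (\<forall>t. 0 < t \<longrightarrow> t < \<rho> \<longrightarrow> ennreal (L * \<theta> * t) \<le> ?A t)"
      using that by simp
    then obtain t where "0 < t" "t < \<rho>" "\<not> ennreal (L * \<theta> * t) \<le> ?A t"
      by (simp only: not_all not_imp) (elim exE conjE, rule that)
    then show ?thesis by (intro exI[of _ t]) (simp add: not_le less_imp_le)
  qed
  from m(1)[unfolded S_def mem_Collect_eq]
  obtain \<tau> where "\<tau> > 0 \<and> (\<forall>t. 0 < t \<longrightarrow> t < \<tau> \<longrightarrow> ennreal (m * t) \<le> ?A t)" by (rule exE)
  then have \<tau>: "\<tau> > 0" "\<And>t. 0 < t \<Longrightarrow> t < \<tau> \<Longrightarrow> ennreal (m * t) \<le> ?A t" by simp_all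
  have M_le: "L * \<theta> \<le> \<eta> * 1 * m"
  proof -
    have "L \<le> m * \<theta>" using m(2) \<theta>(1) by (simp add: divide_less_eq)
    then have "L * \<theta> \<le> m * \<theta> * \<theta>" using \<theta>(1) by (intro mult_right_mono) auto
    also have "\<dots> = m * (\<theta> * \<theta>)" by (simp only: mult.assoc)
    finally show ?thesis by (simp add: \<theta>(2) mult.commute)
  qed
  have eq: "{x \<in> \<Omega>. boundary_dist \<Omega> x \<le> t} = inner_layer \<Omega> t" for t
    using boundary_dist_eq_infdist[OF \<Omega>(1) neq] by auto
  have "ennreal (m * t) \<le> emeasure lborel {x \<in> \<Omega>. boundary_dist \<Omega> x \<le> t}" if "0 < t" "t < \<tau>" for t
    using \<tau>(2)[OF that] unfolding eq .
  moreover have "0 \<le> L * \<theta>" using L \<theta>(1) by simp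
  ultimately have "test_domain \<Omega> \<Omega> (L * \<theta>) m \<tau>"
    using \<Omega>(1,2) \<open>m > 0\<close> \<tau>(1) notS by (simp add: test_domain_def)
  then show "\<exists>E M m t0. test_domain \<Omega> E M m t0 \<and> M \<le> \<eta> * 1 * m"
    using M_le by blast
qed (use \<Omega> e in auto)

section \<open>Flat boxes in the half-space\<close>

lemma emeasure_lborel_box_cart:
  fixes a b :: "real ^ 'n"
  assumes "\<And>i. a $ i \<le> b $ i"
  shows "emeasure lborel (box a b) = ennreal (\<Prod>i\<in>UNIV. b $ i - a $ i)"
proof -
  have le: "\<forall>i\<in>Basis. a \<bullet> i \<le> b \<bullet> i"
    using assms by (auto simp: Basis_vec_def inner_axis)
  then have "emeasure lborel (box a b) = emeasure lborel (cbox a b)"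
    by (simp add: emeasure_lborel_box_eq emeasure_lborel_cbox_eq)
  also have "\<dots> = ennreal (measure lborel (cbox a b))"
    using emeasure_lborel_cbox_finite[of a b] by (intro emeasure_eq_ennreal_measure) auto
  also have "measure lborel (cbox a b) = (\<Prod>i\<in>UNIV. b $ i - a $ i)"
    using le by (intro content_cbox_cart) (simp add: box_ne_empty)
  finally show ?thesis .
qed

lemma prod_if_eq_power:
  fixes k :: "'n::finite" and p q :: real
  shows "(\<Prod>i\<in>UNIV. if i = k then p else q) = p * q ^ (CARD('n) - 1)"
proof -
  have "(\<Prod>i\<in>UNIV. if i = k then p else q) = p * (\<Prod>i\<in>UNIV - {k}. if i = k then p else q)"
    by (subst prod.remove[of UNIV k]) auto
  also have "(\<Prod>i\<in>UNIV - {k}. if i = k then p else q) = (\<Prod>i\<in>UNIV - {k}. q)"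
    by (intro prod.cong) auto
  finally show ?thesis by simp
qed

text \<open>The box has two faces of area L^N and 2 N lateral ones of area L^(N - 1), a total of 2
  (1 + N / L) L^N. Only the bottom face, of area L^N, lies on the boundary hyperplane, so the ratio
  tends to 2 for large L.\<close>

lemma hardy_constant_half_space_test_box:
  fixes k :: "'n::finite" and L :: real
  assumes "L \<ge> 1"
  defines "E \<equiv> box 0 (\<chi> i. if i = k then 1 else L)"
    and "N \<equiv> CARD('n) - 1"
  shows "open E" "bounded E" "E \<subseteq> half_space k" "emeasure lborel E = ennreal (L ^ N)"
    "0 < t \<Longrightarrow> t < 1/2 \<Longrightarrow> emeasure lborel (inner_layer E t) \<le> ennreal (2 * (1 + real N / L) * L ^ N * t)"
    "0 < t \<Longrightarrow> t < 1 \<Longrightarrow> ennreal (L ^ N * t) \<le> emeasure lborel {x \<in> E. boundary_dist (half_space k) x \<le> t}"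
proof -
  define w where "w = (\<lambda>i. if i = k then 1 else L)"
  have mem: "x \<in> E \<longleftrightarrow> (\<forall>i. 0 < x $ i \<and> x $ i < w i)" for x
    by (simp add: E_def mem_box_cart w_def)
  have w: "w i \<ge> 1" for i using assms(1) by (simp add: w_def)
  show "open E" "bounded E" by (simp_all add: E_def open_box bounded_box)
  show sub: "E \<subseteq> half_space k" using mem by (auto simp: half_space_def)
  show emE: "emeasure lborel E = ennreal (L ^ N)"
    unfolding E_def using assms(1) prod_if_eq_power[of k 1 L]
    by (subst emeasure_lborel_box_cart) (auto simp: N_def)
  show "emeasure lborel (inner_layer E t) \<le> ennreal (2 * (1 + real N / L) * L ^ N * t)"
    if t: "0 < t" "t < 1/2"
  proof -
    define I where "I = box ((\<chi> i. t) :: real ^ 'n) (\<chi> i. w i - t)"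
    have memI: "x \<in> I \<longleftrightarrow> (\<forall>i. t < x $ i \<and> x $ i < w i - t)" for x
      by (simp add: I_def mem_box_cart)
    have "I \<subseteq> E"
    proof
      fix x assume "x \<in> I"
      then show "x \<in> E" using t unfolding mem memI by (meson less_trans diff_gt_0_iff_gt less_diff_eq less_add_same_cancel1)
    qed
    have deep: "infdist x (- E) > t" if x: "x \<in> I" for x
    proof -
      have "closed (- E)" "- E \<noteq> {}" using \<open>open E\<close> sub half_space_neq_UNIV[of k] by auto
      then obtain y where y: "y \<in> - E" "infdist x (- E) = dist x y" using infdist_attains_inf by metis
      then obtain i where i: "y $ i \<le> 0 \<or> w i \<le> y $ i" using mem[of y] by (auto simp: not_less)
      have "t < \<bar>(x - y) $ i\<bar>" using x[unfolded memI, rule_format, of i] i by auto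
      also have "\<dots> \<le> norm (x - y)" by (rule component_le_norm_cart)
      finally show ?thesis using y(2) by (simp add: dist_norm)
    qed
    have emI: "emeasure lborel I = ennreal ((1 - 2 * t) * (L - 2 * t) ^ N)"
    proof -
      have "emeasure lborel I = ennreal (\<Prod>i\<in>UNIV. w i - t - t)"
      proof (subst I_def, subst emeasure_lborel_box_cart)
        show "((\<chi> i. t) :: real ^ 'n) $ i \<le> (\<chi> i. w i - t) $ i" for i using w[of i] t by simp
      qed simp
      also have "(\<Prod>i\<in>UNIV. w i - t - t) = (\<Prod>i\<in>UNIV. if i = k then 1 - 2 * t else L - 2 * t)"
        by (intro prod.cong) (auto simp: w_def)
      finally show ?thesis by (simp add: prod_if_eq_power N_def)
    qed
    have "emeasure lborel (inner_layer E t) \<le> emeasure lborel (E - I)"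
      using deep \<open>open E\<close> by (intro emeasure_mono) (auto simp: I_def not_le[symmetric])
    also have "\<dots> = emeasure lborel E - emeasure lborel I"
      using emI \<open>open E\<close> \<open>I \<subseteq> E\<close> by (intro emeasure_Diff) (auto simp: I_def)
    also have "\<dots> = ennreal (L ^ N - (1 - 2 * t) * (L - 2 * t) ^ N)"
      unfolding emE emI using t assms(1) by (subst ennreal_minus) auto
    also have "\<dots> \<le> ennreal (2 * (1 + real N / L) * L ^ N * t)"
    proof (rule ennreal_leI)
      \<comment> \<open>Bernoulli's inequality bounds the volume of the inner box from below; the
        term quadratic in t that arises has the favourable sign and is dropped.\<close>
      have "2 * t / L \<le> 1" using t assms(1) by (simp add: divide_le_eq)
      then have "1 + real N * (- (2 * t / L)) \<le> (1 + (- (2 * t / L))) ^ N"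
        by (intro Bernoulli_inequality) simp
      then have "L ^ N * (1 - real N * (2 * t / L)) \<le> L ^ N * (1 - 2 * t / L) ^ N"
        using assms(1) by (intro mult_left_mono) auto
      also have "\<dots> = (L - 2 * t) ^ N"
        using assms(1) by (simp add: power_mult_distrib[symmetric] right_diff_distrib)
      finally have "(1 - 2 * t) * (L ^ N * (1 - real N * (2 * t / L))) \<le> (1 - 2 * t) * (L - 2 * t) ^ N"
        using t by (intro mult_left_mono) auto
      moreover have "L ^ N - (1 - 2 * t) * (L ^ N * (1 - real N * (2 * t / L)))
         = 2 * (1 + real N / L) * L ^ N * t - L ^ N * (4 * t * t * real N / L)"
        by (simp add: algebra_simps diff_divide_distrib add_divide_distrib)
      moreover have "0 \<le> L ^ N * (4 * t * t * real N / L)" using assms(1) t by simp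
      ultimately show "L ^ N - (1 - 2 * t) * (L - 2 * t) ^ N \<le> 2 * (1 + real N / L) * L ^ N * t"
        by linarith
    qed
    finally show ?thesis .
  qed
  show "ennreal (L ^ N * t) \<le> emeasure lborel {x \<in> E. boundary_dist (half_space k) x \<le> t}" if t: "0 < t" "t < 1"
  proof -
    have "ennreal (L ^ N * t) = emeasure lborel (box 0 (\<chi> i. if i = k then t else L))"
      using assms(1) t prod_if_eq_power[of k t L]
      by (subst emeasure_lborel_box_cart) (auto simp: N_def mult.commute)
    also have "\<dots> \<le> emeasure lborel {x \<in> E. boundary_dist (half_space k) x \<le> t}"
    proof (rule emeasure_mono)
      show "box 0 (\<chi> i. if i = k then t else L) \<subseteq> {x \<in> E. boundary_dist (half_space k) x \<le> t}"
      proof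
        fix x assume "x \<in> box 0 (\<chi> i. if i = k then t else L)"
        then have x: "0 < x $ i \<and> x $ i < (if i = k then t else L)" for i by (simp add: mem_box_cart)
        have "x \<in> E" unfolding mem w_def
        proof
          fix i show "0 < x $ i \<and> x $ i < (if i = k then 1 else L)" using x[of i] t by (auto split: if_splits)
        qed
        moreover have "x $ k \<le> t" using x[of k] by simp
        ultimately show "x \<in> {x \<in> E. boundary_dist (half_space k) x \<le> t}"
          using sub boundary_dist_half_space[of x k] by auto
      qed
      have [measurable]: "E \<in> sets borel" using \<open>open E\<close> by auto
      show "{x \<in> E. boundary_dist (half_space k) x \<le> t} \<in> sets lborel" by measurable
    qed
    finally show ?thesis .
  qed
qed

lemma test_domain_half_space:
  fixes k :: "'n::finite" and L :: real
  assumes L: "L \<ge> 1"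
  defines "N \<equiv> CARD('n) - 1"
  shows "test_domain (half_space k) (box 0 (\<chi> i. if i = k then 1 else L)) (2 * (1 + real N / L) * L ^ N) (L ^ N) 1"
proof -
  define E where "E = box 0 (\<chi> i. if i = k then 1 else L)"
  note box = hardy_constant_half_space_test_box[OF L, where k = k, folded E_def N_def]
  have "\<exists>r. 0 < r \<and> r < \<rho> \<and> emeasure lborel (inner_layer E r) \<le> ennreal (2 * (1 + real N / L) * L ^ N * r)"
    if "\<rho> > 0" for \<rho> :: real
  proof -
    have "0 < min \<rho> (1/2) / 2" "min \<rho> (1/2) / 2 < \<rho>" "min \<rho> (1/2) / 2 < 1/2" using that by auto
    then show ?thesis using box(5)[of "min \<rho> (1/2) / 2"] by blast
  qed
  then have "test_domain (half_space k) E (2 * (1 + real N / L) * L ^ N) (L ^ N) 1"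
    using box L by (simp add: test_domain_def)
  then show ?thesis by (simp add: E_def)
qed

lemma hardy_constant_tendsto_half_space:
  fixes e :: "real ^ 'n" and k :: 'n
  assumes e: "norm e = 1"
  shows "((\<lambda>s. hardy_constant s (half_space k)) \<longlongrightarrow> dir_moment e 1 * ennreal 2) (at_left 1)"
proof (rule hardy_constant_tendsto)
  show "dir_moment e 1 * ennreal 2 \<le> hardy_constant s (half_space k)" if s: "0 < s" "s < 1" for s
  proof -
    have "dir_moment e 1 * ennreal 2 = 2 * dir_moment e 1 * 1" by (simp add: mult.commute)
    also have "\<dots> \<le> 2 * dir_moment e s * ennreal (1 / s)"
      using s dir_moment_1_le[OF e] by (intro mult_mono) (auto simp: ennreal_ge_1)
    also have "\<dots> \<le> hardy_constant s (half_space k)" by (rule hardy_constant_ge_half_space) fact+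
    finally show ?thesis .
  qed
  fix \<eta> :: real assume "\<eta> > 1"
  define N where "N = CARD('n) - 1"
  \<comment> \<open>Then N / L \<le> \<eta> - 1, so the lateral faces cost no more than the
    permitted factor; the maximum with 1 meets the requirement on box widths.\<close>
  define L where "L = max 1 (real N / (\<eta> - 1))"
  have L: "L \<ge> 1" by (simp add: L_def)
  have "real N / (\<eta> - 1) \<le> L" by (simp add: L_def)
  then have "real N \<le> (\<eta> - 1) * L" using \<open>\<eta> > 1\<close> by (simp add: pos_divide_le_eq mult.commute)
  then have NL: "1 + real N / L \<le> \<eta>" using L by (simp add: divide_le_eq[of "real N"] field_simps)
  have "test_domain (half_space k) (box 0 (\<chi> i. if i = k then 1 else L)) (2 * (1 + real N / L) * L ^ N) (L ^ N) 1"
    unfolding N_def by (rule test_domain_half_space[OF L])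
  moreover have "2 * (1 + real N / L) * L ^ N \<le> \<eta> * 2 * L ^ N"
    using NL L by (intro mult_right_mono) auto
  ultimately show "\<exists>E M m t0. test_domain (half_space k) E M m t0 \<and> M \<le> \<eta> * 2 * m"
    by blast
qed (use e open_half_space half_space_neq_UNIV in auto)

text \<open>The constant K is finite and positive, so it cancels in K / (2 K); division in
  \<open>ennreal\<close> is treated as a product with the continuous inverse.\<close>

lemma hardy_constant_ratio_tendsto:
  fixes \<Omega> :: "(real ^ 'n) set" and k :: 'n
  assumes "open \<Omega>" "bounded \<Omega>" "convex \<Omega>" "\<Omega> \<noteq> {}"
  shows "((\<lambda>s. hardy_constant s \<Omega> / hardy_constant s (half_space k)) \<longlongrightarrow> 1 / 2) (at_left (1::real))"
proof -
  define e :: "real ^ 'n" where "e = axis k 1"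
  have e: "norm e = 1" by (simp add: e_def)
  obtain \<kappa> where \<kappa>: "dir_moment e 1 = ennreal \<kappa>" "\<kappa> > 0"
    using dir_moment_finite[OF e] dir_moment_pos[OF e] by (cases "dir_moment e 1") auto
  have 1: "((\<lambda>s. hardy_constant s \<Omega>) \<longlongrightarrow> ennreal \<kappa>) (at_left 1)"
    using hardy_constant_tendsto_convex[OF assms e] by (simp add: \<kappa>)
  have "dir_moment e 1 * ennreal 2 = ennreal (2 * \<kappa>)"
    unfolding \<kappa>(1) using \<kappa>(2) by (subst ennreal_mult[symmetric]) (auto simp: mult.commute)
  then have "((\<lambda>s. inverse (hardy_constant s (half_space k))) \<longlongrightarrow> inverse (ennreal (2 * \<kappa>))) (at_left 1)"
    using continuous_on_tendsto_compose[OF continuous_on_inverse_ennreal[OF continuous_on_id, of UNIV]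
        hardy_constant_tendsto_half_space[OF e, of k]] by simp
  then have 2: "((\<lambda>s. inverse (hardy_constant s (half_space k))) \<longlongrightarrow> ennreal (1 / (2 * \<kappa>))) (at_left 1)"
    using \<kappa>(2) by (simp add: inverse_ennreal inverse_eq_divide)
  have "((\<lambda>s. hardy_constant s \<Omega> * inverse (hardy_constant s (half_space k))) \<longlongrightarrow> ennreal \<kappa> * ennreal (1 / (2 * \<kappa>))) (at_left 1)"
    by (rule tendsto_mult_ennreal[OF 1 2]) simp
  moreover have "ennreal \<kappa> * ennreal (1 / (2 * \<kappa>)) = ennreal (1 / 2)"
    using \<kappa>(2) by (simp add: ennreal_mult[symmetric])
  moreover have "ennreal (1 / 2) = 1 / 2"
    using divide_ennreal[of 1 2] by simp
  ultimately show ?thesis by (simp add: divide_ennreal_def)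
qed

section \<open>The one-dimensional case\<close>

lemma emeasure_slab:
  fixes e :: "'a::euclidean_space"
  assumes D: "DIM('a) = 1" "norm e = 1" and "\<alpha> \<le> \<beta>"
  shows "emeasure lborel {y. \<alpha> < y \<bullet> e \<and> y \<bullet> e < \<beta>} = ennreal (\<beta> - \<alpha>)"
    and "emeasure lborel {y. \<alpha> \<le> y \<bullet> e \<and> y \<bullet> e \<le> \<beta>} = ennreal (\<beta> - \<alpha>)"
proof -
  obtain b :: 'a where b: "Basis = {b}" using D(1) by (meson card_1_singletonE)
  have nb: "norm b = 1" by (rule norm_Basis) (simp add: b)
  then have bb: "b \<bullet> b = 1" by (simp add: norm_eq_1)
  have eb: "y \<bullet> e = (y \<bullet> b) * (e \<bullet> b)" for y
    using euclidean_inner[of y e] by (simp add: b)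
  have "\<bar>e \<bullet> b\<bar> = 1" using abs_inner_DIM_1[OF D(1) nb, of e] D(2) by simp
  then consider "e \<bullet> b = 1" | "e \<bullet> b = -1" by linarith
  then have "emeasure lborel {y. \<alpha> < y \<bullet> e \<and> y \<bullet> e < \<beta>} = ennreal (\<beta> - \<alpha>)
      \<and> emeasure lborel {y. \<alpha> \<le> y \<bullet> e \<and> y \<bullet> e \<le> \<beta>} = ennreal (\<beta> - \<alpha>)"
  proof cases
    case 1
    have "{y. \<alpha> < y \<bullet> e \<and> y \<bullet> e < \<beta>} = box (\<alpha> *\<^sub>R b) (\<beta> *\<^sub>R b)"
      "{y. \<alpha> \<le> y \<bullet> e \<and> y \<bullet> e \<le> \<beta>} = cbox (\<alpha> *\<^sub>R b) (\<beta> *\<^sub>R b)"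
      unfolding eb 1 by (auto simp: mem_box b bb)
    then show ?thesis using \<open>\<alpha> \<le> \<beta>\<close>
      by (simp add: emeasure_lborel_box_eq emeasure_lborel_cbox_eq b bb inner_diff_left)
  next
    case 2
    have "{y. \<alpha> < y \<bullet> e \<and> y \<bullet> e < \<beta>} = box ((- \<beta>) *\<^sub>R b) ((- \<alpha>) *\<^sub>R b)"
      "{y. \<alpha> \<le> y \<bullet> e \<and> y \<bullet> e \<le> \<beta>} = cbox ((- \<beta>) *\<^sub>R b) ((- \<alpha>) *\<^sub>R b)"
      unfolding eb 2 by (auto simp: mem_box b bb)
    then show ?thesis using \<open>\<alpha> \<le> \<beta>\<close>
      by (simp add: emeasure_lborel_box_eq emeasure_lborel_cbox_eq b bb inner_diff_left)
  qed
  then show "emeasure lborel {y. \<alpha> < y \<bullet> e \<and> y \<bullet> e < \<beta>} = ennreal (\<beta> - \<alpha>)"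
    "emeasure lborel {y. \<alpha> \<le> y \<bullet> e \<and> y \<bullet> e \<le> \<beta>} = ennreal (\<beta> - \<alpha>)" by auto
qed

text \<open>The value is the integral of t powr (- 1 - s) over t > m, the kernel mass beyond
  distance m on one side, in layer cake form. \<open>ennreal (t - m)\<close> truncates at zero;
  instead of subtracting, the m term is added to both sides and cancelled at the end, where it is
  finite.\<close>

lemma nn_integral_powr_excess:
  assumes "0 < s" "0 < m"
  shows "(\<integral>\<^sup>+ t. ennreal ((1 + s) * t powr (- (1 + s) - 1)) * ennreal (t - m) * indicator {0<..} t \<partial>lborel)
    = ennreal (1 / (s * m powr s))" (is "?X = _")
proof -
  have "(\<integral>\<^sup>+ t. ennreal (1 + s) * (ennreal (t powr (- s - 1)) * indicator {m<..} t) \<partial>lborel)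
    = (\<integral>\<^sup>+ t. ennreal ((1 + s) * t powr (- (1 + s) - 1)) * ennreal (t - m) * indicator {0<..} t
       + ennreal ((1 + s) * m) * (ennreal (t powr (- (1 + s) - 1)) * indicator {m<..} t) \<partial>lborel)"
  proof (rule nn_integral_cong)
    fix t :: real
    show "ennreal (1 + s) * (ennreal (t powr (- s - 1)) * indicator {m<..} t)
      = ennreal ((1 + s) * t powr (- (1 + s) - 1)) * ennreal (t - m) * indicator {0<..} t
       + ennreal ((1 + s) * m) * (ennreal (t powr (- (1 + s) - 1)) * indicator {m<..} t)"
    proof (cases "t > m")
      case True
      then have t: "t > 0" using assms by linarith
      have "t powr (- s - 1) = t * t powr (- (1 + s) - 1)"
      proof -
        have "t powr (- s - 1) = t powr (1 + (- (1 + s) - 1))"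
          by (rule arg_cong[of _ _ "\<lambda>p. t powr p"]) simp
        then show ?thesis using t by (simp only: powr_add powr_one_gt_zero_iff less_imp_le powr_one)
      qed
      then have "(1 + s) * t powr (- s - 1)
        = (1 + s) * t powr (- (1 + s) - 1) * (t - m) + (1 + s) * m * t powr (- (1 + s) - 1)"
        by (simp add: algebra_simps)
      then show ?thesis using True t assms
        by (simp add: ennreal_mult[symmetric] ennreal_plus[symmetric] del: ennreal_plus)
    next
      case False
      then show ?thesis by (simp add: ennreal_neg)
    qed
  qed
  also have "\<dots> = ?X + ennreal ((1 + s) * m) * (\<integral>\<^sup>+ t. ennreal (t powr (- (1 + s) - 1)) * indicator {m<..} t \<partial>lborel)"
    by (subst nn_integral_add) (auto simp: nn_integral_cmult)
  also have "(\<integral>\<^sup>+ t. ennreal (t powr (- (1 + s) - 1)) * indicator {m<..} t \<partial>lborel) = ennreal (m powr (- (1 + s)) / (1 + s))"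
    using assms by (intro nn_integral_powr_greaterThan) auto
  also have "(\<integral>\<^sup>+ t. ennreal (1 + s) * (ennreal (t powr (- s - 1)) * indicator {m<..} t) \<partial>lborel)
    = ennreal (1 + s) * ennreal (m powr (- s) / s)"
    using nn_integral_powr_greaterThan[OF assms] by (simp add: nn_integral_cmult)
  also have "ennreal (1 + s) * ennreal (m powr (- s) / s) = ennreal (1 / (s * m powr s)) + ennreal (m powr (- s))"
  proof -
    have "(1 + s) * (m powr (- s) / s) = 1 / (s * m powr s) + m powr (- s)"
      using assms by (simp add: powr_minus_divide field_simps)
    then show ?thesis using assms by (simp add: ennreal_mult[symmetric] ennreal_plus[symmetric] del: ennreal_plus)
  qed
  also have "ennreal ((1 + s) * m) * ennreal (m powr (- (1 + s)) / (1 + s)) = ennreal (m powr (- s))"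
  proof -
    have "m powr (- s) = m powr (1 + - (1 + s))" by simp
    then have "m powr (- s) = m * m powr (- (1 + s))"
      using assms by (simp only: powr_add less_imp_le powr_one)
    then show ?thesis using assms by (simp add: ennreal_mult[symmetric])
  qed
  finally have "ennreal (m powr (- s)) + ennreal (1 / (s * m powr s)) = ennreal (m powr (- s)) + ?X"
    by (simp only: add.commute)
  then show ?thesis by (simp add: ennreal_add_left_cancel)
qed

text \<open>One-dimensional bathtub principle: the complement of \<open>E\<close> on one side of \<open>x\<close> is closest to \<open>x\<close>
  when \<open>E\<close> fills an interval adjacent to \<open>x\<close>.\<close>

lemma kern_one_sided_ge:
  fixes e x :: "'a::euclidean_space"
  assumes D: "DIM('a) = 1" "norm e = 1" and "0 < s" and E [measurable]: "E \<in> sets borel" and fin: "emeasure lborel E < \<infinity>"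
  shows "ennreal (1 / (s * measure lborel {y \<in> E. y \<bullet> e > x \<bullet> e} powr s))
    \<le> (\<integral>\<^sup>+ y. kern s (x - y) * indicator {y. y \<notin> E \<and> y \<bullet> e > x \<bullet> e} y \<partial>lborel)"
proof -
  define m where "m = measure lborel {y \<in> E. y \<bullet> e > x \<bullet> e}"
  have "emeasure lborel {y \<in> E. y \<bullet> e > x \<bullet> e} \<le> emeasure lborel E" by (intro emeasure_mono) auto
  then have em: "emeasure lborel {y \<in> E. y \<bullet> e > x \<bullet> e} = ennreal m"
    unfolding m_def using fin by (intro emeasure_eq_ennreal_measure) auto
  show ?thesis
  \<comment> \<open>For m = 0 the left side is 1 / 0 = 0 by convention, so only m > 0 has
    content.\<close>
  proof (cases "m = 0")
    case False
    then have m: "m > 0" by (simp add: m_def less_le)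
    define f where "f = (\<lambda>y. y \<bullet> e - x \<bullet> e)"
    define Y where "Y = {y. y \<notin> E \<and> y \<bullet> e > x \<bullet> e}"
    have [measurable]: "Y \<in> sets borel" "f \<in> borel_measurable borel" unfolding Y_def f_def by measurable
    \<comment> \<open>The points within distance t on the chosen side have measure t, and at most m
      of it belongs to E.\<close>
    have layer: "ennreal (t - m) \<le> emeasure lborel {y \<in> Y. f y \<le> t}" if "t > 0" for t
    proof -
      have "ennreal t = emeasure lborel {y. x \<bullet> e < y \<bullet> e \<and> y \<bullet> e < x \<bullet> e + t}"
        using emeasure_slab(1)[OF D, of "x \<bullet> e" "x \<bullet> e + t"] that by simp
      also have "\<dots> \<le> emeasure lborel ({y \<in> Y. f y \<le> t} \<union> {y \<in> E. y \<bullet> e > x \<bullet> e})"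
        by (intro emeasure_mono) (auto simp: Y_def f_def)
      also have "\<dots> \<le> emeasure lborel {y \<in> Y. f y \<le> t} + ennreal m"
        unfolding em[symmetric] by (intro emeasure_subadditive) measurable
      finally have "ennreal t - ennreal m \<le> emeasure lborel {y \<in> Y. f y \<le> t}"
        by (simp add: ennreal_minus_le_iff add.commute)
      then show ?thesis using m by (simp add: ennreal_minus)
    qed
    have "ennreal (1 / (s * m powr s))
      = (\<integral>\<^sup>+ t. ennreal ((1 + s) * t powr (- (1 + s) - 1)) * ennreal (t - m) * indicator {0<..} t \<partial>lborel)"
      by (rule nn_integral_powr_excess[symmetric]) fact+
    also have "\<dots> \<le> (\<integral>\<^sup>+ t. ennreal ((1 + s) * t powr (- (1 + s) - 1)) * emeasure lborel {y \<in> Y. f y \<le> t} * indicator {0<..} t \<partial>lborel)"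
    proof (intro nn_integral_mono)
      fix t :: real
      show "ennreal ((1 + s) * t powr (- (1 + s) - 1)) * ennreal (t - m) * indicator {0<..} t
        \<le> ennreal ((1 + s) * t powr (- (1 + s) - 1)) * emeasure lborel {y \<in> Y. f y \<le> t} * indicator {0<..} t"
        using layer[of t] by (cases "t > 0") (auto intro: mult_left_mono)
    qed
    also have "\<dots> = (\<integral>\<^sup>+ y\<in>Y. ennreal (1 / f y powr (1 + s)) \<partial>lborel)"
      using \<open>0 < s\<close> by (intro nn_integral_layer_cake[symmetric]) (auto simp: Y_def f_def)
    also have "\<dots> = (\<integral>\<^sup>+ y. kern s (x - y) * indicator Y y \<partial>lborel)"
    proof (rule nn_integral_cong)
      fix y
      have "norm (x - y) = \<bar>y \<bullet> e - x \<bullet> e\<bar>"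
        using abs_inner_DIM_1[OF D, of "y - x"] by (simp add: inner_diff_left norm_minus_commute)
      then show "ennreal (1 / f y powr (1 + s)) * indicator Y y = kern s (x - y) * indicator Y y"
        by (auto simp: kern_def D(1) f_def Y_def indicator_def)
    qed
    finally show ?thesis by (simp add: m_def Y_def)
  qed (simp add: m_def)
qed

text \<open>The rearrangement \<open>x \<mapsto> |E \<inter> {y > x}|\<close> pushes Lebesgue measure on \<open>E\<close> to Lebesgue measure on
  \<open>(0, |E|)\<close>.\<close>

lemma nn_integral_tail_measure_ge:
  fixes e :: "'a::euclidean_space"
  assumes D: "DIM('a) = 1" "norm e = 1" and s: "0 < s" "s < 1" and E [measurable]: "E \<in> sets borel" and "bounded E"
    and m: "measure lborel E > 0"
  shows "ennreal (measure lborel E powr (1 - s) / (1 - s))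
    \<le> (\<integral>\<^sup>+ x\<in>E. ennreal (1 / measure lborel {y \<in> E. y \<bullet> e > x \<bullet> e} powr s) \<partial>lborel)"
proof -
  have fin: "emeasure lborel E < \<infinity>" using \<open>bounded E\<close> by (rule emeasure_bounded_finite)
  \<comment> \<open>The tail function falls from the measure of E to 0 and is 1-Lipschitz, so by the
    intermediate value theorem it attains every level.\<close>
  define G where "G = (\<lambda>\<tau>. measure lborel {y \<in> E. y \<bullet> e > \<tau>})"
  have fin': "emeasure lborel S < \<infinity>" if "S \<subseteq> E" "S \<in> sets borel" for S
    using le_less_trans[OF emeasure_mono[of S E lborel] fin] that by auto
  have split: "G a = G b + measure lborel {y \<in> E. a < y \<bullet> e \<and> y \<bullet> e \<le> b}" if "a \<le> b" for a b
  proof -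
    have "{y \<in> E. y \<bullet> e > a} = {y \<in> E. y \<bullet> e > b} \<union> {y \<in> E. a < y \<bullet> e \<and> y \<bullet> e \<le> b}"
      using that by auto
    then show ?thesis
      unfolding G_def using fin'[of "{y \<in> E. y \<bullet> e > b}"] fin'[of "{y \<in> E. a < y \<bullet> e \<and> y \<bullet> e \<le> b}"]
      by (simp only:) (rule measure_Union, auto)
  qed
  have slab_le: "measure lborel {y \<in> E. a < y \<bullet> e \<and> y \<bullet> e \<le> b} \<le> b - a" if "a \<le> b" for a b
  proof -
    have "emeasure lborel {y \<in> E. a < y \<bullet> e \<and> y \<bullet> e \<le> b} \<le> ennreal (b - a)"
      unfolding emeasure_slab(2)[OF D that, symmetric] by (intro emeasure_mono) auto
    then show ?thesis using that by (simp add: measure_def enn2real_leI)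
  qed
  have G_lip: "\<bar>G a - G b\<bar> \<le> \<bar>a - b\<bar>" for a b
  proof (cases "a \<le> b")
    case True
    then show ?thesis
      using split[OF True] slab_le[OF True] measure_nonneg[of lborel "{y \<in> E. a < y \<bullet> e \<and> y \<bullet> e \<le> b}"] by linarith
  next
    case False
    then have "b \<le> a" by simp
    then show ?thesis
      using split[of b a] slab_le[of b a] measure_nonneg[of lborel "{y \<in> E. b < y \<bullet> e \<and> y \<bullet> e \<le> a}"] by linarith
  qed
  have "1-lipschitz_on UNIV G" using G_lip by (intro lipschitz_onI) (simp_all add: dist_real_def)
  then have "continuous_on UNIV G" by (rule lipschitz_on_continuous_on)
  then have cont: "continuous_on S G" for S by (rule continuous_on_subset) simp
  obtain B where B: "B > 0" "\<And>x. x \<in> E \<Longrightarrow> norm x \<le> B" using \<open>bounded E\<close> bounded_pos by blast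
  have eB: "- (B + 1) < x \<bullet> e" "x \<bullet> e \<le> B" if "x \<in> E" for x
    using Cauchy_Schwarz_ineq2[of x e] B(2)[OF that] D(2) by simp_all
  have G0: "G (- (B + 1)) = measure lborel E"
    unfolding G_def by (rule arg_cong[of _ _ "measure lborel"]) (use eB in auto)
  have "{y \<in> E. y \<bullet> e > B} = {}" using eB(2) by (auto simp: not_less)
  then have G1: "G B = 0" by (simp only: G_def measure_empty)
  have ivt: "\<exists>\<tau>. G \<tau> = t" if "0 \<le> t" "t \<le> measure lborel E" for t
  proof -
    have "\<exists>\<tau>\<ge>- (B + 1). \<tau> \<le> B \<and> G \<tau> = t"
      by (rule IVT2') (use that G0 G1 B(1) cont in simp_all)
    then show ?thesis by blast
  qed
  have G_anti: "G b \<le> G a" if "a \<le> b" for a b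
    using split[OF that] measure_nonneg[of lborel "{y \<in> E. a < y \<bullet> e \<and> y \<bullet> e \<le> b}"] by linarith
  have G_meas [measurable]: "G \<in> borel_measurable borel" using cont by (rule borel_measurable_continuous_onI)
  \<comment> \<open>The layer bound asks for a positive function, so the points with no mass of E
    beyond them are discarded; this can only lower the integral.\<close>
  define E' where "E' = {x \<in> E. G (x \<bullet> e) > 0}"
  have [measurable]: "E' \<in> sets borel" unfolding E'_def by measurable
  have layer: "ennreal (1 * t) \<le> emeasure lborel {x \<in> E'. G (x \<bullet> e) \<le> t}" if t: "0 < t" "t < measure lborel E" for t
  proof -
    have "ennreal t \<le> emeasure lborel {x \<in> E'. G (x \<bullet> e) \<le> t} + ennreal \<delta>" if "0 < \<delta>" for \<delta>
    proof -
      \<comment> \<open>Between the level t and a small level \<delta>' > 0 lies a part of E of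
        measure exactly t - \<delta>'; the positive lower level keeps it inside \<open>E'\<close>.
        Then \<delta> tends to zero.\<close>
      define \<delta>' where "\<delta>' = min \<delta> t"
      have \<delta>': "0 < \<delta>'" "\<delta>' \<le> \<delta>" "\<delta>' \<le> t" using that t by (auto simp: \<delta>'_def)
      obtain a where a: "G a = t" using ivt[of t] t by auto
      obtain b where b: "G b = \<delta>'" using ivt[of \<delta>'] \<delta>' t by auto
      have ab: "a \<le> b \<or> \<delta>' = t" 
      proof (cases "a \<le> b")
        case False
        then have "t \<le> \<delta>'" using G_anti[of b a] a b by simp
        then show ?thesis using \<delta>'(3) by simp
      qed simp
      show ?thesis
      proof (cases "a \<le> b")
        case True
        have sub: "{y \<in> E. a < y \<bullet> e \<and> y \<bullet> e \<le> b} \<subseteq> {x \<in> E'. G (x \<bullet> e) \<le> t}"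
        proof safe
          fix y assume y: "y \<in> E" "a < y \<bullet> e" "y \<bullet> e \<le> b"
          have "\<delta>' \<le> G (y \<bullet> e)" using G_anti[OF y(3)] b by simp
          then show "y \<in> E'" using \<delta>'(1) y(1) by (simp add: E'_def)
          show "G (y \<bullet> e) \<le> t" using G_anti[of a "y \<bullet> e"] y(2) a by simp
        qed
        have "t = \<delta>' + measure lborel {y \<in> E. a < y \<bullet> e \<and> y \<bullet> e \<le> b}"
          using split[OF True] a b by simp
        then have "ennreal t = ennreal \<delta>' + ennreal (measure lborel {y \<in> E. a < y \<bullet> e \<and> y \<bullet> e \<le> b})"
          using \<delta>'(1) by (simp only: ennreal_plus[symmetric] less_imp_le measure_nonneg)
        also have "ennreal (measure lborel {y \<in> E. a < y \<bullet> e \<and> y \<bullet> e \<le> b}) = emeasure lborel {y \<in> E. a < y \<bullet> e \<and> y \<bullet> e \<le> b}"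
          using fin'[of "{y \<in> E. a < y \<bullet> e \<and> y \<bullet> e \<le> b}"] by (intro emeasure_eq_ennreal_measure[symmetric]) auto
        also have "ennreal \<delta>' + \<dots> \<le> ennreal \<delta> + emeasure lborel {x \<in> E'. G (x \<bullet> e) \<le> t}"
          using \<delta>'(2) sub by (intro add_mono emeasure_mono ennreal_leI) auto
        finally show ?thesis by (simp add: add.commute)
      next
        case False
        then have "ennreal t \<le> ennreal \<delta>" using ab \<delta>'(2) by (intro ennreal_leI) simp
        then show ?thesis by (simp add: add_increasing)
      qed
    qed
    then show ?thesis unfolding mult_1 by (rule ennreal_le_epsilon)
  qed
  have "ennreal (1 * measure lborel E powr (1 - s) / (1 - s)) \<le> (\<integral>\<^sup>+ x\<in>E'. ennreal (1 / G (x \<bullet> e) powr s) \<partial>lborel)"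
  proof (rule nn_integral_layer_ge)
    show "(\<lambda>x. G (x \<bullet> e)) \<in> borel_measurable borel" "E' \<in> sets borel" by measurable
    show "0 < G (x \<bullet> e)" if "x \<in> E'" for x using that by (simp add: E'_def)
  qed (use s m layer in simp_all)
  also have "\<dots> \<le> (\<integral>\<^sup>+ x\<in>E. ennreal (1 / G (x \<bullet> e) powr s) \<partial>lborel)"
    by (intro nn_integral_mono mult_left_mono) (auto simp: E'_def indicator_def)
  finally show ?thesis by (simp add: G_def)
qed

text \<open>Add the one-sided bounds for the directions \<open>e\<close> and \<open>- e\<close>: the
  exterior of E on either side of x contributes separately. The constant is that of an interval, for
  which each one-sided bound is an identity.\<close>

lemma fractional_isoperimetric_DIM_1:
  fixes e :: "'a::euclidean_space" and E :: "'a set"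
  assumes D: "DIM('a) = 1" "norm e = 1" and s: "0 < s" "s < 1" and E [measurable]: "E \<in> sets borel" and "bounded E"
    and m: "measure lborel E > 0"
  shows "ennreal (2 * measure lborel E powr (1 - s) / (s * (1 - s)))
    \<le> (\<integral>\<^sup>+ x. (\<integral>\<^sup>+ y. kern s (x - y) * indicator E x * indicator (- E) y \<partial>lborel) \<partial>lborel)"
proof -
  have fin: "emeasure lborel E < \<infinity>" using \<open>bounded E\<close> by (rule emeasure_bounded_finite)
  define F where "F = (\<lambda>(v :: 'a) x. measure lborel {y \<in> E. y \<bullet> v > x \<bullet> v})"
  have D': "norm (- e) = 1" using D(2) by simp
  have F_meas [measurable]: "F e' \<in> borel_measurable borel" for e'
    unfolding F_def measure_def by measurable
  have tail: "ennreal (measure lborel E powr (1 - s) / (1 - s)) \<le> (\<integral>\<^sup>+ x\<in>E. ennreal (1 / F e' x powr s) \<partial>lborel)"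
    if "norm e' = 1" for e'
    unfolding F_def by (rule nn_integral_tail_measure_ge[OF D(1) that s E \<open>bounded E\<close> m])
  have "ennreal (2 * measure lborel E powr (1 - s) / (s * (1 - s)))
    = ennreal (1 / s) * (ennreal (measure lborel E powr (1 - s) / (1 - s)) + ennreal (measure lborel E powr (1 - s) / (1 - s)))"
    using s by (simp add: ennreal_plus[symmetric] ennreal_mult[symmetric] del: ennreal_plus)
  also have "\<dots> \<le> ennreal (1 / s) * ((\<integral>\<^sup>+ x\<in>E. ennreal (1 / F e x powr s) \<partial>lborel) + (\<integral>\<^sup>+ x\<in>E. ennreal (1 / F (- e) x powr s) \<partial>lborel))"
    by (intro mult_left_mono add_mono tail D(2) D') simp
  also have "\<dots> = (\<integral>\<^sup>+ x. ennreal (1 / s) * (ennreal (1 / F e x powr s) * indicator E x + ennreal (1 / F (- e) x powr s) * indicator E x) \<partial>lborel)"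
    by (simp add: nn_integral_add nn_integral_cmult)
  also have "\<dots> \<le> (\<integral>\<^sup>+ x. (\<integral>\<^sup>+ y. kern s (x - y) * indicator E x * indicator (- E) y \<partial>lborel) \<partial>lborel)"
  proof (intro nn_integral_mono)
    fix x
    show "ennreal (1 / s) * (ennreal (1 / F e x powr s) * indicator E x + ennreal (1 / F (- e) x powr s) * indicator E x)
      \<le> (\<integral>\<^sup>+ y. kern s (x - y) * indicator E x * indicator (- E) y \<partial>lborel)"
    proof (cases "x \<in> E")
      case True
      have "ennreal (1 / s) * (ennreal (1 / F e x powr s) + ennreal (1 / F (- e) x powr s))
        = ennreal (1 / (s * F e x powr s)) + ennreal (1 / (s * F (- e) x powr s))"
        using s by (simp add: distrib_left ennreal_mult[symmetric])
      also have "\<dots> \<le> (\<integral>\<^sup>+ y. kern s (x - y) * indicator {y. y \<notin> E \<and> y \<bullet> e > x \<bullet> e} y \<partial>lborel)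
          + (\<integral>\<^sup>+ y. kern s (x - y) * indicator {y. y \<notin> E \<and> y \<bullet> (- e) > x \<bullet> (- e)} y \<partial>lborel)"
        unfolding F_def
        by (intro add_mono kern_one_sided_ge[OF D(1) D(2) s(1) E fin] kern_one_sided_ge[OF D(1) D' s(1) E fin])
      also have "\<dots> = (\<integral>\<^sup>+ y. kern s (x - y) * indicator {y. y \<notin> E \<and> y \<bullet> e > x \<bullet> e} y
          + kern s (x - y) * indicator {y. y \<notin> E \<and> y \<bullet> (- e) > x \<bullet> (- e)} y \<partial>lborel)"
        by (rule nn_integral_add[symmetric]) measurable
      also have "\<dots> \<le> (\<integral>\<^sup>+ y. kern s (x - y) * indicator E x * indicator (- E) y \<partial>lborel)"
        using True by (intro nn_integral_mono) (auto simp: indicator_def)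
      finally show ?thesis using True by simp
    qed simp
  qed
  finally show ?thesis .
qed

text \<open>Coarea: both sides of the inequality are integrals over the superlevel sets of \<open>|u|\<close>.\<close>

lemma gagliardo_seminorm_ge_superlevel:
  fixes u :: "'a::euclidean_space \<Rightarrow> real"
  assumes u [measurable]: "u \<in> borel_measurable borel"
    and w [measurable]: "w \<in> borel_measurable borel"
    and le: "\<And>t. t \<ge> 0 \<Longrightarrow> c * (\<integral>\<^sup>+ x. w x * indicator {x. \<bar>u x\<bar> > t} x \<partial>lborel)
      \<le> 2 * (\<integral>\<^sup>+ x. (\<integral>\<^sup>+ y. kern s (x - y) * indicator {x. \<bar>u x\<bar> > t} x * indicator (- {x. \<bar>u x\<bar> > t}) y \<partial>lborel) \<partial>lborel)"
  shows "c * (\<integral>\<^sup>+ x. ennreal \<bar>u x\<bar> * w x \<partial>lborel) \<le> gagliardo_seminorm s u"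
proof -
  let ?I = "\<lambda>t x. indicator {x. t < \<bar>u x\<bar>} x :: ennreal"
  let ?J = "\<lambda>t x. indicator {x. \<bar>u x\<bar> \<le> t} x :: ennreal"
  have I_eq: "?I t x = indicator {..<\<bar>u x\<bar>} t" and J_eq: "?J t x = indicator {\<bar>u x\<bar>..} t" for t x
    by (auto simp: indicator_def)
  have compl: "- {x. t < \<bar>u x\<bar>} = {x. \<bar>u x\<bar> \<le> t}" for t by auto
  have "c * (\<integral>\<^sup>+ x. ennreal \<bar>u x\<bar> * w x \<partial>lborel) = c * (\<integral>\<^sup>+ x. (\<integral>\<^sup>+ t. w x * ?I t x * indicator {0..} t \<partial>lborel) \<partial>lborel)"
  proof (intro arg_cong[of _ _ "\<lambda>z. c * z"] nn_integral_cong)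
    fix x
    have "(\<integral>\<^sup>+ t. w x * ?I t x * indicator {0..} t \<partial>lborel) = (\<integral>\<^sup>+ t. w x * indicator {0..<\<bar>u x\<bar>} t \<partial>lborel)"
      by (intro nn_integral_cong) (auto simp: I_eq indicator_def)
    also have "\<dots> = w x * ennreal \<bar>u x\<bar>" by (simp add: nn_integral_cmult)
    finally show "ennreal \<bar>u x\<bar> * w x = (\<integral>\<^sup>+ t. w x * ?I t x * indicator {0..} t \<partial>lborel)"
      by (simp add: mult.commute)
  qed
  also have "\<dots> = c * (\<integral>\<^sup>+ t. (\<integral>\<^sup>+ x. w x * ?I t x * indicator {0..} t \<partial>lborel) \<partial>lborel)"
    by (rule arg_cong[of _ _ "\<lambda>z. c * z"], rule lborel_pair.Fubini') measurable
  also have "\<dots> = (\<integral>\<^sup>+ t. c * (\<integral>\<^sup>+ x. w x * ?I t x \<partial>lborel) * indicator {0..} t \<partial>lborel)"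
    by (subst nn_integral_cmult[symmetric]) (measurable, simp add: nn_integral_multc mult.assoc[symmetric])
  also have "\<dots> \<le> (\<integral>\<^sup>+ t. 2 * (\<integral>\<^sup>+ x. (\<integral>\<^sup>+ y. kern s (x - y) * ?I t x * ?J t y \<partial>lborel) \<partial>lborel) \<partial>lborel)"
  proof (intro nn_integral_mono)
    fix t :: real
    show "c * (\<integral>\<^sup>+ x. w x * ?I t x \<partial>lborel) * indicator {0..} t
      \<le> 2 * (\<integral>\<^sup>+ x. (\<integral>\<^sup>+ y. kern s (x - y) * ?I t x * ?J t y \<partial>lborel) \<partial>lborel)"
      using le[of t] by (cases "t \<ge> 0") (simp_all add: compl)
  qed
  also have "\<dots> = (\<integral>\<^sup>+ t. (\<integral>\<^sup>+ x. (\<integral>\<^sup>+ y. kern s (x - y) * (?I t x * ?J t y + ?I t y * ?J t x) \<partial>lborel) \<partial>lborel) \<partial>lborel)"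
  \<comment> \<open>One half of the doubled interaction is rewritten with x and y exchanged, so that
    a pair is counted at the levels separating |u x| from |u y|, whichever of the two is
    larger.\<close>
  proof (rule nn_integral_cong)
    fix t
    have "(\<integral>\<^sup>+ x. (\<integral>\<^sup>+ y. kern s (x - y) * ?I t x * ?J t y \<partial>lborel) \<partial>lborel)
      = (\<integral>\<^sup>+ y. (\<integral>\<^sup>+ x. kern s (x - y) * ?I t x * ?J t y \<partial>lborel) \<partial>lborel)"
      by (rule lborel_pair.Fubini'[symmetric]) measurable
    also have "\<dots> = (\<integral>\<^sup>+ x. (\<integral>\<^sup>+ y. kern s (x - y) * ?I t y * ?J t x \<partial>lborel) \<partial>lborel)"
    proof -
      have "kern s (y - x) = kern s (x - y)" for x y :: 'a using kern_minus[of s "x - y"] by simp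
      then show ?thesis by simp
    qed
    finally have swap: "(\<integral>\<^sup>+ x. (\<integral>\<^sup>+ y. kern s (x - y) * ?I t x * ?J t y \<partial>lborel) \<partial>lborel)
      = (\<integral>\<^sup>+ x. (\<integral>\<^sup>+ y. kern s (x - y) * ?I t y * ?J t x \<partial>lborel) \<partial>lborel)" .
    have "2 * (\<integral>\<^sup>+ x. (\<integral>\<^sup>+ y. kern s (x - y) * ?I t x * ?J t y \<partial>lborel) \<partial>lborel)
      = (\<integral>\<^sup>+ x. (\<integral>\<^sup>+ y. kern s (x - y) * ?I t x * ?J t y \<partial>lborel) \<partial>lborel)
      + (\<integral>\<^sup>+ x. (\<integral>\<^sup>+ y. kern s (x - y) * ?I t y * ?J t x \<partial>lborel) \<partial>lborel)"
      by (simp add: mult_2 swap)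
    also have "\<dots> = (\<integral>\<^sup>+ x. (\<integral>\<^sup>+ y. kern s (x - y) * ?I t x * ?J t y \<partial>lborel) + (\<integral>\<^sup>+ y. kern s (x - y) * ?I t y * ?J t x \<partial>lborel) \<partial>lborel)"
      by (rule nn_integral_add[symmetric]) measurable
    also have "\<dots> = (\<integral>\<^sup>+ x. (\<integral>\<^sup>+ y. kern s (x - y) * (?I t x * ?J t y + ?I t y * ?J t x) \<partial>lborel) \<partial>lborel)"
      by (intro nn_integral_cong) (subst nn_integral_add[symmetric], measurable, simp add: distrib_left mult.assoc)
    finally show "2 * (\<integral>\<^sup>+ x. (\<integral>\<^sup>+ y. kern s (x - y) * ?I t x * ?J t y \<partial>lborel) \<partial>lborel)
      = (\<integral>\<^sup>+ x. (\<integral>\<^sup>+ y. kern s (x - y) * (?I t x * ?J t y + ?I t y * ?J t x) \<partial>lborel) \<partial>lborel)" .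
  qed
  also have "\<dots> = (\<integral>\<^sup>+ x. (\<integral>\<^sup>+ t. (\<integral>\<^sup>+ y. kern s (x - y) * (?I t x * ?J t y + ?I t y * ?J t x) \<partial>lborel) \<partial>lborel) \<partial>lborel)"
    by (rule lborel_pair.Fubini') measurable
  also have "\<dots> = (\<integral>\<^sup>+ x. (\<integral>\<^sup>+ y. (\<integral>\<^sup>+ t. kern s (x - y) * (?I t x * ?J t y + ?I t y * ?J t x) \<partial>lborel) \<partial>lborel) \<partial>lborel)"
    by (intro nn_integral_cong lborel_pair.Fubini') measurable
  also have "\<dots> \<le> (\<integral>\<^sup>+ x. (\<integral>\<^sup>+ y. ennreal \<bar>u x - u y\<bar> * kern s (x - y) \<partial>lborel) \<partial>lborel)"
  proof (intro nn_integral_mono)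
    fix x y
    \<comment> \<open>The separating levels form an interval of length ||u x| - |u y||, which the
      reverse triangle inequality bounds by |u x - u y|.\<close>
    have "(\<integral>\<^sup>+ t. kern s (x - y) * (?I t x * ?J t y + ?I t y * ?J t x) \<partial>lborel)
      = kern s (x - y) * (\<integral>\<^sup>+ t. indicator {\<bar>u y\<bar>..<\<bar>u x\<bar>} t + indicator {\<bar>u x\<bar>..<\<bar>u y\<bar>} t \<partial>lborel)"
      by (subst nn_integral_cmult[symmetric]) (auto intro!: nn_integral_cong simp: I_eq J_eq indicator_def)
    also have "(\<integral>\<^sup>+ t. indicator {\<bar>u y\<bar>..<\<bar>u x\<bar>} t + indicator {\<bar>u x\<bar>..<\<bar>u y\<bar>} t \<partial>lborel) = ennreal \<bar>\<bar>u x\<bar> - \<bar>u y\<bar>\<bar>"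
      by (subst nn_integral_add) (auto simp: abs_if ennreal_neg)
    also have "kern s (x - y) * ennreal \<bar>\<bar>u x\<bar> - \<bar>u y\<bar>\<bar> \<le> kern s (x - y) * ennreal \<bar>u x - u y\<bar>"
      by (intro mult_left_mono ennreal_leI) (auto simp: abs_triangle_ineq3)
    finally show "(\<integral>\<^sup>+ t. kern s (x - y) * (?I t x * ?J t y + ?I t y * ?J t x) \<partial>lborel) \<le> ennreal \<bar>u x - u y\<bar> * kern s (x - y)"
      by (simp add: mult.commute)
  qed
  also have "\<dots> = gagliardo_seminorm s u" by (rule gagliardo_seminorm_lborel[symmetric])
  finally show ?thesis .
qed

text \<open>In dimension one x = (x . e) e, so the set is determined by its coordinates, which form
  an open, connected and bounded subset of the line.\<close>

lemma convex_open_DIM_1: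
  fixes \<Omega> :: "'a::euclidean_space set"
  assumes D: "DIM('a) = 1" "norm e = 1" and \<Omega>: "open \<Omega>" "bounded \<Omega>" "convex \<Omega>" "\<Omega> \<noteq> {}"
  obtains \<alpha> \<beta> where "\<alpha> < \<beta>" "\<Omega> = {x. \<alpha> < x \<bullet> e \<and> x \<bullet> e < \<beta>}"
proof -
  have ee: "e \<bullet> e = 1" using D(2) by (simp add: norm_eq_1)
  have rep: "x = (x \<bullet> e) *\<^sub>R e" for x
  proof -
    have "norm (x - (x \<bullet> e) *\<^sub>R e) = \<bar>(x - (x \<bullet> e) *\<^sub>R e) \<bullet> e\<bar>"
      by (rule abs_inner_DIM_1[OF D, symmetric])
    also have "\<dots> = 0" by (simp add: inner_diff_left ee)
    finally show ?thesis by simp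
  qed
  define S where "S = {t. t *\<^sub>R e \<in> \<Omega>}"
  have mem: "x \<in> \<Omega> \<longleftrightarrow> x \<bullet> e \<in> S" for x using rep[of x] by (simp add: S_def)
  have cont: "continuous_on UNIV (\<lambda>t. t *\<^sub>R e)" by (intro continuous_intros)
  have "open S" unfolding S_def using open_vimage[OF \<Omega>(1) cont] by (simp add: vimage_def)
  moreover have "connected S"
  proof -
    have "convex S"
      using convex_linear_vimage[of "\<lambda>t. t *\<^sub>R e" \<Omega>] \<Omega>(3)
      by (auto simp: S_def vimage_def linear_iff scaleR_add_left)
    then show ?thesis by (rule convex_connected)
  qed
  moreover obtain B where B: "\<And>x. x \<in> \<Omega> \<Longrightarrow> norm x \<le> B" using \<Omega>(2) bounded_iff by blast
  then have S_bd: "\<bar>t\<bar> \<le> B" if "t \<in> S" for t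
    using B[of "t *\<^sub>R e"] that D(2) by (simp add: S_def)
  obtain x0 where "x0 \<in> \<Omega>" using \<Omega>(4) by blast
  then have t0: "x0 \<bullet> e \<in> S" using mem by blast
  define \<alpha> where "\<alpha> = Inf S"
  define \<beta> where "\<beta> = Sup S"
  have bdd: "bdd_below S" "bdd_above S"
    using S_bd by (auto intro!: bdd_belowI[of _ "- B"] bdd_aboveI[of _ B] simp: abs_le_iff) (fastforce dest: S_bd simp: abs_le_iff)+
  have strict: "\<alpha> < t \<and> t < \<beta>" if "t \<in> S" for t
  proof -
    obtain r where r: "r > 0" "\<And>y. dist y t < r \<Longrightarrow> y \<in> S" using \<open>open S\<close> \<open>t \<in> S\<close> unfolding open_dist by blast
    have "t - r / 2 \<in> S" "t + r / 2 \<in> S" using r by (auto simp: dist_real_def)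
    then have "\<alpha> \<le> t - r / 2" "t + r / 2 \<le> \<beta>"
      unfolding \<alpha>_def \<beta>_def using bdd by (auto intro: cInf_lower cSup_upper)
    then show ?thesis using r(1) by linarith
  qed
  have "t \<in> S" if t: "\<alpha> < t" "t < \<beta>" for t
  proof -
    obtain p where p: "p \<in> S" "p < t" using cInf_lessD[of S t] t(1) t0 unfolding \<alpha>_def by blast
    obtain q where q: "q \<in> S" "t < q" using less_cSupD[of S t] t(2) t0 unfolding \<beta>_def by blast
    show ?thesis using connectedD_interval[OF \<open>connected S\<close> p(1) q(1), of t] p(2) q(2) by simp
  qed
  then have "x \<in> \<Omega> \<longleftrightarrow> \<alpha> < x \<bullet> e \<and> x \<bullet> e < \<beta>" for x using mem strict by blast
  then show thesis using strict[OF t0] by (intro that[of \<alpha> \<beta>]) auto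
qed

section \<open>The sharp constant on an interval\<close>

context
  fixes e :: "real ^ 'n" and \<alpha> \<beta> :: real and \<Omega> :: "(real ^ 'n) set" and s :: real
  assumes D: "DIM(real ^ 'n) = 1" and e: "norm e = 1" and s: "0 < s" "s < 1" and \<alpha>\<beta>: "\<alpha> < \<beta>"
  defines "\<Omega> \<equiv> {x. \<alpha> < x \<bullet> e \<and> x \<bullet> e < \<beta>}"
begin

lemma mem_interval: "x \<in> \<Omega> \<longleftrightarrow> \<alpha> < x \<bullet> e \<and> x \<bullet> e < \<beta>"
  by (simp add: \<Omega>_def)

lemma norm_eq_inner: "norm x = \<bar>x \<bullet> e\<bar>"
  by (rule abs_inner_DIM_1[OF D e, symmetric])

lemma inner_e_e: "e \<bullet> e = 1"
  using e by (simp add: norm_eq_1)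

lemma open_interval: "open \<Omega>"
  unfolding \<Omega>_def by (intro open_Collect_conj open_Collect_less continuous_intros)

lemma sets_interval [measurable]: "\<Omega> \<in> sets borel"
  using open_interval by (rule borel_open)

lemma bounded_interval: "bounded \<Omega>"
  by (rule boundedI[of _ "\<bar>\<alpha>\<bar> + \<bar>\<beta>\<bar>"]) (auto simp: mem_interval norm_eq_inner)

lemma interval_neq_UNIV: "\<Omega> \<noteq> UNIV"
  using bounded_interval by auto

lemma emeasure_interval: "emeasure lborel \<Omega> = ennreal (\<beta> - \<alpha>)"
  unfolding \<Omega>_def using \<alpha>\<beta> by (intro emeasure_slab(1)[OF D e]) simp

lemma infdist_interval:
  assumes "x \<in> \<Omega>"
  shows "infdist x (- \<Omega>) = min (x \<bullet> e - \<alpha>) (\<beta> - x \<bullet> e)"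
proof (rule antisym)
  have "\<alpha> *\<^sub>R e \<in> - \<Omega>" "\<beta> *\<^sub>R e \<in> - \<Omega>" by (simp_all add: mem_interval inner_e_e)
  then have "infdist x (- \<Omega>) \<le> dist x (\<alpha> *\<^sub>R e)" "infdist x (- \<Omega>) \<le> dist x (\<beta> *\<^sub>R e)"
    by (simp_all add: infdist_le)
  then show "infdist x (- \<Omega>) \<le> min (x \<bullet> e - \<alpha>) (\<beta> - x \<bullet> e)"
    using assms by (simp add: dist_norm norm_eq_inner inner_diff_left inner_e_e mem_interval)
  have "closed (- \<Omega>)" "- \<Omega> \<noteq> {}" using open_interval interval_neq_UNIV by auto
  then obtain y where y: "y \<in> - \<Omega>" "infdist x (- \<Omega>) = dist x y" using infdist_attains_inf by metis
  then show "min (x \<bullet> e - \<alpha>) (\<beta> - x \<bullet> e) \<le> infdist x (- \<Omega>)"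
    using assms by (auto simp: dist_norm norm_eq_inner inner_diff_left mem_interval not_less)
qed

lemma boundary_dist_interval: "x \<in> \<Omega> \<Longrightarrow> boundary_dist \<Omega> x = infdist x (- \<Omega>)"
  by (rule boundary_dist_eq_infdist[OF open_interval interval_neq_UNIV])

lemma emeasure_layer_interval_le:
  assumes "t > 0"
  shows "emeasure lborel (inner_layer \<Omega> t) \<le> ennreal (2 * t)"
proof -
  have "emeasure lborel (inner_layer \<Omega> t)
    \<le> emeasure lborel ({y. \<alpha> \<le> y \<bullet> e \<and> y \<bullet> e \<le> \<alpha> + t} \<union> {y. \<beta> - t \<le> y \<bullet> e \<and> y \<bullet> e \<le> \<beta>})"
    by (intro emeasure_mono) (auto simp: infdist_interval mem_interval min_def split: if_splits)
  also have "\<dots> \<le> emeasure lborel {y. \<alpha> \<le> y \<bullet> e \<and> y \<bullet> e \<le> \<alpha> + t} + emeasure lborel {y. \<beta> - t \<le> y \<bullet> e \<and> y \<bullet> e \<le> \<beta>}"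
    by (intro emeasure_subadditive) measurable
  also have "\<dots> = ennreal t + ennreal t"
    using assms by (simp add: emeasure_slab(2)[OF D e])
  finally show ?thesis using assms by (simp add: ennreal_plus[symmetric] del: ennreal_plus)
qed

lemma emeasure_layer_interval_ge:
  assumes "t > 0" "t < (\<beta> - \<alpha>) / 2"
  shows "ennreal (2 * t) \<le> emeasure lborel {x \<in> \<Omega>. boundary_dist \<Omega> x \<le> t}"
proof -
  have "ennreal (2 * t) = ennreal t + ennreal t"
    using assms by (simp add: ennreal_plus[symmetric] del: ennreal_plus)
  also have "\<dots> = emeasure lborel {y. \<alpha> < y \<bullet> e \<and> y \<bullet> e < \<alpha> + t} + emeasure lborel {y. \<beta> - t < y \<bullet> e \<and> y \<bullet> e < \<beta>}"
    using assms by (simp add: emeasure_slab(1)[OF D e])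
  also have "\<dots> = emeasure lborel ({y. \<alpha> < y \<bullet> e \<and> y \<bullet> e < \<alpha> + t} \<union> {y. \<beta> - t < y \<bullet> e \<and> y \<bullet> e < \<beta>})"
    using assms by (intro plus_emeasure) auto
  also have "\<dots> \<le> emeasure lborel {x \<in> \<Omega>. boundary_dist \<Omega> x \<le> t}"
  proof (intro emeasure_mono subsetI)
    fix y assume y: "y \<in> {y. \<alpha> < y \<bullet> e \<and> y \<bullet> e < \<alpha> + t} \<union> {y. \<beta> - t < y \<bullet> e \<and> y \<bullet> e < \<beta>}"
    then have "y \<in> \<Omega>" using assms by (auto simp: mem_interval)
    moreover have "infdist y (- \<Omega>) \<le> t" using y by (auto simp: infdist_interval[OF \<open>y \<in> \<Omega>\<close>])
    ultimately show "y \<in> {x \<in> \<Omega>. boundary_dist \<Omega> x \<le> t}" by (simp add: boundary_dist_interval)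
  qed measurable
  finally show ?thesis .
qed

text \<open>Each end contributes t to a layer of depth t until the two meet at half the length.
  Perimeter and boundary part coincide, so nothing is lost between M and m.\<close>

lemma test_domain_interval: "test_domain \<Omega> \<Omega> 2 2 ((\<beta> - \<alpha>) / 2)"
proof -
  have "\<exists>r. 0 < r \<and> r < \<rho> \<and> emeasure lborel (inner_layer \<Omega> r) \<le> ennreal (2 * r)" if "\<rho> > 0" for \<rho> :: real
    using that emeasure_layer_interval_le[of "\<rho> / 2"] by (intro exI[of _ "\<rho> / 2"]) simp
  then show ?thesis
    using \<alpha>\<beta> open_interval bounded_interval emeasure_layer_interval_ge by (simp add: test_domain_def)
qed

text \<open>The splitting radius is the length L: the translation difference of an interval is at
  most 2 |z| and at most 2 L, and these bounds cross at |z| = L. With t0 = L / 2 all powers of L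
  cancel, and the halving of L leaves the factor 2 powr (1 - s) next to 2 / s.\<close>

lemma hardy_constant_interval_le: "hardy_constant s \<Omega> \<le> ennreal (2 powr (2 - s) / s)"
proof -
  define L where "L = \<beta> - \<alpha>"
  have L: "L > 0" using \<alpha>\<beta> by (simp add: L_def)
  have "hardy_constant s \<Omega>
    \<le> ennreal ((2 * (2 * L powr (1 - s) / (1 - s)) + 2 * (2 * L powr (- s) / s) * L) / (2 * (L / 2) powr (1 - s) / (1 - s)))"
    by (rule hardy_constant_le_real[OF test_domain_interval[folded L_def] open_interval interval_neq_UNIV s e L])
       (use L emeasure_interval dir_moment_DIM_1[OF D e] shell_mass_DIM_1[OF D] in \<open>simp_all add: L_def\<close>)
  also have "(2 * (2 * L powr (1 - s) / (1 - s)) + 2 * (2 * L powr (- s) / s) * L) / (2 * (L / 2) powr (1 - s) / (1 - s)) = 2 powr (2 - s) / s"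
  proof -
    have 1: "L powr (1 - s) = L powr (- s) * L" using L by (simp add: powr_diff powr_minus_divide)
    have 2: "(2::real) powr (2 - s) = 2 * 2 powr (1 - s)" by (simp add: powr_diff)
    have 3: "2 * (L / 2) powr (1 - s) / (1 - s) = 2 * L powr (1 - s) / (2 powr (1 - s) * (1 - s))"
      using L by (simp add: powr_divide)
    have "2 * (2 * L powr (1 - s) / (1 - s)) + 2 * (2 * L powr (- s) / s) * L = 4 * L powr (1 - s) / (s * (1 - s))"
      using s unfolding 1 by (simp add: field_simps)
    then show ?thesis unfolding 2 3 using L s by simp
  qed
  finally show ?thesis .
qed

text \<open>Within E the points of depth at most t have measure at most the smaller of 2 t and |E|;
  two end pieces of length |E| / 2 would realize this at every t.\<close>

lemma bathtub_interval:
  assumes [measurable]: "E \<in> sets borel" and "E \<subseteq> \<Omega>"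
  shows "(\<integral>\<^sup>+ x\<in>E. ennreal (1 / boundary_dist \<Omega> x powr s) \<partial>lborel)
    \<le> ennreal (2 * (measure lborel E / 2) powr (1 - s) / (1 - s))"
proof -
  have "bounded E" using bounded_interval assms(2) by (rule bounded_subset)
  then have "emeasure lborel E < \<infinity>" by (rule emeasure_bounded_finite)
  then have em: "emeasure lborel E = ennreal (measure lborel E)" by (intro emeasure_eq_ennreal_measure) auto
  show ?thesis
  proof (cases "measure lborel E = 0")
    case True
    then have "AE x in lborel. x \<notin> E"
      using em by (intro AE_not_in) (auto simp: null_sets_def)
    then have "AE x in lborel. ennreal (1 / boundary_dist \<Omega> x powr s) * indicator E x = 0"
      by eventually_elim simp
    then have "(\<integral>\<^sup>+ x\<in>E. ennreal (1 / boundary_dist \<Omega> x powr s) \<partial>lborel) = 0"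
      by (subst nn_integral_0_iff_AE) auto
    then show ?thesis by simp
  next
    case False
    show ?thesis
    proof (rule nn_integral_layer_le)
      show "0 < boundary_dist \<Omega> x" if "x \<in> E" for x
        using boundary_dist_pos[OF open_interval interval_neq_UNIV] that assms(2) by auto
      show "0 < measure lborel E / 2" using False by (simp add: less_le)
      show "emeasure lborel {x \<in> E. boundary_dist \<Omega> x \<le> t} \<le> ennreal (2 * min t (measure lborel E / 2))" if "0 < t" for t
      proof -
        have "emeasure lborel {x \<in> E. boundary_dist \<Omega> x \<le> t} \<le> emeasure lborel (inner_layer \<Omega> t)"
        proof (intro emeasure_mono subsetI)
          show "inner_layer \<Omega> t \<in> sets lborel" by measurable
        qed (use assms(2) boundary_dist_interval in auto)
        also have "\<dots> \<le> ennreal (2 * t)" using that by (rule emeasure_layer_interval_le)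
        finally have 1: "emeasure lborel {x \<in> E. boundary_dist \<Omega> x \<le> t} \<le> ennreal (2 * t)" .
        have 2: "emeasure lborel {x \<in> E. boundary_dist \<Omega> x \<le> t} \<le> ennreal (2 * (measure lborel E / 2))"
        proof -
          have "emeasure lborel {x \<in> E. boundary_dist \<Omega> x \<le> t} \<le> emeasure lborel E"
            by (rule emeasure_mono) auto
          then show ?thesis using em by simp
        qed
        show ?thesis using 1 2 by (simp add: min_def)
      qed
    qed (use s in auto)
  qed
qed

lemma gagliardo_seminorm_ge_interval:
  assumes u [measurable]: "u \<in> borel_measurable borel" and u0: "\<And>x. x \<notin> \<Omega> \<Longrightarrow> u x = 0"
  shows "ennreal (2 powr (2 - s) / s) * hardy_integral s \<Omega> u \<le> gagliardo_seminorm s u"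
proof -
  define w where "w = (\<lambda>x. ennreal (1 / boundary_dist \<Omega> x powr s) * indicator \<Omega> x)"
  have [measurable]: "w \<in> borel_measurable borel" unfolding w_def by measurable
  have "hardy_integral s \<Omega> u = (\<integral>\<^sup>+ x. ennreal \<bar>u x\<bar> * w x \<partial>lborel)"
    unfolding hardy_integral_lborel w_def
    by (intro nn_integral_cong) (simp add: indicator_def ennreal_mult[symmetric])
  moreover have "ennreal (2 powr (2 - s) / s) * (\<integral>\<^sup>+ x. ennreal \<bar>u x\<bar> * w x \<partial>lborel) \<le> gagliardo_seminorm s u"
  proof (rule gagliardo_seminorm_ge_superlevel[OF u])
    fix t :: real assume "t \<ge> 0"
    define E where "E = {x. \<bar>u x\<bar> > t}"
    have [measurable]: "E \<in> sets borel" unfolding E_def by measurable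
    have sub: "E \<subseteq> \<Omega>" using u0 \<open>t \<ge> 0\<close> by (force simp: E_def)
    have bnd: "bounded E" using bounded_interval sub by (rule bounded_subset)
    define m where "m = measure lborel E"
    have wE: "(\<integral>\<^sup>+ x. w x * indicator E x \<partial>lborel) \<le> ennreal (2 * (m / 2) powr (1 - s) / (1 - s))"
    proof -
      have "(\<integral>\<^sup>+ x. w x * indicator E x \<partial>lborel) = (\<integral>\<^sup>+ x\<in>E. ennreal (1 / boundary_dist \<Omega> x powr s) \<partial>lborel)"
        using sub by (intro nn_integral_cong) (auto simp: w_def indicator_def)
      also have "\<dots> \<le> ennreal (2 * (m / 2) powr (1 - s) / (1 - s))"
        unfolding m_def by (rule bathtub_interval) (use sub in auto)
      finally show ?thesis .
    qed
    have "ennreal (2 powr (2 - s) / s) * (\<integral>\<^sup>+ x. w x * indicator E x \<partial>lborel)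
      \<le> ennreal (2 powr (2 - s) / s) * ennreal (2 * (m / 2) powr (1 - s) / (1 - s))"
      using wE by (rule mult_left_mono) simp
    also have "\<dots> = ennreal (2 powr (2 - s) / s * (2 * (m / 2) powr (1 - s) / (1 - s)))"
      using s by (intro ennreal_mult[symmetric]) auto
    also have "2 powr (2 - s) / s * (2 * (m / 2) powr (1 - s) / (1 - s)) = 2 * (2 * m powr (1 - s) / (s * (1 - s)))"
    proof -
      have "(2::real) powr (2 - s) = 2 * 2 powr (1 - s)" by (simp add: powr_diff)
      then show ?thesis by (simp add: powr_divide m_def)
    qed
    also have "ennreal \<dots> = 2 * ennreal (2 * m powr (1 - s) / (s * (1 - s)))"
      using s by (subst ennreal_mult) auto
    also have "\<dots> \<le> 2 * (\<integral>\<^sup>+ x. (\<integral>\<^sup>+ y. kern s (x - y) * indicator E x * indicator (- E) y \<partial>lborel) \<partial>lborel)"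
    proof (cases "m = 0")
      case False
      then have "m > 0" by (simp add: m_def less_le)
      then show ?thesis
        unfolding m_def by (intro mult_left_mono fractional_isoperimetric_DIM_1[OF D e s _ bnd]) auto
    qed simp
    finally show "ennreal (2 powr (2 - s) / s) * (\<integral>\<^sup>+ x. w x * indicator {x. \<bar>u x\<bar> > t} x \<partial>lborel)
      \<le> 2 * (\<integral>\<^sup>+ x. (\<integral>\<^sup>+ y. kern s (x - y) * indicator {x. \<bar>u x\<bar> > t} x * indicator (- {x. \<bar>u x\<bar> > t}) y \<partial>lborel) \<partial>lborel)"
      by (simp add: E_def)
  qed measurable
  ultimately show ?thesis by simp
qed

lemma hardy_constant_interval: "hardy_constant s \<Omega> = ennreal (2 powr (2 - s) / s)"
proof (rule antisym[OF hardy_constant_interval_le hardy_constant_ge])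
  fix u assume u: "u \<in> test_functions \<Omega>"
  show "ennreal (2 powr (2 - s) / s) * hardy_integral s \<Omega> u \<le> gagliardo_seminorm s u"
    by (rule gagliardo_seminorm_ge_interval[OF test_functions_measurable[OF u] test_functions_outside[OF u]])
qed

text \<open>The smooth estimate with the gradient replaced by a Lipschitz bound for translations in
  L^1, which makes it applicable to indicators and to their differences with cutoffs.\<close>

lemma gagliardo_seminorm_le_DIM_1:
  fixes u :: "real ^ 'n \<Rightarrow> real"
  assumes u [measurable]: "u \<in> borel_measurable borel" and "0 < R" "0 \<le> B" "0 \<le> m"
    and B: "\<And>z. (\<integral>\<^sup>+ x. ennreal \<bar>u (x + z) - u x\<bar> \<partial>lborel) \<le> ennreal (B * norm z)"
    and m: "(\<integral>\<^sup>+ x. ennreal \<bar>u x\<bar> \<partial>lborel) \<le> ennreal m"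
  shows "gagliardo_seminorm s u \<le> ennreal (2 * (B * R powr (1 - s) / (1 - s)) + 2 * (2 * m * R powr (- s) / s))"
proof -
  have "gagliardo_seminorm s u \<le>
    (\<integral>\<^sup>+ z. kern s z * (\<integral>\<^sup>+ x. ennreal \<bar>u (x + z) - u x\<bar> \<partial>lborel) * indicator {z. norm z \<le> R} z \<partial>lborel)
    + shell_mass TYPE(real ^ 'n) * ennreal (R powr (- s) / s) * (2 * (\<integral>\<^sup>+ x. ennreal \<bar>u x\<bar> \<partial>lborel))"
    by (rule gagliardo_seminorm_split[OF u s(1) \<open>0 < R\<close>])
  also have "\<dots> \<le> (\<integral>\<^sup>+ z. ennreal B * (kern s z * ennreal \<bar>z \<bullet> e\<bar> * indicator {z. norm z \<le> R} z) \<partial>lborel)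
    + 2 * ennreal (R powr (- s) / s) * (2 * ennreal m)"
  proof (rule add_mono)
    show "(\<integral>\<^sup>+ z. kern s z * (\<integral>\<^sup>+ x. ennreal \<bar>u (x + z) - u x\<bar> \<partial>lborel) * indicator {z. norm z \<le> R} z \<partial>lborel)
      \<le> (\<integral>\<^sup>+ z. ennreal B * (kern s z * ennreal \<bar>z \<bullet> e\<bar> * indicator {z. norm z \<le> R} z) \<partial>lborel)"
    proof (rule nn_integral_mono)
      fix z
      have "ennreal (B * norm z) = ennreal B * ennreal \<bar>z \<bullet> e\<bar>"
        using \<open>0 \<le> B\<close> by (simp add: norm_eq_inner ennreal_mult)
      then have "kern s z * (\<integral>\<^sup>+ x. ennreal \<bar>u (x + z) - u x\<bar> \<partial>lborel) * indicator {z. norm z \<le> R} z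
        \<le> kern s z * (ennreal B * ennreal \<bar>z \<bullet> e\<bar>) * indicator {z. norm z \<le> R} z"
        using B[of z] by (intro mult_right_mono mult_left_mono) auto
      then show "kern s z * (\<integral>\<^sup>+ x. ennreal \<bar>u (x + z) - u x\<bar> \<partial>lborel) * indicator {z. norm z \<le> R} z
        \<le> ennreal B * (kern s z * ennreal \<bar>z \<bullet> e\<bar> * indicator {z. norm z \<le> R} z)"
        by (simp add: mult_ac)
    qed
    show "shell_mass TYPE(real ^ 'n) * ennreal (R powr (- s) / s) * (2 * (\<integral>\<^sup>+ x. ennreal \<bar>u x\<bar> \<partial>lborel))
      \<le> 2 * ennreal (R powr (- s) / s) * (2 * ennreal m)"
      unfolding shell_mass_DIM_1[OF D] by (intro mult_left_mono m) auto
  qed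
  also have "(\<integral>\<^sup>+ z. ennreal B * (kern s z * ennreal \<bar>z \<bullet> e\<bar> * indicator {z. norm z \<le> R} z) \<partial>lborel)
    = ennreal B * (2 * ennreal (R powr (1 - s) / (1 - s)))"
    using nn_integral_kern_near[OF s(2) \<open>0 < R\<close>, of e] dir_moment_DIM_1[OF D e]
    by (subst nn_integral_cmult) auto
  also have "ennreal B * (2 * ennreal (R powr (1 - s) / (1 - s))) + 2 * ennreal (R powr (- s) / s) * (2 * ennreal m)
    = ennreal B * (ennreal 2 * ennreal (R powr (1 - s) / (1 - s))) + ennreal 2 * ennreal (R powr (- s) / s) * (ennreal 2 * ennreal m)"
    by simp
  also have "\<dots> = ennreal (2 * (B * R powr (1 - s) / (1 - s)) + 2 * (2 * m * R powr (- s) / s))"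
    using assms(2-4) s by (simp add: ennreal_mult[symmetric] ennreal_plus[symmetric] mult_ac del: ennreal_plus ennreal_numeral)
  finally show ?thesis .
qed

lemma translation_difference_interval:
  "(\<integral>\<^sup>+ x. ennreal \<bar>indicat_real \<Omega> (x + z) - indicat_real \<Omega> x\<bar> \<partial>lborel) \<le> ennreal (2 * norm z)"
proof -
  define h where "h = \<bar>z \<bullet> e\<bar>"
  define A where "A = {y. \<alpha> - h \<le> y \<bullet> e \<and> y \<bullet> e \<le> \<alpha>}"
  define A' where "A' = {y. \<alpha> \<le> y \<bullet> e \<and> y \<bullet> e \<le> \<alpha> + h}"
  define B where "B = {y. \<beta> - h \<le> y \<bullet> e \<and> y \<bullet> e \<le> \<beta>}"
  define B' where "B' = {y. \<beta> \<le> y \<bullet> e \<and> y \<bullet> e \<le> \<beta> + h}"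
  have [measurable]: "A \<in> sets borel" "A' \<in> sets borel" "B \<in> sets borel" "B' \<in> sets borel"
    unfolding A_def A'_def B_def B'_def by measurable
  have h: "h \<ge> 0" "h = norm z" by (simp_all add: h_def norm_eq_inner)
  have em: "emeasure lborel A = ennreal h" "emeasure lborel A' = ennreal h" "emeasure lborel B = ennreal h" "emeasure lborel B' = ennreal h"
    unfolding A_def A'_def B_def B'_def using h(1) by (simp_all add: emeasure_slab(2)[OF D e])
  have two: "ennreal (2 * norm z) = ennreal h + ennreal h"
    using h by (simp add: ennreal_plus[symmetric] del: ennreal_plus)
  show ?thesis
  proof (cases "z \<bullet> e \<ge> 0")
    \<comment> \<open>Moving up by h changes the indicator only at points within h below one of the
      endpoints.\<close>
    case True
    have "(\<integral>\<^sup>+ x. ennreal \<bar>indicat_real \<Omega> (x + z) - indicat_real \<Omega> x\<bar> \<partial>lborel) \<le> (\<integral>\<^sup>+ x. indicator A x + indicator B x \<partial>lborel)"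
    proof (rule nn_integral_mono)
      fix x
      show "ennreal \<bar>indicat_real \<Omega> (x + z) - indicat_real \<Omega> x\<bar> \<le> indicator A x + indicator B x"
        using True by (auto simp: indicator_def mem_interval A_def B_def h_def inner_add_left)
    qed
    also have "\<dots> = ennreal h + ennreal h" by (subst nn_integral_add) (simp_all add: em)
    finally show ?thesis by (simp add: two)
  next
    case False
    have "(\<integral>\<^sup>+ x. ennreal \<bar>indicat_real \<Omega> (x + z) - indicat_real \<Omega> x\<bar> \<partial>lborel) \<le> (\<integral>\<^sup>+ x. indicator A' x + indicator B' x \<partial>lborel)"
    proof (rule nn_integral_mono)
      fix x
      show "ennreal \<bar>indicat_real \<Omega> (x + z) - indicat_real \<Omega> x\<bar> \<le> indicator A' x + indicator B' x"
        using False by (auto simp: indicator_def mem_interval A'_def B'_def h_def inner_add_left)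
    qed
    also have "\<dots> = ennreal h + ennreal h" by (subst nn_integral_add) (simp_all add: em)
    finally show ?thesis by (simp add: two)
  qed
qed

lemma gagliardo_seminorm_interval_le:
  "gagliardo_seminorm s (indicat_real \<Omega>) \<le> ennreal (4 * (\<beta> - \<alpha>) powr (1 - s) / (s * (1 - s)))"
proof -
  define L where "L = \<beta> - \<alpha>"
  have L: "L > 0" using \<alpha>\<beta> by (simp add: L_def)
  have "(\<integral>\<^sup>+ x. ennreal \<bar>indicat_real \<Omega> x\<bar> \<partial>lborel) = (\<integral>\<^sup>+ x. indicator \<Omega> x \<partial>lborel)"
    by (intro nn_integral_cong) (simp add: indicator_def)
  also have "\<dots> = ennreal L" by (simp add: emeasure_interval L_def)
  finally have int: "(\<integral>\<^sup>+ x. ennreal \<bar>indicat_real \<Omega> x\<bar> \<partial>lborel) \<le> ennreal L" by simp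
  have "gagliardo_seminorm s (indicat_real \<Omega>) \<le> ennreal (2 * (2 * L powr (1 - s) / (1 - s)) + 2 * (2 * L * L powr (- s) / s))"
    using L int translation_difference_interval by (intro gagliardo_seminorm_le_DIM_1) auto
  also have "2 * (2 * L powr (1 - s) / (1 - s)) + 2 * (2 * L * L powr (- s) / s) = 4 * L powr (1 - s) / (s * (1 - s))"
  proof -
    have 1: "L powr (1 - s) = L * L powr (- s)" using L by (simp add: powr_diff powr_minus_divide)
    show ?thesis using s unfolding 1 by (simp add: field_simps)
  qed
  finally show ?thesis by (simp add: L_def)
qed

lemma hardy_integral_interval_ge:
  "ennreal (2 powr s * (\<beta> - \<alpha>) powr (1 - s) / (1 - s)) \<le> hardy_integral s \<Omega> (indicat_real \<Omega>)"
proof -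
  have "2 powr s * (\<beta> - \<alpha>) powr (1 - s) / (1 - s) = 2 * ((\<beta> - \<alpha>) / 2) powr (1 - s) / (1 - s)"
    using \<alpha>\<beta> by (simp add: powr_divide powr_diff)
  then have "ennreal (2 powr s * (\<beta> - \<alpha>) powr (1 - s) / (1 - s)) = ennreal (2 * ((\<beta> - \<alpha>) / 2) powr (1 - s) / (1 - s))"
    by (simp only:)
  also have "\<dots> \<le> (\<integral>\<^sup>+ x\<in>\<Omega>. ennreal (1 / boundary_dist \<Omega> x powr s) \<partial>lborel)"
    by (rule nn_integral_layer_ge)
       (use s \<alpha>\<beta> emeasure_layer_interval_ge boundary_dist_pos[OF open_interval interval_neq_UNIV] in auto)
  also have "\<dots> = hardy_integral s \<Omega> (indicat_real \<Omega>)"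
    unfolding hardy_integral_lborel by (intro nn_integral_cong) (auto simp: indicator_def)
  finally show ?thesis .
qed

text \<open>The translation bound 6 |z| for the difference does not improve as r shrinks, but its
  mass is at most 2 r. Splitting at R = r turns the two into C r powr (1 - s), which tends to zero
  because s < 1.\<close>

lemma indicator_interval_approx:
  assumes "\<epsilon> > 0"
  shows "\<exists>\<phi>\<in>test_functions \<Omega>. gagliardo_seminorm s (\<lambda>x. indicat_real \<Omega> x - \<phi> x) < ennreal \<epsilon>"
proof -
  \<comment> \<open>12 = 2 * 6 stems from the translation bound 6 |z|, of which 2 is due to the
    indicator and 4 to the cutoff with q = 2; 8 = 2 * 2 * 2 stems from the mass 2 r.\<close>
  define C where "C = 12 / (1 - s) + 8 / s"
  have C: "C > 0" using s by (simp add: C_def add_pos_pos)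
  define r where "r = (\<epsilon> / (2 * C)) powr (1 / (1 - s))"
  have r: "r > 0" using C assms by (simp add: r_def)
  have r_pow: "r powr (1 - s) = \<epsilon> / (2 * C)"
    using C assms s by (simp add: r_def powr_powr)
  obtain \<phi> where \<phi>: "\<phi> \<in> test_functions \<Omega>" "\<And>x. 0 \<le> \<phi> x" "\<And>x. \<phi> x \<le> 1"
    "\<And>x. r \<le> infdist x (- \<Omega>) \<Longrightarrow> \<phi> x = 1" "\<And>x. x \<notin> \<Omega> \<Longrightarrow> \<phi> x = 0"
    "\<And>x. norm (gradient \<phi> x) \<le> 2 / r * indicator (inner_layer \<Omega> r) x"
    by (rule cutoff_exists[OF open_interval bounded_interval r, of 2], simp, rule that)
  have sm: "smooth \<phi>" using \<phi>(1) by (simp add: test_functions_def)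
  note [measurable] = test_functions_measurable[OF \<phi>(1)] measurable_gradient[OF sm]
  have grad: "(\<integral>\<^sup>+ x. ennreal (norm (gradient \<phi> x)) \<partial>lborel) \<le> ennreal 4"
  proof -
    have "(\<integral>\<^sup>+ x. ennreal (norm (gradient \<phi> x)) \<partial>lborel) \<le> ennreal (2 / r) * emeasure lborel (inner_layer \<Omega> r)"
      by (intro nn_integral_le_cmult_emeasure \<phi>(6)) measurable
    also have "\<dots> \<le> ennreal (2 / r) * ennreal (2 * r)"
      by (intro mult_left_mono emeasure_layer_interval_le r) simp
    also have "\<dots> = ennreal 4" using r by (simp add: ennreal_mult[symmetric] del: ennreal_numeral)
    finally show ?thesis .
  qed
  define w where "w = (\<lambda>x. indicat_real \<Omega> x - \<phi> x)"
  have w_meas [measurable]: "w \<in> borel_measurable borel" unfolding w_def by measurable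
  have P: "(\<integral>\<^sup>+ x. ennreal \<bar>w (x + z) - w x\<bar> \<partial>lborel) \<le> ennreal (6 * norm z)" for z
  proof -
    have "(\<integral>\<^sup>+ x. ennreal \<bar>w (x + z) - w x\<bar> \<partial>lborel)
      \<le> (\<integral>\<^sup>+ x. ennreal \<bar>indicat_real \<Omega> (x + z) - indicat_real \<Omega> x\<bar> + ennreal \<bar>\<phi> (x + z) - \<phi> x\<bar> \<partial>lborel)"
    proof (rule nn_integral_mono)
      fix x
      have "\<bar>w (x + z) - w x\<bar> \<le> \<bar>indicat_real \<Omega> (x + z) - indicat_real \<Omega> x\<bar> + \<bar>\<phi> (x + z) - \<phi> x\<bar>"
        unfolding w_def by linarith
      then show "ennreal \<bar>w (x + z) - w x\<bar> \<le> ennreal \<bar>indicat_real \<Omega> (x + z) - indicat_real \<Omega> x\<bar> + ennreal \<bar>\<phi> (x + z) - \<phi> x\<bar>"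
        unfolding ennreal_plus[OF abs_ge_zero abs_ge_zero, symmetric] by (rule ennreal_leI)
    qed
    also have "\<dots> = (\<integral>\<^sup>+ x. ennreal \<bar>indicat_real \<Omega> (x + z) - indicat_real \<Omega> x\<bar> \<partial>lborel) + (\<integral>\<^sup>+ x. ennreal \<bar>\<phi> (x + z) - \<phi> x\<bar> \<partial>lborel)"
      by (rule nn_integral_add) measurable
    also have "\<dots> \<le> ennreal (2 * norm z) + ennreal (4 * norm z)"
    proof (rule add_mono[OF translation_difference_interval])
      have "(\<integral>\<^sup>+ x. ennreal \<bar>\<phi> (x + z) - \<phi> x\<bar> \<partial>lborel) \<le> (\<integral>\<^sup>+ x. ennreal \<bar>gradient \<phi> x \<bullet> z\<bar> \<partial>lborel)"
        by (rule smooth_translation_le[OF sm])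
      also have "\<dots> \<le> (\<integral>\<^sup>+ x. ennreal (norm (gradient \<phi> x)) * ennreal (norm z) \<partial>lborel)"
        by (intro nn_integral_mono) (simp add: ennreal_mult[symmetric] ennreal_leI Cauchy_Schwarz_ineq2)
      also have "\<dots> = (\<integral>\<^sup>+ x. ennreal (norm (gradient \<phi> x)) \<partial>lborel) * ennreal (norm z)"
        by (rule nn_integral_multc) measurable
      also have "\<dots> \<le> ennreal 4 * ennreal (norm z)" using grad by (rule mult_right_mono) simp
      finally show "(\<integral>\<^sup>+ x. ennreal \<bar>\<phi> (x + z) - \<phi> x\<bar> \<partial>lborel) \<le> ennreal (4 * norm z)"
        by (simp add: ennreal_mult[symmetric] del: ennreal_numeral)
    qed
    also have "\<dots> = ennreal (6 * norm z)" by (simp add: ennreal_plus[symmetric] del: ennreal_plus)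
    finally show ?thesis .
  qed
  have m: "(\<integral>\<^sup>+ x. ennreal \<bar>w x\<bar> \<partial>lborel) \<le> ennreal (2 * r)"
  proof -
    have "(\<integral>\<^sup>+ x. ennreal \<bar>w x\<bar> \<partial>lborel) \<le> (\<integral>\<^sup>+ x. indicator (inner_layer \<Omega> r) x \<partial>lborel)"
    proof (rule nn_integral_mono)
      fix x
      show "ennreal \<bar>w x\<bar> \<le> indicator (inner_layer \<Omega> r) x"
      proof (cases "x \<in> inner_layer \<Omega> r")
        case True
        then have "\<bar>w x\<bar> \<le> 1" using \<phi>(2,3)[of x] by (simp add: w_def)
        then show ?thesis using True by simp
      next
        case False
        then have "w x = 0" using \<phi>(4,5)[of x] by (cases "x \<in> \<Omega>") (auto simp: w_def)
        then show ?thesis by simp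
      qed
    qed
    also have "\<dots> = emeasure lborel (inner_layer \<Omega> r)"
      by (rule nn_integral_indicator) measurable
    also have "\<dots> \<le> ennreal (2 * r)" using r by (rule emeasure_layer_interval_le)
    finally show ?thesis .
  qed
  have "gagliardo_seminorm s w \<le> ennreal (2 * (6 * r powr (1 - s) / (1 - s)) + 2 * (2 * (2 * r) * r powr (- s) / s))"
    using P m r by (intro gagliardo_seminorm_le_DIM_1 w_meas) auto
  also have "2 * (6 * r powr (1 - s) / (1 - s)) + 2 * (2 * (2 * r) * r powr (- s) / s) = C * r powr (1 - s)"
  proof -
    have "r powr (1 - s) = r * r powr (- s)" using r by (simp add: powr_diff powr_minus_divide)
    then show ?thesis by (simp add: C_def distrib_right)
  qed
  also have "\<dots> = \<epsilon> / 2" using C by (simp add: r_pow)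
  also have "ennreal (\<epsilon> / 2) < ennreal \<epsilon>" using assms by (simp add: ennreal_less_iff)
  finally show ?thesis using \<phi>(1) unfolding w_def by blast
qed

text \<open>Neither functional is integrated exactly: the upper bound C \<eta> for the seminorm, the
  lower bound \<eta> for the Hardy integral and the inequality with constant C close a circle and
  force equality throughout.\<close>

lemma hardy_constant_attained_interval: "hardy_constant_attained s \<Omega>"
proof -
  define L where "L = \<beta> - \<alpha>"
  define f where "f = indicat_real \<Omega>"
  define \<eta> where "\<eta> = 2 powr s * L powr (1 - s) / (1 - s)"
  define C where "C = 2 powr (2 - s) / s"
  have L: "L > 0" using \<alpha>\<beta> by (simp add: L_def)
  have pos: "\<eta> > 0" "C > 0" using L s by (simp_all add: \<eta>_def C_def)
  have f_meas [measurable]: "f \<in> borel_measurable borel" unfolding f_def by measurable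
  have C\<eta>: "C * \<eta> = 4 * L powr (1 - s) / (s * (1 - s))"
    by (simp add: C_def \<eta>_def powr_diff)
  have upper: "gagliardo_seminorm s f \<le> ennreal (C * \<eta>)"
    unfolding C\<eta> f_def L_def by (rule gagliardo_seminorm_interval_le)
  have lower: "ennreal C * hardy_integral s \<Omega> f \<le> gagliardo_seminorm s f"
    unfolding C_def by (rule gagliardo_seminorm_ge_interval[OF f_meas]) (simp add: f_def)
  have "ennreal C * hardy_integral s \<Omega> f \<le> ennreal C * ennreal \<eta>"
    using order_trans[OF lower upper] pos by (simp add: ennreal_mult)
  then have "ennreal (1 / C) * (ennreal C * hardy_integral s \<Omega> f) \<le> ennreal (1 / C) * (ennreal C * ennreal \<eta>)"
    by (rule mult_left_mono) simp
  moreover have "ennreal (1 / C) * ennreal C = 1" using pos by (simp add: ennreal_mult[symmetric])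
  ultimately have "hardy_integral s \<Omega> f \<le> ennreal \<eta>" by (simp add: mult.assoc[symmetric])
  then have hardy: "hardy_integral s \<Omega> f = ennreal \<eta>"
    using hardy_integral_interval_ge unfolding f_def \<eta>_def L_def by (rule antisym)
  have gag: "gagliardo_seminorm s f = ennreal (C * \<eta>)"
    using upper lower pos unfolding hardy by (intro antisym) (simp_all add: ennreal_mult)
  define u where "u = (\<lambda>x. (1 / \<eta>) * f x)"
  have u_meas [measurable]: "u \<in> borel_measurable borel" unfolding u_def by measurable
  have "hardy_integral s \<Omega> u = 1"
    unfolding u_def hardy_integral_cmult[OF f_meas sets_interval] hardy using pos by (simp add: ennreal_mult[symmetric])
  moreover have gag_u: "gagliardo_seminorm s u = ennreal C"
    unfolding u_def gagliardo_seminorm_cmult[OF f_meas] gag using pos by (simp add: ennreal_mult[symmetric])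
  moreover have "u \<in> sobolev0 s \<Omega>"
  proof -
    have "(\<integral>\<^sup>+ x. ennreal (\<bar>u x\<bar> powr (real DIM(real ^ 'n) / (real DIM(real ^ 'n) - s))) \<partial>lborel)
      \<le> (\<integral>\<^sup>+ x. ennreal ((1 / \<eta>) powr (real DIM(real ^ 'n) / (real DIM(real ^ 'n) - s))) * indicator \<Omega> x \<partial>lborel)"
      using pos by (intro nn_integral_mono) (simp add: u_def f_def indicator_def)
    also have "\<dots> = ennreal ((1 / \<eta>) powr (real DIM(real ^ 'n) / (real DIM(real ^ 'n) - s))) * emeasure lborel \<Omega>"
      by (rule nn_integral_cmult_indicator) measurable
    also have "\<dots> < \<infinity>" by (simp add: emeasure_interval ennreal_mult_less_top)
    finally have "u \<in> sobolev_ambient s"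
      unfolding sobolev_ambient_def nn_integral_completion using gag_u measurable_completion[of u lborel borel] by simp
    moreover have "\<exists>\<phi>\<in>test_functions \<Omega>. gagliardo_seminorm s (\<lambda>x. u x - \<phi> x) < ennreal \<epsilon>" if "\<epsilon> > 0" for \<epsilon>
    proof -
      \<comment> \<open>The approximation is requested up to \<epsilon> \<eta>, since dividing by
        \<eta> scales the seminorm as well.\<close>
      have "\<epsilon> * \<eta> > 0" using that pos by simp
      then obtain \<phi> where \<phi>: "\<phi> \<in> test_functions \<Omega>" "gagliardo_seminorm s (\<lambda>x. f x - \<phi> x) < ennreal (\<epsilon> * \<eta>)"
        using indicator_interval_approx unfolding f_def by blast
      note [measurable] = test_functions_measurable[OF \<phi>(1)]
      have "(\<lambda>x. u x - (1 / \<eta>) * \<phi> x) = (\<lambda>x. (1 / \<eta>) * (f x - \<phi> x))"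
        by (simp add: u_def right_diff_distrib)
      then have "gagliardo_seminorm s (\<lambda>x. u x - (1 / \<eta>) * \<phi> x) = ennreal (1 / \<eta>) * gagliardo_seminorm s (\<lambda>x. f x - \<phi> x)"
        using pos by (simp only: gagliardo_seminorm_cmult[of "\<lambda>x. f x - \<phi> x"]) (subst gagliardo_seminorm_cmult, auto)
      also have "\<dots> < ennreal (1 / \<eta>) * ennreal (\<epsilon> * \<eta>)"
        using \<phi>(2) pos by (intro ennreal_mult_strict_left_mono) auto
      also have "\<dots> = ennreal \<epsilon>" using pos that by (simp add: ennreal_mult[symmetric])
      finally show ?thesis
        using test_functions_cmult[OF \<phi>(1), of "1 / \<eta>"] by (rule bexI[of _ "\<lambda>x. 1 / \<eta> * \<phi> x"])
    qed
    ultimately show ?thesis by (simp add: sobolev0_def)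
  qed
  ultimately show ?thesis
    unfolding hardy_constant_attained_def hardy_constant_interval C_def by blast
qed

end

text \<open>In dimension one the moment is 2 for every exponent, so the lower bound is 4 / s. The
  interval (0, 1), one end of which lies on the boundary, gives the same value from above with M =
  2, m = 1 and R = 1, already at each fixed s.\<close>

lemma hardy_constant_half_line:
  fixes k :: "'n::finite"
  assumes D: "DIM(real ^ 'n) = 1" and s: "0 < s" "s < 1"
  shows "hardy_constant s (half_space k) = ennreal (4 / s)"
proof (rule antisym)
  define e :: "real ^ 'n" where "e = axis k 1"
  have e: "norm e = 1" by (simp add: e_def)
  have N: "CARD('n) = 1" using D by simp
  have "2 * dir_moment e s * ennreal (1 / s) \<le> hardy_constant s (half_space k)"
    by (rule hardy_constant_ge_half_space[OF e s(1)])
  moreover have "2 * dir_moment e s * ennreal (1 / s) = ennreal (4 / s)"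
  proof -
    have "2 * dir_moment e s = ennreal 4" using dir_moment_DIM_1[OF D e] by simp
    then show ?thesis using s by (simp add: ennreal_mult[symmetric] del: ennreal_numeral)
  qed
  ultimately show "ennreal (4 / s) \<le> hardy_constant s (half_space k)" by simp
  define E :: "(real ^ 'n) set" where "E = box 0 (\<chi> i. if i = k then 1 else 1)"
  have em: "emeasure lborel E = ennreal 1"
    using hardy_constant_half_space_test_box(4)[of 1 k] N by (simp add: E_def)
  have "hardy_constant s (half_space k)
    \<le> ennreal ((2 * (2 * 1 powr (1 - s) / (1 - s)) + 2 * (2 * 1 powr (- s) / s) * 1) / (1 * 1 powr (1 - s) / (1 - s)))"
    by (rule hardy_constant_le_real[OF _ open_half_space half_space_neq_UNIV s e])
       (use test_domain_half_space[of 1 k] N em dir_moment_DIM_1[OF D e] shell_mass_DIM_1[OF D] in \<open>simp_all add: E_def\<close>)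
  also have "(2 * (2 * 1 powr (1 - s) / (1 - s)) + 2 * (2 * 1 powr (- s) / s) * 1) / (1 * 1 powr (1 - s) / (1 - s)) = 4 / s"
    using s by (simp add: field_simps)
  finally show "hardy_constant s (half_space k) \<le> ennreal (4 / s)" .
qed

theorem theorem1p2:
  fixes \<Omega> :: "(real ^ 'n) set" and k :: 'n
  assumes "\<Omega> \<noteq> {}" and "\<Omega> \<noteq> UNIV" and "bounded \<Omega>" and "open \<Omega>" and "convex \<Omega>"
  shows "(CARD('n) = 1 \<longrightarrow>
            (\<forall>s\<in>{0<..<1::real}.
               hardy_constant s \<Omega> = ennreal (2 powr (- s)) * hardy_constant s (half_space k) \<and>
               hardy_constant s \<Omega> = ennreal (2 powr (2 - s) / s) \<and>
               hardy_constant_attained s \<Omega>)) \<and>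
         (CARD('n) \<ge> 2 \<longrightarrow>
            ((\<lambda>s. hardy_constant s \<Omega> / hardy_constant s (half_space k)) \<longlongrightarrow> 1 / 2)
              (at_left (1::real)))"
proof (intro conjI impI ballI)
  have cvx: "open \<Omega>" "bounded \<Omega>" "convex \<Omega>" "\<Omega> \<noteq> {}" using assms by auto
  show "((\<lambda>s. hardy_constant s \<Omega> / hardy_constant s (half_space k)) \<longlongrightarrow> 1 / 2) (at_left 1)"
    by (rule hardy_constant_ratio_tendsto[OF cvx])
  fix s :: real assume "CARD('n) = 1" "s \<in> {0<..<1}"
  then have D: "DIM(real ^ 'n) = 1" and s: "0 < s" "s < 1" by simp_all
  have e: "norm (axis k 1 :: real ^ 'n) = 1" by simp
  obtain \<alpha> \<beta> where \<Omega>: "\<alpha> < \<beta>" "\<Omega> = {x. \<alpha> < x \<bullet> axis k 1 \<and> x \<bullet> axis k 1 < \<beta>}"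
    using convex_open_DIM_1[OF D e cvx] by metis
  show const: "hardy_constant s \<Omega> = ennreal (2 powr (2 - s) / s)"
    unfolding \<Omega>(2) by (rule hardy_constant_interval[OF D e s \<Omega>(1)])
  show "hardy_constant_attained s \<Omega>"
    unfolding \<Omega>(2) by (rule hardy_constant_attained_interval[OF D e s \<Omega>(1)])
  have "2 powr (2 - s) / s = 2 powr (- s) * (4 / s)"
    by (simp add: powr_diff powr_minus_divide)
  then show "hardy_constant s \<Omega> = ennreal (2 powr (- s)) * hardy_constant s (half_space k)"
    unfolding const hardy_constant_half_line[OF D s] using s by (simp add: ennreal_mult[symmetric])
qed

end
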